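(* Let $\mathfrak{g}=(\Gamma,lb)$ be a fine-labelled rooted tree and let $q_{\mathfrak{g}}:V_{\mathfrak{g}}\to Z=\mathrm{Spec}(\mathbb{C}[h])$ be the generalized Danielewski surface defined by $\mathfrak{g}$. Then every $\mathbb{G}_{a,Z}$-action on $V_{\mathfrak{g}}$ is induced by (i.e. is the restriction to the closed subscheme $V_{\mathfrak{g}}$ of) a $\mathbb{G}_{a,Z}$-action on the ambient space $\mathbb{A}_Z^{d(\Gamma)+1}=\mathrm{Spec}(\mathbb{C}[h][\Gamma])$.
   Context: Trees. A rooted tree $\Gamma$ is a nonempty finite poset $(N(\Gamma),\le)$ with a unique minimal element $e_0$ (the root) such that $(\downarrow e)=\{e'\le e\}$ is a chain for every node $e$. Maximal elements are the leaves, $\mathrm{Leaves}(\Gamma)$; $\mathbf{P}(\Gamma)=N(\Gamma)\setminus\mathrm{Leaves}(\Gamma)$. $\mathrm{Anc}(e)=(\downarrow e)\setminus\{e\}$; for $e\ne e_0$, $\mathrm{Par}(e)$ is the maximal element of $\mathrm{Anc}(e)$. $\mathrm{Child}(e)$ is the set of minimal elements of $\{e'>e\}$. A fine-labelled rooted tree $\mathfrak{g}=(\Gamma,lb)$ is a rooted tree with a function $lb:N(\Gamma)\setminus\{e_0\}\to\mathbb{C}$ such that $lb(f)\ne lb(f')$ for distinct nodes $f,f'$ with the same parent. The scheme $V_{\mathfrak{g}}$. Let $A=\mathbb{C}[h]$ (polynomial ring in one variable), $Z=\mathrm{Spec}(A)$. $A[\Gamma]=\mathbb{C}[h][\Gamma]$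 is the polynomial ring over $A$ in the variables $X_0$ and $X_e$, $e\in\mathbf{P}(\Gamma)$; $d(\Gamma)=\mathrm{Card}(\mathbf{P}(\Gamma))$. Convention: $X_{\mathrm{Par}(e_0)}:=X_0$. For $e\in\mathbf{P}(\Gamma)$ and $J\subset\mathrm{Child}(e)$ put $S_e^J=\prod_{g\in\mathrm{Child}(e)\setminus J}(X_{\mathrm{Par}(e)}-lb(g))$ and $S_e=S_e^{\emptyset}$. Put $R_{e_0}=1$, and recursively $R_e=S_{\mathrm{Par}(e)}^{\{e\}}R_{\mathrm{Par}(e)}$ for $e\ne e_0$; for $e\in\mathbf{P}(\Gamma)$ put $Q_e=S_eR_e$. $I_{\mathfrak{g}}\subset A[\Gamma]$ is the ideal generated by $\Delta_{0,e}=hX_e-Q_e$ ($e\in\mathbf{P}(\Gamma)$) and $\Delta_{e',e}=R_{e''}^{-1}(Q_{e'}X_e-Q_eX_{e'})=(X_{\mathrm{Par}(e')}-lb(e''))X_e-X_{e'}\,(Q_e/R_{e''})$ for $e\in\mathbf{P}(\Gamma)$, $e'\in\mathrm{Anc}(e)$, where $e''$ is the unique element of $\mathrm{Child}(e')\cap(\downarrow e)$. Put $B_{\mathfrak{g}}=A[\Gamma]/I_{\mathfrak{g}}$, $V_{\mathfrak{g}}=\mathrm{Spec}(B_{\mathfrak{g}})\subset\mathrm{Spec}(A[\Gamma])$, and $q_{\mathfrak{g}}:V_{\mathfrak{g}}\to Z$ the morphism induced by $A\to B_{\mathfrak{g}}$. $\mathbb{G}_{a,Z}$-actions on an affine $Z$-scheme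 $\mathrm{Spec}(B)$ (actions over $Z$ of the additive group scheme) correspond to locally nilpotent $A$-derivations of $B$. *)

theory Defs
  imports
    Complex_Main
    "HOL-Library.Poly_Mapping"
    "HOL-Computational_Algebra.Polynomial"
    "HOL-Algebra.UnivPoly"
    "HOL-Algebra.QuotRing"
begin

section \<open>Fine-labelled rooted trees\<close>

text \<open>A pair of nodes \<open>(e, f)\<close> in \<open>tord\<close> means that \<open>e\<close> lies below \<open>f\<close>, so the root
  is the smallest node.  The label of the root is a junk value that is never used.\<close>

record 'n fl_tree =
  nodes :: "'n set"
  tord :: "('n \<times> 'n) set"
  lb :: "'n \<Rightarrow> complex"

definition min_elts :: "('n \<times> 'n) set \<Rightarrow> 'n set \<Rightarrow> 'n set" where
  "min_elts r S = {x \<in> S. \<forall>y\<in>S. (y, x) \<in> r \<longrightarrow> y = x}"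

definition max_elts :: "('n \<times> 'n) set \<Rightarrow> 'n set \<Rightarrow> 'n set" where
  "max_elts r S = {x \<in> S. \<forall>y\<in>S. (x, y) \<in> r \<longrightarrow> y = x}"

definition down :: "('n, 'x) fl_tree_scheme \<Rightarrow> 'n \<Rightarrow> 'n set" where
  "down \<Gamma> e = {e' \<in> nodes \<Gamma>. (e', e) \<in> tord \<Gamma>}"

definition rooted_tree :: "('n, 'x) fl_tree_scheme \<Rightarrow> bool" where
  "rooted_tree \<Gamma> \<longleftrightarrow>
     finite (nodes \<Gamma>) \<and> nodes \<Gamma> \<noteq> {} \<and> partial_order_on (nodes \<Gamma>) (tord \<Gamma>) \<and>
     (\<exists>!e. e \<in> min_elts (tord \<Gamma>) (nodes \<Gamma>)) \<and>
     (\<forall>e\<in>nodes \<Gamma>. total_on (down \<Gamma> e) (tord \<Gamma>))"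

definition root_node :: "('n, 'x) fl_tree_scheme \<Rightarrow> 'n" where
  "root_node \<Gamma> = (THE e. e \<in> min_elts (tord \<Gamma>) (nodes \<Gamma>))"

definition Leaves :: "('n, 'x) fl_tree_scheme \<Rightarrow> 'n set" where
  "Leaves \<Gamma> = max_elts (tord \<Gamma>) (nodes \<Gamma>)"

definition inner_nodes :: "('n, 'x) fl_tree_scheme \<Rightarrow> 'n set" where
  "inner_nodes \<Gamma> = nodes \<Gamma> - Leaves \<Gamma>"

definition Anc :: "('n, 'x) fl_tree_scheme \<Rightarrow> 'n \<Rightarrow> 'n set" where
  "Anc \<Gamma> e = down \<Gamma> e - {e}"

definition Par :: "('n, 'x) fl_tree_scheme \<Rightarrow> 'n \<Rightarrow> 'n" where
  "Par \<Gamma> e = (THE p. p \<in> max_elts (tord \<Gamma>) (Anc \<Gamma> e))"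

definition Child :: "('n, 'x) fl_tree_scheme \<Rightarrow> 'n \<Rightarrow> 'n set" where
  "Child \<Gamma> e = min_elts (tord \<Gamma>) {e' \<in> nodes \<Gamma>. (e, e') \<in> tord \<Gamma> \<and> e' \<noteq> e}"

definition fine_labelled_rooted_tree :: "('n, 'x) fl_tree_scheme \<Rightarrow> bool" where
  "fine_labelled_rooted_tree \<gamma> \<longleftrightarrow>
     rooted_tree \<gamma> \<and>
     (\<forall>f \<in> nodes \<gamma> - {root_node \<gamma>}. \<forall>f' \<in> nodes \<gamma> - {root_node \<gamma>}.
        f \<noteq> f' \<and> Par \<gamma> f = Par \<gamma> f' \<longrightarrow> lb \<gamma> f \<noteq> lb \<gamma> f')"

lemma Par_props:
  assumes "rooted_tree \<Gamma>" and e: "e \<in> nodes \<Gamma>" and "e \<noteq> root_node \<Gamma>"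
  shows Par_in_max: "Par \<Gamma> e \<in> max_elts (tord \<Gamma>) (Anc \<Gamma> e)"
    and Par_in_Anc: "Par \<Gamma> e \<in> Anc \<Gamma> e"
    and Anc_Par_psubset: "Anc \<Gamma> (Par \<Gamma> e) \<subset> Anc \<Gamma> e"
proof -
  let ?r = "tord \<Gamma>" and ?N = "nodes \<Gamma>"
  have fin: "finite ?N" and po: "partial_order_on ?N ?r"
    and ex1: "\<exists>!e. e \<in> min_elts ?r ?N" and tot: "total_on (down \<Gamma> e) ?r"
    using assms by (auto simp: rooted_tree_def)
  have tr: "trans ?r" and an: "antisym ?r"
    using po by (auto simp: partial_order_on_def preorder_on_def)
  have root: "root_node \<Gamma> \<in> min_elts ?r ?N"
    unfolding root_node_def by (rule theI'[OF ex1])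
  have finA: "finite (Anc \<Gamma> e)"
    using fin by (auto simp: Anc_def down_def)
  have ne: "Anc \<Gamma> e \<noteq> {}"
  proof
    assume "Anc \<Gamma> e = {}"
    then have "e \<in> min_elts ?r ?N"
      using e by (auto simp: Anc_def down_def min_elts_def)
    with root ex1 assms(3) show False by blast
  qed
  define S where "S = (\<lambda>x y. (x, y) \<in> ?r \<and> x \<noteq> y)"
  have "asymp_on (Anc \<Gamma> e) S" "transp_on (Anc \<Gamma> e) S"
    using tr an unfolding S_def asymp_on_def transp_on_def trans_def antisym_def by blast+
  then obtain m where m: "m \<in> Anc \<Gamma> e" "\<forall>x\<in>Anc \<Gamma> e. x \<noteq> m \<longrightarrow> \<not> S m x"
    using Finite_Set.bex_max_element[OF finA _ _ ne] by blast
  have mm: "m \<in> max_elts ?r (Anc \<Gamma> e)"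
    using m by (auto simp: S_def max_elts_def)
  have uniq: "x = m" if "x \<in> max_elts ?r (Anc \<Gamma> e)" for x
    using tot that mm unfolding total_on_def max_elts_def Anc_def by blast
  show P: "Par \<Gamma> e \<in> max_elts ?r (Anc \<Gamma> e)"
    unfolding Par_def using mm uniq by (rule theI)
  then show A: "Par \<Gamma> e \<in> Anc \<Gamma> e" by (simp add: max_elts_def)
  show "Anc \<Gamma> (Par \<Gamma> e) \<subset> Anc \<Gamma> e"
  proof
    show "Anc \<Gamma> (Par \<Gamma> e) \<subseteq> Anc \<Gamma> e"
      using A tr an unfolding Anc_def down_def trans_def antisym_def by blast
    show "Anc \<Gamma> (Par \<Gamma> e) \<noteq> Anc \<Gamma> e"
      using A by (auto simp: Anc_def)
  qed
qed


section \<open>The polynomial ring over \<open>A\<close> attached to a tree\<close>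

text \<open>\<open>A\<close> is \<^typ>\<open>complex poly\<close>.  The variable \<open>X\<^sub>0\<close> is indexed by \<^const>\<open>None\<close> and
  \<open>X\<^sub>e\<close> by \<open>Some e\<close>; a polynomial maps exponent vectors to coefficients in \<open>A\<close>.  The type
  has a variable for every element of the type of nodes; the variables actually present are
  cut out by the carrier of \<open>A_ring\<close> below.\<close>

type_synonym 'n apoly = "('n option \<Rightarrow>\<^sub>0 nat) \<Rightarrow>\<^sub>0 complex poly"

definition Const :: "complex poly \<Rightarrow> 'n apoly" where
  "Const a = Poly_Mapping.single 0 a"

definition X :: "'n option \<Rightarrow> 'n apoly" where
  "X v = Poly_Mapping.single (Poly_Mapping.single v 1) 1"

definition hA :: "complex poly" where
  "hA = [:0, 1:]"

definition A_ring :: "('n, 'x) fl_tree_scheme \<Rightarrow> 'n apoly ring" where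
  "A_ring \<Gamma> =
     \<lparr>carrier = {p. \<forall>m \<in> Poly_Mapping.keys p.
                     Poly_Mapping.keys m \<subseteq> insert None (Some ` inner_nodes \<Gamma>)},
      mult = (*), one = 1, zero = 0, add = (+)\<rparr>"

definition ParX :: "('n, 'x) fl_tree_scheme \<Rightarrow> 'n \<Rightarrow> 'n option" where
  "ParX \<Gamma> e = (if e = root_node \<Gamma> then None else Some (Par \<Gamma> e))"

definition S_poly :: "('n, 'x) fl_tree_scheme \<Rightarrow> 'n \<Rightarrow> 'n set \<Rightarrow> 'n apoly" where
  "S_poly \<gamma> e J = (\<Prod>g \<in> Child \<gamma> e - J. X (ParX \<gamma> e) - Const [:lb \<gamma> g:])"

text \<open>Outside rooted trees the value of \<open>R_poly\<close> is junk; the guard makes the recursion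
  along parents terminate.\<close>

function R_poly :: "('n, 'x) fl_tree_scheme \<Rightarrow> 'n \<Rightarrow> 'n apoly" where
  "R_poly \<gamma> e =
     (if rooted_tree \<gamma> \<and> e \<in> nodes \<gamma> \<and> e \<noteq> root_node \<gamma>
      then S_poly \<gamma> (Par \<gamma> e) {e} * R_poly \<gamma> (Par \<gamma> e) else 1)"
  by pat_completeness auto
termination
proof (relation "measure (\<lambda>(\<gamma>, e). card (Anc \<gamma> e))")
  fix \<gamma> :: "('n, 'x) fl_tree_scheme" and e
  assume *: "rooted_tree \<gamma> \<and> e \<in> nodes \<gamma> \<and> e \<noteq> root_node \<gamma>"
  then have "finite (Anc \<gamma> e)" by (auto simp: rooted_tree_def Anc_def down_def)
  with * have "card (Anc \<gamma> (Par \<gamma> e)) < card (Anc \<gamma> e)"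
    by (meson psubset_card_mono Anc_Par_psubset)
  then show "((\<gamma>, Par \<gamma> e), \<gamma>, e) \<in> measure (\<lambda>(\<gamma>, e). card (Anc \<gamma> e))"
    by simp
qed simp

declare R_poly.simps [simp del]

definition Q_poly :: "('n, 'x) fl_tree_scheme \<Rightarrow> 'n \<Rightarrow> 'n apoly" where
  "Q_poly \<gamma> e = S_poly \<gamma> e {} * R_poly \<gamma> e"

text \<open>The quotient \<open>p / d\<close> of a polynomial by a nonzero divisor of it.  It is unique since the
  polynomial ring is a domain.\<close>

definition exact_quot :: "'n apoly \<Rightarrow> 'n apoly \<Rightarrow> 'n apoly" where
  "exact_quot p d = (THE q. q * d = p)"

text \<open>\<open>next_node \<gamma> e' e\<close> is the node \<open>e''\<close>, the child of \<open>e'\<close> on the way up to \<open>e\<close>.\<close>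

definition next_node :: "('n, 'x) fl_tree_scheme \<Rightarrow> 'n \<Rightarrow> 'n \<Rightarrow> 'n" where
  "next_node \<gamma> e' e = (THE e''. e'' \<in> Child \<gamma> e' \<inter> down \<gamma> e)"

definition Delta0 :: "('n, 'x) fl_tree_scheme \<Rightarrow> 'n \<Rightarrow> 'n apoly" where
  "Delta0 \<gamma> e = Const hA * X (Some e) - Q_poly \<gamma> e"

definition Delta :: "('n, 'x) fl_tree_scheme \<Rightarrow> 'n \<Rightarrow> 'n \<Rightarrow> 'n apoly" where
  "Delta \<gamma> e' e =
     (let e'' = next_node \<gamma> e' e in
      (X (ParX \<gamma> e') - Const [:lb \<gamma> e'':]) * X (Some e)
        - X (Some e') * exact_quot (Q_poly \<gamma> e) (R_poly \<gamma> e''))"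

definition I_ideal :: "('n, 'x) fl_tree_scheme \<Rightarrow> 'n apoly set" where
  "I_ideal \<gamma> = genideal (A_ring \<gamma>)
     ({Delta0 \<gamma> e | e. e \<in> inner_nodes \<gamma>} \<union>
      {Delta \<gamma> e' e | e e'. e \<in> inner_nodes \<gamma> \<and> e' \<in> Anc \<gamma> e})"

definition B_ring :: "('n, 'x) fl_tree_scheme \<Rightarrow> 'n apoly set ring" where
  "B_ring \<gamma> = A_ring \<gamma> Quot I_ideal \<gamma>"

definition B_proj :: "('n, 'x) fl_tree_scheme \<Rightarrow> 'n apoly \<Rightarrow> 'n apoly set" where
  "B_proj \<gamma> p = I_ideal \<gamma> +>\<^bsub>A_ring \<gamma>\<^esub> p"


section \<open>Actions of the additive group scheme\<close>

text \<open>All schemes involved are affine over \<open>Z = Spec A\<close>, so everything is expressed in the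
  opposite category of \<open>A\<close>-algebras.  The additive group scheme is \<open>Spec A[t]\<close> with
  comultiplication \<open>t \<mapsto> s + t\<close> and counit \<open>t \<mapsto> 0\<close>.  A morphism
  \<open>G\<^sub>a \<times>\<^sub>Z Spec C \<rightarrow> Spec B\<close> over \<open>Z\<close> is an \<open>A\<close>-algebra homomorphism
  \<open>B \<rightarrow> C \<otimes>\<^sub>A A[t] = C[t]\<close>.\<close>

text \<open>The homomorphism \<open>R[t] \<rightarrow> S[t]\<close> that applies \<open>f\<close> to the coefficients.\<close>

definition UP_map :: "('a, 'x) ring_scheme \<Rightarrow> ('a \<Rightarrow> 'b) \<Rightarrow> (nat \<Rightarrow> 'a) \<Rightarrow> (nat \<Rightarrow> 'b)" where
  "UP_map R f p = (\<lambda>n. f (up_ring.coeff (UP R) p n))"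

text \<open>The homomorphism \<open>R[t] \<rightarrow> R[t][s]\<close> that fixes \<open>R\<close> and sends \<open>t\<close> to \<open>s + t\<close>, where
  \<open>R[t][s]\<close> is \<^term>\<open>UP (UP R)\<close>.\<close>

definition Ga_comult :: "('a, 'x) ring_scheme \<Rightarrow> (nat \<Rightarrow> 'a) \<Rightarrow> (nat \<Rightarrow> nat \<Rightarrow> 'a)" where
  "Ga_comult R = eval R (UP (UP R))
     (\<lambda>a. up_ring.monom (UP (UP R)) (up_ring.monom (UP R) a 0) 0)
     (up_ring.monom (UP (UP R)) \<one>\<^bsub>UP R\<^esub> 1
        \<oplus>\<^bsub>UP (UP R)\<^esub> up_ring.monom (UP (UP R)) (up_ring.monom (UP R) \<one>\<^bsub>R\<^esub> 1) 0)"

text \<open>\<open>Ga_action R \<phi> \<mu>\<close>: the map \<open>\<mu> : R \<rightarrow> R[t]\<close> is the comorphism of an action of the additive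
  group scheme over \<open>A\<close> on \<open>Spec R\<close>, where \<open>R\<close> is an \<open>A\<close>-algebra via \<open>\<phi>\<close>.  The four conjuncts
  say that \<open>\<mu>\<close> is a homomorphism of rings, that it is \<open>A\<close>-linear, that \<open>0 \<cdot> v = v\<close>,
  and that \<open>s \<cdot> (t \<cdot> v) = (s + t) \<cdot> v\<close>.\<close>

definition Ga_action :: "('a, 'x) ring_scheme \<Rightarrow> ('k \<Rightarrow> 'a) \<Rightarrow> ('a \<Rightarrow> nat \<Rightarrow> 'a) \<Rightarrow> bool" where
  "Ga_action R \<phi> \<mu> \<longleftrightarrow>
     \<mu> \<in> ring_hom R (UP R) \<and>
     (\<forall>a. \<mu> (\<phi> a) = up_ring.monom (UP R) (\<phi> a) 0) \<and>
     (\<forall>b \<in> carrier R. eval R R (\<lambda>c. c) \<zero>\<^bsub>R\<^esub> (\<mu> b) = b) \<and>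
     (\<forall>b \<in> carrier R. UP_map R \<mu> (\<mu> b) = Ga_comult R (\<mu> b))"

text \<open>For a surjection \<open>\<pi> : R \<rightarrow> S\<close>, that is, a closed immersion \<open>Spec S \<rightarrow> Spec R\<close>, the
  action \<open>\<nu>\<close> on \<open>Spec S\<close> is the restriction of the action \<open>\<mu>\<close> on \<open>Spec R\<close>.\<close>

definition Ga_restricts ::
  "('a, 'x) ring_scheme \<Rightarrow> ('a \<Rightarrow> 'b) \<Rightarrow> ('a \<Rightarrow> nat \<Rightarrow> 'a) \<Rightarrow> ('b \<Rightarrow> nat \<Rightarrow> 'b) \<Rightarrow> bool" where
  "Ga_restricts R \<pi> \<mu> \<nu> \<longleftrightarrow> (\<forall>p \<in> carrier R. UP_map R \<pi> (\<mu> p) = \<nu> (\<pi> p))"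

end

theory Submission
  imports Defs "HOL-Computational_Algebra.Polynomial_Factorial"
begin

text \<open>
  Inverting \<open>h\<close> turns \<open>B\<close> into \<open>A\<^sub>h[X\<^sub>0]\<close>, so a locally nilpotent \<open>A\<close>-derivation of \<open>B\<close>
  is \<open>g \<partial>/\<partial>X\<^sub>0\<close> there, and nilpotency forces \<open>g\<close> to be free of \<open>X\<^sub>0\<close>.  Near the component of
  the fibre \<open>h = 0\<close> that belongs to a leaf at depth \<open>d\<close>, the surface has a coordinate \<open>u\<close> with
  \<open>X\<^sub>0 = \<sigma>(h) + h\<^sup>d u\<close>; regularity there makes \<open>g\<close> divisible by \<open>h\<^sup>d\<close>.  Taking the
  deepest leaf, \<open>X\<^sub>0 \<mapsto> g\<close> lifts to the triangular derivation of the polynomial ring given by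
  \<open>h D(X\<^sub>e) = D(Q\<^sub>e)\<close>: each step down the tree costs one factor \<open>h\<close>, and enough are available.
  Its exponential is the desired action.

  All of this needs \<open>B\<close> to have no \<open>h\<close>-torsion.  The polynomials \<open>R\<^sub>f\<close>, \<open>f\<close> a leaf, generate
  the unit ideal, and after inverting \<open>R\<^sub>f\<close> the surface is cut out by the \<open>\<Delta>\<^bsub>0,a\<^esub>\<close>
  with \<open>a\<close> an ancestor of \<open>f\<close>, which form a regular sequence modulo \<open>h\<close>.
\<close>


section \<open>Evaluation of polynomials\<close>

text \<open>Torsion-freeness is what permits cancelling \<open>h\<close> in \<open>B\<close>: the
  lift is only known to satisfy h D(X_e) = D(Q_e), and to compare it with the given derivation on
  X_e this has to be divided by \<open>h\<close> modulo the ideal, not just in the polynomial ring.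
  The unit ideal comes from the fineness of the labelling: siblings carry different labels, so the
  products S_e^{g}, g a child of e, are comaximal, and R_g = S_e^{g} R_e passes this on from the
  leaves to R_{e_0} = 1. Regularity modulo \<open>h\<close> rests on the linear factors along one
  path involving pairwise different variables. The local coordinate u is never constructed:
  divisibility by h^k after inverting R_f is expressed with powers of R_f, and a closed point of the
  fibre h = 0 where R_f does not vanish prevents such a power from absorbing factors of
  \<open>h\<close>. The deepest leaf matters because X_e needs depth(e)+1 factors of
  \<open>h\<close>, which for inner e is at most the depth of that leaf. The derivation of
  \<open>B\<close> acts on cosets, so it is represented by chosen polynomials, for which all laws
  hold modulo the ideal.\<close>

locale comm_hom =
  fixes \<phi> :: "'a::comm_ring_1 \<Rightarrow> 'b::comm_ring_1"
  assumes add: "\<phi> (a + b) = \<phi> a + \<phi> b"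
    and mult: "\<phi> (a * b) = \<phi> a * \<phi> b"
    and one: "\<phi> 1 = 1"
begin

lemma zero: "\<phi> 0 = 0"
  using add[of 0 0] by simp

lemma uminus: "\<phi> (- a) = - \<phi> a"
  using add[of a "- a"] zero by (simp add: eq_neg_iff_add_eq_0 add.commute)

lemma diff: "\<phi> (a - b) = \<phi> a - \<phi> b"
  using add[of a "- b"] uminus by simp

lemma power: "\<phi> (a ^ n) = \<phi> a ^ n"
  by (induction n) (simp_all add: one mult)

lemma prod: "\<phi> (prod f S) = (\<Prod>x\<in>S. \<phi> (f x))"
  by (induction S rule: infinite_finite_induct) (simp_all add: one mult)

lemma sum: "\<phi> (sum f S) = (\<Sum>x\<in>S. \<phi> (f x))"
  by (induction S rule: infinite_finite_induct) (simp_all add: zero add)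

lemmas hom_simps = zero one add mult uminus diff power prod sum

end

definition mono_eval :: "('v \<Rightarrow> 'b::comm_ring_1) \<Rightarrow> ('v \<Rightarrow>\<^sub>0 nat) \<Rightarrow> 'b" where
  "mono_eval s m = (\<Prod>v\<in>Poly_Mapping.keys m. s v ^ Poly_Mapping.lookup m v)"

text \<open>All homomorphisms out of the polynomial ring used in the sequel have this form: to the
  generic fibre, to closed points, to first-order deformations, and partial specialisations of the
  variables.\<close>

definition subst :: "('a::comm_ring_1 \<Rightarrow> 'b::comm_ring_1) \<Rightarrow> ('v \<Rightarrow> 'b) \<Rightarrow> (('v \<Rightarrow>\<^sub>0 nat) \<Rightarrow>\<^sub>0 'a) \<Rightarrow> 'b" where
  "subst \<phi> s p = (\<Sum>m\<in>Poly_Mapping.keys p. \<phi> (Poly_Mapping.lookup p m) * mono_eval s m)"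

lemma mono_eval_superset:
  assumes "finite S" "Poly_Mapping.keys m \<subseteq> S"
  shows "mono_eval s m = (\<Prod>v\<in>S. s v ^ Poly_Mapping.lookup m v)"
  unfolding mono_eval_def
  by (rule prod.mono_neutral_left) (use assms in \<open>auto simp: in_keys_iff\<close>)

lemma keys_nat_add:
  fixes m n :: "'v \<Rightarrow>\<^sub>0 nat"
  shows "Poly_Mapping.keys (m + n) = Poly_Mapping.keys m \<union> Poly_Mapping.keys n"
  by (auto simp: in_keys_iff lookup_add)

lemma mono_eval_add: "mono_eval s (m + n) = mono_eval s m * mono_eval s n"
proof -
  let ?S = "Poly_Mapping.keys m \<union> Poly_Mapping.keys n"
  have "mono_eval s (m + n) = (\<Prod>v\<in>?S. s v ^ Poly_Mapping.lookup (m + n) v)"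
    by (rule mono_eval_superset) (auto simp: keys_nat_add)
  also have "\<dots> = (\<Prod>v\<in>?S. s v ^ Poly_Mapping.lookup m v) * (\<Prod>v\<in>?S. s v ^ Poly_Mapping.lookup n v)"
    by (simp add: lookup_add power_add prod.distrib)
  also have "\<dots> = mono_eval s m * mono_eval s n"
    by (subst (1 2) mono_eval_superset[where S = ?S]) auto
  finally show ?thesis .
qed

lemma mono_eval_zero [simp]: "mono_eval s 0 = 1"
  by (simp add: mono_eval_def)

lemma mono_eval_single [simp]: "mono_eval s (Poly_Mapping.single v 1) = s v"
  by (simp add: mono_eval_def)

lemma poly_mapping_sum_single:
  fixes p :: "'a \<Rightarrow>\<^sub>0 'b::comm_monoid_add"
  shows "p = (\<Sum>m\<in>Poly_Mapping.keys p. Poly_Mapping.single m (Poly_Mapping.lookup p m))"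
proof (rule poly_mapping_eqI)
  fix k
  have "(\<Sum>m\<in>Poly_Mapping.keys p. Poly_Mapping.lookup (Poly_Mapping.single m (Poly_Mapping.lookup p m)) k)
      = (\<Sum>m\<in>Poly_Mapping.keys p. if m = k then Poly_Mapping.lookup p k else 0)"
    by (rule sum.cong) (auto simp: lookup_single when_def)
  also have "\<dots> = Poly_Mapping.lookup p k"
    by (auto simp: in_keys_iff)
  finally show "Poly_Mapping.lookup p k =
      Poly_Mapping.lookup (\<Sum>m\<in>Poly_Mapping.keys p. Poly_Mapping.single m (Poly_Mapping.lookup p m)) k"
    by (simp add: lookup_sum)
qed

lemma poly_mapping_add_induct [case_names zero single add]:
  fixes p :: "'a \<Rightarrow>\<^sub>0 'b::comm_monoid_add"
  assumes "P 0" "\<And>m c. P (Poly_Mapping.single m c)" "\<And>p q. P p \<Longrightarrow> P q \<Longrightarrow> P (p + q)"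
  shows "P p"
proof -
  have "P (\<Sum>m\<in>S. Poly_Mapping.single m (Poly_Mapping.lookup p m))" if "finite S" for S
    using that by induction (auto intro: assms)
  then show ?thesis
    using poly_mapping_sum_single[of p] by (metis finite_keys)
qed

lemma X_power: "(X v :: 'n apoly) ^ k = Poly_Mapping.single (Poly_Mapping.single v k) 1"
proof (induction k)
  case (Suc k)
  then show ?case
    by (simp add: X_def mult_single single_add[symmetric] del: single_add)
qed simp

lemma mono_eval_X: "mono_eval X m = (Poly_Mapping.single m 1 :: 'n apoly)"
proof -
  have "(\<Prod>v\<in>S. Poly_Mapping.single (Poly_Mapping.single v (Poly_Mapping.lookup m v)) 1)
      = (Poly_Mapping.single (\<Sum>v\<in>S. Poly_Mapping.single v (Poly_Mapping.lookup m v)) 1 :: 'n apoly)"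
    if "finite S" for S
    using that by induction (simp_all add: mult_single)
  then show ?thesis
    using poly_mapping_sum_single[of m] by (simp add: mono_eval_def X_power)
qed

lemma single_eq_Const_mono_eval: "Poly_Mapping.single m c = Const c * mono_eval X m"
  by (simp add: mono_eval_X Const_def mult_single)

context comm_hom
begin

lemma subst_superset:
  assumes "finite S" "Poly_Mapping.keys p \<subseteq> S"
  shows "subst \<phi> s p = (\<Sum>m\<in>S. \<phi> (Poly_Mapping.lookup p m) * mono_eval s m)"
  unfolding subst_def
  by (rule sum.mono_neutral_left) (use assms in \<open>auto simp: in_keys_iff zero\<close>)

lemma subst_single [simp]: "subst \<phi> s (Poly_Mapping.single m c) = \<phi> c * mono_eval s m"
  by (simp add: subst_def zero)

lemma subst_0: "subst \<phi> s 0 = 0"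
  by (simp add: subst_def)

lemma subst_add: "subst \<phi> s (p + q) = subst \<phi> s p + subst \<phi> s q"
proof -
  let ?S = "Poly_Mapping.keys p \<union> Poly_Mapping.keys q"
  have "Poly_Mapping.keys (p + q) \<subseteq> ?S"
    by (rule keys_add)
  then show ?thesis
    by (subst (1 2 3) subst_superset[where S = ?S])
      (auto simp: lookup_add add algebra_simps sum.distrib)
qed

lemma subst_mult: "subst \<phi> s (p * q) = subst \<phi> s p * subst \<phi> s q"
proof (induction p rule: poly_mapping_add_induct)
  case (single m c)
  show ?case
    by (induction q rule: poly_mapping_add_induct)
      (simp_all add: subst_0 subst_add mult_single mult mono_eval_add algebra_simps)
qed (simp_all add: subst_0 subst_add algebra_simps)

lemma subst_comm_hom: "comm_hom (subst \<phi> s)"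
proof
  show "subst \<phi> s 1 = 1"
    by (simp add: one flip: single_one)
qed (simp_all add: subst_add subst_mult)

end

lemma comm_hom_subst_simps:
  assumes "comm_hom \<phi>"
  shows "subst \<phi> s (Const c) = \<phi> c" "subst \<phi> s (X v) = s v"
  using assms
  by (simp_all add: Const_def X_def comm_hom.subst_single comm_hom.one mono_eval_single del: One_nat_def)

interpretation Const: comm_hom Const
  by unfold_locales (simp_all add: Const_def single_add mult_single)

lemma lookup_Const_mult: "Poly_Mapping.lookup (Const a * p) m = a * Poly_Mapping.lookup p m"
  unfolding Const_def mult_map_scale_conv_mult[symmetric]
  by (simp add: Poly_Mapping.map.rep_eq when_def)

lemma lookup_X_mult:
  "Poly_Mapping.lookup (X v * p) (Poly_Mapping.single v 1 + m) = Poly_Mapping.lookup p m"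
proof (induction p rule: poly_mapping_add_induct)
  case (single m' c)
  show ?case
    by (simp add: X_def mult_single lookup_single when_def)
qed (simp_all add: lookup_add distrib_left)

lemma Const_mult_eq_0:
  assumes "Const a * p = 0" "a \<noteq> 0"
  shows "p = (0 :: 'n apoly)"
proof (rule poly_mapping_eqI)
  fix m
  show "Poly_Mapping.lookup p m = Poly_Mapping.lookup 0 m"
    using lookup_Const_mult[of a p m] assms by simp
qed

text \<open>Choose a monomial m of \<open>q\<close> with the largest exponent of X_v. In the
  relation X_v q = c q the coefficient at X_v m is that of \<open>q\<close> at m on the left and
  zero on the right.\<close>

lemma X_minus_Const_mult_eq_0:
  fixes q :: "'n apoly"
  assumes "(X v - Const c) * q = 0"
  shows "q = 0"
proof (rule ccontr)
  assume "q \<noteq> 0"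
  then have "Poly_Mapping.keys q \<noteq> {}" by simp
  then obtain m where m: "m \<in> Poly_Mapping.keys q"
      "\<And>m'. m' \<in> Poly_Mapping.keys q \<Longrightarrow> Poly_Mapping.lookup m' v \<le> Poly_Mapping.lookup m v"
    using arg_max_nat_lemma[of "\<lambda>m. m \<in> Poly_Mapping.keys q" _ "\<lambda>m. Poly_Mapping.lookup m v"
        "Suc (Max ((\<lambda>m. Poly_Mapping.lookup m v) ` Poly_Mapping.keys q))"]
    by (metis (mono_tags, lifting) Max_ge all_not_in_conv finite_imageI finite_keys imageI less_Suc_eq_le)
  let ?m = "Poly_Mapping.single v 1 + m"
  have "?m \<notin> Poly_Mapping.keys q"
    using m(2)[of ?m] by (auto simp: lookup_add)
  then have "Poly_Mapping.lookup q ?m = 0" by (simp add: in_keys_iff)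
  moreover have "X v * q = Const c * q" using assms by (simp add: algebra_simps)
  ultimately have "Poly_Mapping.lookup q m = 0"
    using lookup_X_mult[of v q m] by (simp add: lookup_Const_mult)
  with m(1) show False by (simp add: in_keys_iff)
qed

section \<open>Polynomials in a given set of variables\<close>

definition polys :: "'n option set \<Rightarrow> 'n apoly set" where
  "polys V = {p. \<forall>m\<in>Poly_Mapping.keys p. Poly_Mapping.keys m \<subseteq> V}"

lemma polys_UNIV [simp]: "polys UNIV = UNIV"
  by (simp add: polys_def)

lemma polys_mono: "V \<subseteq> W \<Longrightarrow> polys V \<subseteq> polys W"
  unfolding polys_def by blast

lemma polys_0 [simp]: "0 \<in> polys V"
  by (simp add: polys_def)

lemma polys_Const [simp]: "Const c \<in> polys V"
  by (simp add: polys_def Const_def)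

lemma polys_1 [simp]: "1 \<in> polys V"
  by (simp add: polys_def)

lemma polys_X: "v \<in> V \<Longrightarrow> X v \<in> polys V"
  by (simp add: polys_def X_def)

lemma polys_add: "p \<in> polys V \<Longrightarrow> q \<in> polys V \<Longrightarrow> p + q \<in> polys V"
  unfolding polys_def using keys_add[of p q] by blast

lemma polys_mult:
  assumes "p \<in> polys V" "q \<in> polys V" shows "p * q \<in> polys V"
  unfolding polys_def
proof safe
  fix m v assume "m \<in> Poly_Mapping.keys (p * q)" "v \<in> Poly_Mapping.keys m"
  then obtain a b where "a \<in> Poly_Mapping.keys p" "b \<in> Poly_Mapping.keys q" "m = a + b"
    using keys_mult[of p q] by blast
  then show "v \<in> V"
    using assms \<open>v \<in> Poly_Mapping.keys m\<close> by (auto simp: polys_def keys_nat_add)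
qed

lemma polys_uminus: "p \<in> polys V \<Longrightarrow> - p \<in> polys V"
  by (auto simp: polys_def in_keys_iff)

lemma polys_diff: "p \<in> polys V \<Longrightarrow> q \<in> polys V \<Longrightarrow> p - q \<in> polys V"
  using polys_add[of p V "- q"] polys_uminus by auto

lemma polys_prod: "(\<And>x. x \<in> S \<Longrightarrow> f x \<in> polys V) \<Longrightarrow> prod f S \<in> polys V"
  by (induction S rule: infinite_finite_induct) (auto intro: polys_mult)

lemma polys_sum: "(\<And>x. x \<in> S \<Longrightarrow> f x \<in> polys V) \<Longrightarrow> sum f S \<in> polys V"
  by (induction S rule: infinite_finite_induct) (auto intro: polys_add)

lemma polys_power: "p \<in> polys V \<Longrightarrow> p ^ n \<in> polys V"
  by (induction n) (auto intro: polys_mult)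

lemmas polys_intros = polys_X polys_add polys_mult polys_uminus polys_diff polys_prod polys_sum polys_power

lemma polys_Const_mult_cancel:
  assumes "Const a * p \<in> polys V" "a \<noteq> 0"
  shows "p \<in> polys V"
  using assms by (auto simp: polys_def in_keys_iff lookup_Const_mult)

lemma polys_induct [consumes 1, case_names Const X add mult]:
  assumes p: "p \<in> polys V" and C: "\<And>c. P (Const c)" and X: "\<And>v. v \<in> V \<Longrightarrow> P (X v)"
    and A: "\<And>p q. P p \<Longrightarrow> P q \<Longrightarrow> P (p + q)" and M: "\<And>p q. P p \<Longrightarrow> P q \<Longrightarrow> P (p * q)"
  shows "P p"
proof -
  have P1: "P 1" using C[of 1] by (simp add: Const.one)
  have pow: "P (q ^ k)" if "P q" for q k
    using that by (induction k) (auto intro: P1 M)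
  have prod: "P (prod f S)" if "\<And>x. x \<in> S \<Longrightarrow> P (f x)" for f and S :: "'a option set"
    using that by (induction S rule: infinite_finite_induct) (auto intro: P1 M)
  have sum: "P (sum f S)" if "\<And>x. x \<in> S \<Longrightarrow> P (f x)" for f and S :: "('a option \<Rightarrow>\<^sub>0 nat) set"
    using that C[of 0] by (induction S rule: infinite_finite_induct) (auto intro: A simp: Const.zero)
  have "P (\<Sum>m\<in>Poly_Mapping.keys p. Poly_Mapping.single m (Poly_Mapping.lookup p m))"
    unfolding single_eq_Const_mono_eval mono_eval_def
    by (intro sum M C prod pow X) (use p in \<open>auto simp: polys_def\<close>)
  then show ?thesis
    using poly_mapping_sum_single[of p] by metis
qed

lemma subst_cong_polys:
  assumes "p \<in> polys V" "\<And>v. v \<in> V \<Longrightarrow> s v = s' v"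
  shows "subst \<phi> s p = subst \<phi> s' p"
  unfolding subst_def mono_eval_def
  by (intro sum.cong prod.cong arg_cong2[where f = "(*)"] arg_cong2[where f = "(^)"] refl)
    (use assms in \<open>auto simp: polys_def\<close>)

text \<open>A commutative ring is viewed as a module over itself: \<open>idl.subspace J\<close> says
  that J is an ideal, and \<open>idl.span S\<close> is the ideal generated by S.\<close>

interpretation idl: Modules.module "(*) :: 'a::comm_ring_1 \<Rightarrow> 'a \<Rightarrow> 'a"
  by unfold_locales (simp_all add: algebra_simps)

declare idl.scale_scale [simp del]

lemma idl_mult_right: "x \<in> idl.span S \<Longrightarrow> x * c \<in> idl.span S"
  using idl.span_scale[of x S c] by (simp add: mult.commute)


section \<open>Combinatorics of the tree\<close>

locale fl_rooted_tree =
  fixes \<gamma> :: "'n fl_tree"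
  assumes fine: "fine_labelled_rooted_tree \<gamma>"
begin

abbreviation "rt \<equiv> root_node \<gamma>"

definition depth :: "'n \<Rightarrow> nat" where
  "depth e = card (Anc \<gamma> e)"

lemma rooted: "rooted_tree \<gamma>"
  using fine by (simp add: fine_labelled_rooted_tree_def)

lemma finite_nodes: "finite (nodes \<gamma>)"
  using rooted by (simp add: rooted_tree_def)

lemma tord_refl: "e \<in> nodes \<gamma> \<Longrightarrow> (e, e) \<in> tord \<gamma>"
  using rooted by (auto simp: rooted_tree_def partial_order_on_def preorder_on_def refl_on_def)

lemma tord_trans: "(a, b) \<in> tord \<gamma> \<Longrightarrow> (b, c) \<in> tord \<gamma> \<Longrightarrow> (a, c) \<in> tord \<gamma>"
  using rooted by (auto simp: rooted_tree_def partial_order_on_def preorder_on_def dest: transD)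

lemma tord_antisym: "(a, b) \<in> tord \<gamma> \<Longrightarrow> (b, a) \<in> tord \<gamma> \<Longrightarrow> a = b"
  using rooted by (auto simp: rooted_tree_def partial_order_on_def dest: antisymD)

lemma down_total: "e \<in> nodes \<gamma> \<Longrightarrow> a \<in> down \<gamma> e \<Longrightarrow> b \<in> down \<gamma> e \<Longrightarrow> (a, b) \<in> tord \<gamma> \<or> (b, a) \<in> tord \<gamma>"
  using rooted tord_refl unfolding rooted_tree_def total_on_def by (auto simp: down_def)

lemma root_min: "rt \<in> min_elts (tord \<gamma>) (nodes \<gamma>)"
  using rooted unfolding rooted_tree_def root_node_def by (auto intro: theI')

lemma root_node: "rt \<in> nodes \<gamma>"
  using root_min by (simp add: min_elts_def)

lemma finite_Anc: "finite (Anc \<gamma> e)"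
  using finite_nodes by (simp add: Anc_def down_def)

lemma down_eq: "e \<in> nodes \<gamma> \<Longrightarrow> down \<gamma> e = insert e (Anc \<gamma> e)"
  by (auto simp: Anc_def down_def tord_refl)

lemma Anc_root [simp]: "Anc \<gamma> rt = {}"
  using root_min by (auto simp: Anc_def down_def min_elts_def)

lemma Anc_nodes: "a \<in> Anc \<gamma> e \<Longrightarrow> a \<in> nodes \<gamma>"
  by (simp add: Anc_def down_def)

lemma self_notin_Anc [simp]: "e \<notin> Anc \<gamma> e"
  by (simp add: Anc_def)

lemma Anc_inner:
  assumes "a \<in> Anc \<gamma> e" "e \<in> nodes \<gamma>"
  shows "a \<in> inner_nodes \<gamma>"
  using assms by (auto simp: Anc_def down_def inner_nodes_def Leaves_def max_elts_def)

lemma Par_Anc: "e \<in> nodes \<gamma> \<Longrightarrow> e \<noteq> rt \<Longrightarrow> Par \<gamma> e \<in> Anc \<gamma> e"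
  using Par_in_Anc[OF rooted] .

lemma Par_nodes: "e \<in> nodes \<gamma> \<Longrightarrow> e \<noteq> rt \<Longrightarrow> Par \<gamma> e \<in> nodes \<gamma>"
  using Par_Anc Anc_nodes by blast

lemma Anc_Par:
  assumes "e \<in> nodes \<gamma>" "e \<noteq> rt"
  shows "Anc \<gamma> e = insert (Par \<gamma> e) (Anc \<gamma> (Par \<gamma> e))"
proof (intro equalityI subsetI)
  fix a assume a: "a \<in> Anc \<gamma> e"
  have P: "Par \<gamma> e \<in> Anc \<gamma> e" using Par_Anc assms .
  have "(a, Par \<gamma> e) \<in> tord \<gamma> \<or> (Par \<gamma> e, a) \<in> tord \<gamma>"
    using down_total[OF assms(1), of a "Par \<gamma> e"] a P by (auto simp: Anc_def)
  moreover have "(Par \<gamma> e, a) \<in> tord \<gamma> \<Longrightarrow> a = Par \<gamma> e"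
    using Par_in_max[OF rooted assms] a by (auto simp: max_elts_def)
  ultimately show "a \<in> insert (Par \<gamma> e) (Anc \<gamma> (Par \<gamma> e))"
    using a by (auto simp: Anc_def down_def)
next
  fix a assume "a \<in> insert (Par \<gamma> e) (Anc \<gamma> (Par \<gamma> e))"
  then show "a \<in> Anc \<gamma> e"
    using Par_Anc[OF assms] Anc_Par_psubset[OF rooted assms] by auto
qed

lemma Anc_Par_down: "e \<in> nodes \<gamma> \<Longrightarrow> e \<noteq> rt \<Longrightarrow> Anc \<gamma> e = down \<gamma> (Par \<gamma> e)"
  using Anc_Par down_eq Par_nodes by metis

lemma depth_Par: "e \<in> nodes \<gamma> \<Longrightarrow> e \<noteq> rt \<Longrightarrow> depth e = Suc (depth (Par \<gamma> e))"
  by (simp add: depth_def Anc_Par finite_Anc)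

lemma depth_root [simp]: "depth rt = 0"
  by (simp add: depth_def)

lemma tree_induct [consumes 1, case_names rt step]:
  assumes "e \<in> nodes \<gamma>" "P rt" "\<And>e. e \<in> nodes \<gamma> \<Longrightarrow> e \<noteq> rt \<Longrightarrow> P (Par \<gamma> e) \<Longrightarrow> P e"
  shows "P e"
  using assms(1)
proof (induction "depth e" arbitrary: e rule: less_induct)
  case less
  show ?case
  proof (cases "e = rt")
    case False
    show ?thesis
      by (rule assms(3)[OF less(2) False less(1)[OF _ Par_nodes[OF less(2) False]]])
        (simp only: depth_Par[OF less(2) False] lessI)
  qed (simp add: assms(2))
qed

lemma Anc_trans: "b \<in> Anc \<gamma> e \<Longrightarrow> a \<in> Anc \<gamma> b \<Longrightarrow> a \<in> Anc \<gamma> e"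
  unfolding Anc_def down_def using tord_trans tord_antisym by blast

lemma down_mono: "b \<in> down \<gamma> e \<Longrightarrow> down \<gamma> b \<subseteq> down \<gamma> e"
  unfolding down_def using tord_trans by blast

lemma Anc_mono:
  assumes "b \<in> down \<gamma> e"
  shows "Anc \<gamma> b \<subseteq> Anc \<gamma> e"
proof (cases "b = e")
  case False
  then have "b \<in> Anc \<gamma> e" using assms by (simp add: Anc_def)
  then show ?thesis using Anc_trans by blast
qed simp

lemma depth_Anc: "a \<in> Anc \<gamma> e \<Longrightarrow> depth a < depth e"
  unfolding depth_def
  by (rule psubset_card_mono[OF finite_Anc]) (use Anc_trans self_notin_Anc in blast)

lemma Child_iff:
  assumes "a \<in> nodes \<gamma>"
  shows "g \<in> Child \<gamma> a \<longleftrightarrow> g \<in> nodes \<gamma> \<and> g \<noteq> rt \<and> Par \<gamma> g = a"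
proof
  assume g: "g \<in> Child \<gamma> a"
  then have gA: "g \<in> nodes \<gamma>" "a \<in> Anc \<gamma> g"
    using assms by (auto simp: Child_def min_elts_def Anc_def down_def)
  then have "g \<noteq> rt" by auto
  have P: "Par \<gamma> g \<in> Anc \<gamma> g" by (rule Par_Anc) fact+
  have "a \<in> down \<gamma> (Par \<gamma> g)"
    using Anc_Par_down[OF gA(1) \<open>g \<noteq> rt\<close>] gA by simp
  then have "(a, Par \<gamma> g) \<in> tord \<gamma>" by (simp add: down_def)
  then have "Par \<gamma> g = a"
    using g P by (auto simp: Child_def min_elts_def Anc_def down_def)
  with gA \<open>g \<noteq> rt\<close> show "g \<in> nodes \<gamma> \<and> g \<noteq> rt \<and> Par \<gamma> g = a" by blast
next
  assume g: "g \<in> nodes \<gamma> \<and> g \<noteq> rt \<and> Par \<gamma> g = a"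
  then have A: "Anc \<gamma> g = down \<gamma> a" "a \<in> Anc \<gamma> g"
    using Anc_Par_down Par_Anc by auto
  then show "g \<in> Child \<gamma> a"
    using g tord_antisym unfolding Child_def min_elts_def Anc_def down_def by blast
qed

lemma Child_Par: "e \<in> nodes \<gamma> \<Longrightarrow> e \<noteq> rt \<Longrightarrow> e \<in> Child \<gamma> (Par \<gamma> e)"
  using Child_iff[OF Par_nodes] by blast

lemma ChildD:
  assumes "g \<in> Child \<gamma> a" "a \<in> nodes \<gamma>"
  shows "g \<in> nodes \<gamma>" "g \<noteq> rt" "Par \<gamma> g = a" "a \<in> Anc \<gamma> g" "depth g = Suc (depth a)"
  using assms Par_Anc depth_Par by (auto simp: Child_iff)

lemma finite_Child: "finite (Child \<gamma> a)"
  using finite_nodes by (simp add: Child_def min_elts_def)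

lemma next_node_exists:
  assumes "e \<in> nodes \<gamma>" "a \<in> Anc \<gamma> e"
  shows "\<exists>g. g \<in> Child \<gamma> a \<inter> down \<gamma> e"
  using assms
proof (induction rule: tree_induct)
  case (step e)
  show ?case
  proof (cases "a = Par \<gamma> e")
    case True
    then show ?thesis using step Child_Par down_eq by auto
  next
    case False
    then have "a \<in> Anc \<gamma> (Par \<gamma> e)" using step Anc_Par by auto
    moreover have "down \<gamma> (Par \<gamma> e) \<subseteq> down \<gamma> e"
      using step by (metis Anc_Par_down Anc_def Diff_subset)
    ultimately show ?thesis using step by blast
  qed
qed auto

lemma Child_inter_down_unique:
  assumes "e \<in> nodes \<gamma>" "a \<in> nodes \<gamma>" "g \<in> Child \<gamma> a" "g \<in> down \<gamma> e" "g' \<in> Child \<gamma> a" "g' \<in> down \<gamma> e"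
  shows "g = g'"
proof (rule ccontr)
  assume "g \<noteq> g'"
  have "g \<in> Anc \<gamma> g' \<or> g' \<in> Anc \<gamma> g"
    using down_total[OF assms(1,4,6)] \<open>g \<noteq> g'\<close> assms by (auto simp: Anc_def down_def)
  then show False
    using depth_Anc ChildD(5) assms by fastforce
qed

lemma next_node_eq:
  assumes "e \<in> nodes \<gamma>" "a \<in> nodes \<gamma>" "g \<in> Child \<gamma> a" "g \<in> down \<gamma> e"
  shows "next_node \<gamma> a e = g"
  unfolding next_node_def using assms Child_inter_down_unique by (intro the_equality) blast+

lemma next_node_in:
  assumes "e \<in> nodes \<gamma>" "a \<in> Anc \<gamma> e"
  shows "next_node \<gamma> a e \<in> Child \<gamma> a" "next_node \<gamma> a e \<in> down \<gamma> e"
  using next_node_exists[OF assms] next_node_eq[OF assms(1) Anc_nodes[OF assms(2)]] by auto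

lemma next_node_Par: "e \<in> nodes \<gamma> \<Longrightarrow> e \<noteq> rt \<Longrightarrow> next_node \<gamma> (Par \<gamma> e) e = e"
  by (rule next_node_eq) (auto simp: Par_nodes Child_Par down_eq)

lemma next_node_down:
  assumes "f \<in> nodes \<gamma>" "e \<in> down \<gamma> f" "a \<in> Anc \<gamma> e"
  shows "next_node \<gamma> a f = next_node \<gamma> a e"
proof -
  have e: "e \<in> nodes \<gamma>" using assms(2) by (simp add: down_def)
  show ?thesis
    using assms next_node_in[OF e assms(3)] down_mono[OF assms(2)]
    by (intro next_node_eq) (auto intro: Anc_nodes)
qed

lemma Child_nonempty:
  assumes "e \<in> inner_nodes \<gamma>"
  shows "Child \<gamma> e \<noteq> {}"
proof -
  obtain y where y: "y \<in> nodes \<gamma>" "(e, y) \<in> tord \<gamma>" "y \<noteq> e" "e \<in> nodes \<gamma>"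
    using assms by (auto simp: inner_nodes_def Leaves_def max_elts_def)
  then have "e \<in> Anc \<gamma> y" by (auto simp: Anc_def down_def)
  then show ?thesis using next_node_in y by blast
qed

lemma inner_nodesD: "e \<in> inner_nodes \<gamma> \<Longrightarrow> e \<in> nodes \<gamma>"
  by (simp add: inner_nodes_def)

lemma lb_inj:
  assumes "a \<in> nodes \<gamma>" "g \<in> Child \<gamma> a" "g' \<in> Child \<gamma> a" "g \<noteq> g'"
  shows "lb \<gamma> g \<noteq> lb \<gamma> g'"
proof -
  have "\<forall>f\<in>nodes \<gamma> - {rt}. \<forall>f'\<in>nodes \<gamma> - {rt}. f \<noteq> f' \<and> Par \<gamma> f = Par \<gamma> f' \<longrightarrow> lb \<gamma> f \<noteq> lb \<gamma> f'"
    using fine by (simp add: fine_labelled_rooted_tree_def)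
  moreover have "g \<in> nodes \<gamma> - {rt}" "g' \<in> nodes \<gamma> - {rt}" "Par \<gamma> g = Par \<gamma> g'"
    using ChildD[OF assms(2,1)] ChildD[OF assms(3,1)] by auto
  ultimately show ?thesis using assms(4) by blast
qed

lemma root_down: "e \<in> nodes \<gamma> \<Longrightarrow> rt \<in> down \<gamma> e"
proof (induction rule: tree_induct)
  case (step e)
  then show ?case using Anc_Par_down[of e] down_eq[of e] by simp
qed (simp add: down_eq root_node)

text \<open>Walk from \<open>e\<close> towards the root until the parent lies on the path to
  \<open>f\<close>; there the two paths use different children, because the node reached is off the
  path. The walk never meets \<open>f\<close>, since a parent is not a leaf.\<close>

lemma branching_exists:
  assumes "e \<in> nodes \<gamma>" "f \<in> Leaves \<gamma>" "e \<noteq> f" "e \<notin> Anc \<gamma> f"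
  shows "\<exists>a. a \<in> Anc \<gamma> e \<and> a \<in> Anc \<gamma> f \<and> next_node \<gamma> a e \<noteq> next_node \<gamma> a f"
  using assms(1,3,4)
proof (induction rule: tree_induct)
  case rt
  have f: "f \<in> nodes \<gamma>" using assms(2) by (simp add: Leaves_def max_elts_def)
  then have "rt \<in> down \<gamma> f" by (rule root_down)
  then show ?case using rt by (auto simp: Anc_def)
next
  case (step e)
  have f: "f \<in> nodes \<gamma>" using assms(2) by (simp add: Leaves_def max_elts_def)
  have P: "Par \<gamma> e \<in> Anc \<gamma> e"
    using Par_Anc step(1,2) .
  then have Pd: "Par \<gamma> e \<in> down \<gamma> e"
    by (simp add: Anc_def)
  show ?case
  proof (cases "Par \<gamma> e \<in> Anc \<gamma> f")
    case True
    have "next_node \<gamma> (Par \<gamma> e) f \<noteq> e"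
      using next_node_in(2)[OF f True] step(4,5) unfolding down_eq[OF f] by (metis insertE)
    then show ?thesis
      by (intro exI[of _ "Par \<gamma> e"] conjI P True) (metis next_node_Par[OF step(1,2)])
  next
    case False
    have "Par \<gamma> e \<noteq> f"
      using Anc_inner[OF P step(1)] assms(2) by (metis DiffD2 inner_nodes_def)
    then obtain a where a: "a \<in> Anc \<gamma> (Par \<gamma> e)" "a \<in> Anc \<gamma> f"
        "next_node \<gamma> a (Par \<gamma> e) \<noteq> next_node \<gamma> a f"
      using step.IH False by blast
    show ?thesis
      by (intro exI[of _ a] conjI Anc_trans[OF P a(1)] a(2))
        (simp only: next_node_down[OF step(1) Pd a(1)] a(3) not_False_eq_True)
  qed
qed

section \<open>The tree polynomials as products of linear factors\<close>

definition lin :: "'n \<Rightarrow> 'n \<Rightarrow> 'n apoly" where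
  "lin a g = X (ParX \<gamma> a) - Const [:lb \<gamma> g:]"

lemma S_poly_lin: "S_poly \<gamma> a J = (\<Prod>g\<in>Child \<gamma> a - J. lin a g)"
  by (simp add: S_poly_def lin_def)

lemma S_poly_remove: "g \<in> Child \<gamma> a \<Longrightarrow> S_poly \<gamma> a {} = lin a g * S_poly \<gamma> a {g}"
  unfolding S_poly_lin using prod.remove[OF finite_Child, of g a "lin a"] by simp

lemma lin_dvd_S_poly: "g \<in> Child \<gamma> a \<Longrightarrow> g \<notin> J \<Longrightarrow> lin a g dvd S_poly \<gamma> a J"
  unfolding S_poly_lin using finite_Child by (intro dvd_prodI) auto

lemma R_root: "R_poly \<gamma> rt = 1"
  by (subst R_poly.simps) simp

lemma R_step: "e \<in> nodes \<gamma> \<Longrightarrow> e \<noteq> rt \<Longrightarrow> R_poly \<gamma> e = S_poly \<gamma> (Par \<gamma> e) {e} * R_poly \<gamma> (Par \<gamma> e)"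
  by (subst R_poly.simps) (simp add: rooted)

lemma R_Child: "g \<in> Child \<gamma> a \<Longrightarrow> a \<in> nodes \<gamma> \<Longrightarrow> R_poly \<gamma> g = S_poly \<gamma> a {g} * R_poly \<gamma> a"
  using R_step[of g] ChildD[of g a] by simp

lemma R_prod: "e \<in> nodes \<gamma> \<Longrightarrow> R_poly \<gamma> e = (\<Prod>a\<in>Anc \<gamma> e. S_poly \<gamma> a {next_node \<gamma> a e})"
proof (induction rule: tree_induct)
  case (step e)
  have "Par \<gamma> e \<in> down \<gamma> e"
    using Par_Anc[OF step(1,2)] by (simp add: Anc_def)
  then have "(\<Prod>a\<in>Anc \<gamma> (Par \<gamma> e). S_poly \<gamma> a {next_node \<gamma> a e})
      = (\<Prod>a\<in>Anc \<gamma> (Par \<gamma> e). S_poly \<gamma> a {next_node \<gamma> a (Par \<gamma> e)})"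
    using next_node_down[OF step(1)] by (intro prod.cong refl) simp
  then show ?case
    unfolding R_step[OF step(1,2)] Anc_Par[OF step(1,2)] step(3)
    by (simp add: finite_Anc next_node_Par[OF step(1,2)])
qed (simp add: R_root)

text \<open>For \<open>c\<close> in \<open>down \<gamma> e\<close>, \<open>U_poly c e\<close> is the
  quotient R_e / R_c and \<open>T_poly c e\<close> is Q_e / R_c, written as products so that no
  division is left in the relations.\<close>

definition U_poly :: "'n \<Rightarrow> 'n \<Rightarrow> 'n apoly" where
  "U_poly c e = (\<Prod>a\<in>Anc \<gamma> e - Anc \<gamma> c. S_poly \<gamma> a {next_node \<gamma> a e})"

definition T_poly :: "'n \<Rightarrow> 'n \<Rightarrow> 'n apoly" where
  "T_poly c e = S_poly \<gamma> e {} * U_poly c e"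

lemma R_split:
  assumes "e \<in> nodes \<gamma>" "c \<in> down \<gamma> e"
  shows "R_poly \<gamma> e = U_poly c e * R_poly \<gamma> c"
proof -
  have c: "c \<in> nodes \<gamma>" using assms by (simp add: down_def)
  have "R_poly \<gamma> c = (\<Prod>a\<in>Anc \<gamma> c. S_poly \<gamma> a {next_node \<gamma> a e})"
    unfolding R_prod[OF c] by (intro prod.cong refl) (simp add: next_node_down[OF assms])
  then show ?thesis
    unfolding R_prod[OF assms(1)] U_poly_def
    using prod.subset_diff[OF Anc_mono[OF assms(2)] finite_Anc] by simp
qed

lemma Q_T: "e \<in> nodes \<gamma> \<Longrightarrow> c \<in> down \<gamma> e \<Longrightarrow> Q_poly \<gamma> e = T_poly c e * R_poly \<gamma> c"
  unfolding Q_poly_def T_poly_def by (subst R_split[of e c]) (simp_all only: mult.assoc)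

lemma Q_lin:
  assumes "a \<in> nodes \<gamma>" "g \<in> Child \<gamma> a"
  shows "Q_poly \<gamma> a = lin a g * R_poly \<gamma> g"
  unfolding Q_poly_def R_Child[OF assms(2,1)] S_poly_remove[OF assms(2)] by (simp only: mult.assoc)

text \<open>Linear factors are cancelled one at a time. This leads to the cancellation of R_e and
  thus to the uniqueness behind \<open>exact_quot\<close>.\<close>

lemma S_poly_mult_eq_0:
  assumes "S_poly \<gamma> a J * q = 0"
  shows "q = 0"
proof -
  have *: "q = 0" if "finite C" "(\<Prod>g\<in>C. lin a g) * q = 0" for C
    using that
  proof (induction C)
    case (insert g C)
    have "lin a g * ((\<Prod>g\<in>C. lin a g) * q) = 0"
      using insert.prems insert.hyps by (simp add: mult.assoc)
    then have "(\<Prod>g\<in>C. lin a g) * q = 0"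
      unfolding lin_def[of a g] by (rule X_minus_Const_mult_eq_0)
    then show ?case by (rule insert.IH)
  qed simp
  show ?thesis
    by (rule *[of "Child \<gamma> a - J"]) (use assms finite_Child in \<open>simp_all add: S_poly_lin\<close>)
qed

lemma R_mult_eq_0: "e \<in> nodes \<gamma> \<Longrightarrow> R_poly \<gamma> e * q = 0 \<Longrightarrow> q = 0"
proof (induction rule: tree_induct)
  case (step e)
  have "S_poly \<gamma> (Par \<gamma> e) {e} * (R_poly \<gamma> (Par \<gamma> e) * q) = 0"
    using step(4) by (simp only: R_step[OF step(1,2)] mult.assoc)
  then show ?case using S_poly_mult_eq_0 step(3) by blast
qed (simp add: R_root)

lemma exact_quot_Q:
  assumes "e \<in> nodes \<gamma>" "c \<in> down \<gamma> e"
  shows "exact_quot (Q_poly \<gamma> e) (R_poly \<gamma> c) = T_poly c e"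
  unfolding exact_quot_def
proof (rule the_equality)
  show "T_poly c e * R_poly \<gamma> c = Q_poly \<gamma> e" using Q_T[OF assms] by simp
  fix q assume "q * R_poly \<gamma> c = Q_poly \<gamma> e"
  then have "R_poly \<gamma> c * (q - T_poly c e) = 0"
    unfolding Q_T[OF assms] by (simp add: right_diff_distrib mult.commute)
  moreover have "c \<in> nodes \<gamma>" using assms by (simp add: down_def)
  ultimately have "q - T_poly c e = 0" by (rule R_mult_eq_0[rotated])
  then show "q = T_poly c e" by simp
qed

lemma Delta_eq:
  assumes "e \<in> nodes \<gamma>" "a \<in> Anc \<gamma> e"
  shows "Delta \<gamma> a e = lin a (next_node \<gamma> a e) * X (Some e) - X (Some a) * T_poly (next_node \<gamma> a e) e"
  using next_node_in[OF assms] assms by (simp add: Delta_def Let_def exact_quot_Q lin_def)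

section \<open>Dependence of the tree polynomials on the variables\<close>

definition lower_vars :: "'n \<Rightarrow> 'n option set" where
  "lower_vars e = insert None (Some ` Anc \<gamma> e)"

definition all_vars :: "'n option set" where
  "all_vars = insert None (Some ` inner_nodes \<gamma>)"

text \<open>The shift by one makes the level of X_{Par(a)} equal to the depth of \<open>a\<close>,
  including the root, whose variable is X_0. The level drives the recursions over the variables and
  counts the factors \<open>h\<close> that a variable costs.\<close>

definition level :: "'n option \<Rightarrow> nat" where
  "level v = (case v of None \<Rightarrow> 0 | Some e \<Rightarrow> Suc (depth e))"

lemma level_simps [simp]: "level None = 0" "level (Some e) = Suc (depth e)"
  by (simp_all add: level_def)

lemma level_lower_vars: "v \<in> lower_vars e \<Longrightarrow> level v < level (Some e)"
  by (auto simp: lower_vars_def depth_Anc)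

lemma lower_vars_subset: "e \<in> nodes \<gamma> \<Longrightarrow> lower_vars e \<subseteq> all_vars"
  using Anc_inner unfolding lower_vars_def all_vars_def by blast

lemma lower_vars_mono: "a \<in> down \<gamma> e \<Longrightarrow> lower_vars a \<subseteq> lower_vars e"
  using Anc_mono unfolding lower_vars_def by blast

lemma carrier_A_ring: "carrier (A_ring \<gamma>) = polys all_vars"
  by (simp add: A_ring_def polys_def all_vars_def)

lemma ParX_lower: "a \<in> nodes \<gamma> \<Longrightarrow> ParX \<gamma> a \<in> lower_vars a"
  using Par_Anc[of a] by (simp add: ParX_def lower_vars_def)

lemma level_ParX: "a \<in> nodes \<gamma> \<Longrightarrow> level (ParX \<gamma> a) = depth a"
  by (simp add: ParX_def depth_Par[of a])

lemma lin_polys: "a \<in> nodes \<gamma> \<Longrightarrow> lin a g \<in> polys (lower_vars a)"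
  unfolding lin_def by (intro polys_intros ParX_lower) simp_all

lemma S_polys: "a \<in> nodes \<gamma> \<Longrightarrow> S_poly \<gamma> a J \<in> polys (lower_vars a)"
  unfolding S_poly_lin by (intro polys_intros lin_polys)

lemma S_polys_down:
  assumes "a \<in> down \<gamma> e" shows "S_poly \<gamma> a J \<in> polys (lower_vars e)"
proof -
  have "a \<in> nodes \<gamma>" using assms by (simp add: down_def)
  then show ?thesis using S_polys polys_mono[OF lower_vars_mono[OF assms]] by blast
qed

lemma R_polys: "e \<in> nodes \<gamma> \<Longrightarrow> R_poly \<gamma> e \<in> polys (lower_vars e)"
  unfolding R_prod by (intro polys_prod S_polys_down) (simp add: Anc_def)

lemma T_polys: "e \<in> nodes \<gamma> \<Longrightarrow> T_poly c e \<in> polys (lower_vars e)"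
  unfolding T_poly_def U_poly_def
  by (intro polys_mult polys_prod S_polys_down) (auto simp: Anc_def down_def tord_refl)

lemma Q_polys: "e \<in> nodes \<gamma> \<Longrightarrow> Q_poly \<gamma> e \<in> polys (lower_vars e)"
  unfolding Q_poly_def by (intro polys_mult S_polys R_polys)

text \<open>At each ancestor \<open>a\<close>, R_e collects the factors of all children of
  \<open>a\<close> except the one towards \<open>e\<close>. Hence the other factors become
  invertible as soon as R_e is.\<close>

lemma lin_factor_R:
  assumes e: "e \<in> nodes \<gamma>" and a: "a \<in> Anc \<gamma> e" and g: "g \<in> Child \<gamma> a" "g \<noteq> next_node \<gamma> a e"
  shows "\<exists>s \<in> polys (lower_vars e). R_poly \<gamma> e = lin a g * s"
proof -
  let ?c = "next_node \<gamma> a e"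
  have "S_poly \<gamma> a {?c} = lin a g * (\<Prod>g'\<in>Child \<gamma> a - {?c} - {g}. lin a g')"
    unfolding S_poly_lin by (rule prod.remove) (use g finite_Child in auto)
  moreover have "R_poly \<gamma> e = S_poly \<gamma> a {?c} * (\<Prod>b\<in>Anc \<gamma> e - {a}. S_poly \<gamma> b {next_node \<gamma> b e})"
    unfolding R_prod[OF e] by (rule prod.remove) (use a finite_Anc in auto)
  ultimately have "R_poly \<gamma> e = lin a g * ((\<Prod>g'\<in>Child \<gamma> a - {?c} - {g}. lin a g') *
      (\<Prod>b\<in>Anc \<gamma> e - {a}. S_poly \<gamma> b {next_node \<gamma> b e}))"
    by (simp only: mult.assoc)
  moreover have "lin a g' \<in> polys (lower_vars e)" for g'
    using lin_polys[OF Anc_nodes[OF a]] polys_mono[OF lower_vars_mono[of a e]] a by (auto simp: Anc_def)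
  then have "(\<Prod>g'\<in>Child \<gamma> a - {?c} - {g}. lin a g') *
      (\<Prod>b\<in>Anc \<gamma> e - {a}. S_poly \<gamma> b {next_node \<gamma> b e}) \<in> polys (lower_vars e)"
    by (intro polys_mult polys_prod S_polys_down) (auto simp: Anc_def)
  ultimately show ?thesis by blast
qed

text \<open>The levels of these variables are the depths of the nodes, which differ along a
  chain.\<close>

lemma ParX_inj:
  assumes "f \<in> nodes \<gamma>"
  shows "inj_on (ParX \<gamma>) (Anc \<gamma> f)"
proof
  fix a b assume ab: "a \<in> Anc \<gamma> f" "b \<in> Anc \<gamma> f" "ParX \<gamma> a = ParX \<gamma> b"
  then have "depth a = depth b"
    using level_ParX[of a] level_ParX[of b] Anc_nodes by simp
  then have "a \<notin> Anc \<gamma> b" "b \<notin> Anc \<gamma> a"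
    using depth_Anc[of a b] depth_Anc[of b a] by auto
  moreover have "a \<in> down \<gamma> f" "b \<in> down \<gamma> f"
    using ab by (auto simp: Anc_def)
  ultimately show "a = b"
    using down_total[OF assms, of a b] by (auto simp: Anc_def down_def)
qed

text \<open>A node of maximal depth serves: an inner node has a child, which is one deeper.\<close>

lemma depth_less_leaf_exists:
  obtains f where "f \<in> Leaves \<gamma>" "\<And>e. e \<in> inner_nodes \<gamma> \<Longrightarrow> depth e < depth f"
proof -
  obtain f where f: "f \<in> nodes \<gamma>" "\<And>e. e \<in> nodes \<gamma> \<Longrightarrow> depth e \<le> depth f"
  proof -
    have "Max (depth ` nodes \<gamma>) \<in> depth ` nodes \<gamma>"
      using finite_nodes root_node by (intro Max_in) auto
    then obtain f where "f \<in> nodes \<gamma>" "depth f = Max (depth ` nodes \<gamma>)" by auto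
    then show thesis using that finite_nodes by simp
  qed
  have *: "depth e < depth f" if e: "e \<in> inner_nodes \<gamma>" for e
  proof -
    obtain g where "g \<in> Child \<gamma> e" using Child_nonempty[OF e] by blast
    then show ?thesis using ChildD[of g e] f(2)[of g] inner_nodesD[OF e] by auto
  qed
  then have "f \<in> Leaves \<gamma>" using f(1) by (auto simp: inner_nodes_def)
  with * that show thesis by blast
qed

lemma LeavesD: "f \<in> Leaves \<gamma> \<Longrightarrow> f \<in> nodes \<gamma>"
  by (simp add: Leaves_def max_elts_def)

end


section \<open>Torsion-freeness\<close>

text \<open>\<open>Y n\<close> is the n-th iterate of \<open>F\<close> on an arbitrary start. Its
  value at \<open>v\<close> no longer changes once n exceeds the level of \<open>v\<close>, so the
  diagonal is a solution.\<close>

lemma level_recursion: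
  fixes lv :: "'v \<Rightarrow> nat" and F :: "'v \<Rightarrow> ('v \<Rightarrow> 'b) \<Rightarrow> 'b"
  assumes "\<And>v y y'. (\<And>u. lv u < lv v \<Longrightarrow> y u = y' u) \<Longrightarrow> F v y = F v y'"
  shows "\<exists>y. \<forall>v. y v = F v y"
proof -
  define Y where "Y = rec_nat (\<lambda>_. undefined) (\<lambda>_ y v. F v y)"
  have Y_Suc: "Y (Suc n) = (\<lambda>v. F v (Y n))" for n by (simp add: Y_def)
  have eq: "Y n v = Y m v" if "lv v < n" "lv v < m" for n m v
    using that
  proof (induction n arbitrary: m v)
    case (Suc n)
    then obtain k where k: "m = Suc k" by (cases m) auto
    show ?case unfolding k Y_Suc
      by (rule assms, rule Suc.IH) (use Suc.prems k in auto)
  qed simp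
  have "Y (Suc (lv v)) v = F v (\<lambda>u. Y (Suc (lv u)) u)" for v
    unfolding Y_Suc[of "lv v"] by (rule assms, rule eq) auto
  then show ?thesis by (intro exI[of _ "\<lambda>u. Y (Suc (lv u)) u"] allI)
qed

lemma idl_mult_span:
  assumes "x \<in> idl.span S" "\<And>s. s \<in> S \<Longrightarrow> r * s \<in> idl.span T"
  shows "r * x \<in> idl.span T"
  using assms(1)
proof (induction rule: idl.span_induct_alt)
  case (step c s y)
  have "r * (c * s + y) = c * (r * s) + r * y" by (simp add: algebra_simps)
  then show ?case using step assms(2) by (simp add: idl.span_add idl.span_scale)
qed (simp add: idl.span_zero)

lemma hom_idl_span:
  assumes "comm_hom \<theta>" "\<And>s. s \<in> S \<Longrightarrow> \<theta> s = 0" "x \<in> idl.span S"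
  shows "\<theta> x = 0"
proof -
  interpret comm_hom \<theta> by fact
  show ?thesis
    using assms(3) by (induction rule: idl.span_induct_alt) (simp_all add: hom_simps assms(2))
qed

lemma radical_add:
  assumes "idl.subspace J" "x ^ n \<in> J" "y ^ m \<in> J"
  shows "(x + y) ^ (n + m) \<in> J"
  unfolding binomial_ring
proof (rule idl.subspace_sum[OF assms(1)])
  fix k assume "k \<in> {..n + m}"
  show "of_nat (n + m choose k) * x ^ k * y ^ (n + m - k) \<in> J"
  proof (cases "n \<le> k")
    case True
    then have "of_nat (n + m choose k) * x ^ k * y ^ (n + m - k)
        = (of_nat (n + m choose k) * x ^ (k - n) * y ^ (n + m - k)) * x ^ n"
      using power_add[of x n "k - n"] by (simp add: mult_ac)
    then show ?thesis using idl.subspace_scale[OF assms(1,2)] by metis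
  next
    case False
    then have "m + (n - k) = n + m - k" by simp
    then have "of_nat (n + m choose k) * x ^ k * y ^ (n + m - k)
        = (of_nat (n + m choose k) * x ^ k * y ^ (n - k)) * y ^ m"
      by (metis (no_types) mult.assoc mult.commute power_add)
    then show ?thesis using idl.subspace_scale[OF assms(1,3)] by metis
  qed
qed

text \<open>The elements with some power in \<open>J\<close> are closed under sums and multiples, so
  they include the whole ideal generated by \<open>S\<close>, in particular 1.\<close>

lemma comaximal_powers:
  assumes J: "idl.subspace J" and one: "1 \<in> idl.span S" and S: "\<And>s. s \<in> S \<Longrightarrow> \<exists>n. s ^ n \<in> J"
  shows "1 \<in> J"
proof -
  have "\<exists>n. x ^ n \<in> J" if "x \<in> idl.span S" for x
    using that
  proof (induction rule: idl.span_induct_alt)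
    case base
    have "0 ^ 1 \<in> J" using idl.subspace_0[OF J] by simp
    then show ?case by blast
  next
    case (step c s y)
    then obtain n m where "s ^ n \<in> J" "y ^ m \<in> J" using S by blast
    then have "(c * s) ^ n \<in> J" "y ^ m \<in> J"
      using idl.subspace_scale[OF J] by (simp_all add: power_mult_distrib)
    then show ?case using radical_add[OF J] by blast
  qed
  from this[OF one] show ?thesis by simp
qed

text \<open>Modulo X_v - c(g) the product over the other roots becomes the constant \<Prod>(c(g) -
  c(g')), which is nonzero and so a unit. When g is inserted, the induction hypothesis is applied to
  (X_v - c(g)) y in place of y.\<close>

lemma comaximal_linear_factors:
  fixes c :: "'g \<Rightarrow> complex" and y :: "'n apoly"
  assumes J: "idl.subspace J" and C: "finite C" "C \<noteq> {}" "inj_on c C"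
    and *: "\<And>g. g \<in> C \<Longrightarrow> (\<Prod>g'\<in>C - {g}. X v - Const [:c g':]) * y \<in> J"
  shows "y \<in> J"
  using C *
proof (induction C arbitrary: y rule: finite_ne_induct)
  case (singleton g)
  then show ?case by simp
next
  case (insert g C)
  let ?L = "\<lambda>g. X v - Const [:c g:] :: 'n apoly"
  have "?L g * y \<in> J"
  proof (rule insert.IH)
    fix g0 assume g0: "g0 \<in> C"
    then have "insert g C - {g0} = insert g (C - {g0})" using insert.hyps by auto
    then have "(\<Prod>g'\<in>insert g C - {g0}. ?L g') = ?L g * (\<Prod>g'\<in>C - {g0}. ?L g')"
      using insert.hyps by simp
    then show "(\<Prod>g'\<in>C - {g0}. ?L g') * (?L g * y) \<in> J"
      using insert.prems(2)[of g0] g0 by (simp add: mult_ac)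
  qed (use insert.prems in \<open>auto simp: inj_on_def\<close>)
  define d where "d = (\<Prod>g'\<in>C. c g - c g')"
  have "d \<noteq> 0" using insert.hyps insert.prems(1) by (auto simp: d_def inj_on_def)
  have "\<exists>q. (\<Prod>g'\<in>D. ?L g') = ?L g * q + Const [:\<Prod>g'\<in>D. c g - c g':]" if "finite D" for D
    using that
  proof (induction D)
    case empty
    show ?case by (rule exI[of _ 0]) (simp add: Const.one flip: one_pCons)
  next
    case (insert g' D)
    then obtain q where q: "(\<Prod>g'\<in>D. ?L g') = ?L g * q + Const [:\<Prod>g'\<in>D. c g - c g':]" by blast
    let ?e = "\<Prod>g'\<in>D. c g - c g'"
    have L: "?L g' = ?L g + Const [:c g - c g':]"
      by (simp add: algebra_simps flip: Const.add Const.diff)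
    have "(\<Prod>g'\<in>insert g' D. ?L g') = ?L g' * (?L g * q + Const [:?e:])"
      using insert.hyps q by simp
    also have "\<dots> = ?L g * (?L g' * q + Const [:?e:]) + Const [:c g - c g':] * Const [:?e:]"
      unfolding L by (simp add: algebra_simps)
    also have "Const [:c g - c g':] * Const [:?e:] = (Const [:(\<Prod>g'\<in>insert g' D. c g - c g'):] :: 'n apoly)"
      using insert.hyps by (simp add: mult.commute flip: Const.mult)
    finally show ?case by blast
  qed
  then obtain q where q: "(\<Prod>g'\<in>C. ?L g') = ?L g * q + Const [:d:]"
    using insert.hyps unfolding d_def by blast
  have "(\<Prod>g'\<in>C. ?L g') * y \<in> J"
    using insert.prems(2)[of g] insert.hyps by simp
  then have "(\<Prod>g'\<in>C. ?L g') * y - q * (?L g * y) \<in> J"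
    using idl.subspace_diff[OF J] idl.subspace_scale[OF J \<open>?L g * y \<in> J\<close>] by blast
  then have "Const [:d:] * y \<in> J" unfolding q by (simp add: algebra_simps)
  then have "Const [:1 / d:] * (Const [:d:] * y) \<in> J" by (rule idl.subspace_scale[OF J])
  moreover have "Const [:1 / d:] * Const [:d:] = (1 :: 'n apoly)"
    using \<open>d \<noteq> 0\<close> by (simp add: Const.one flip: Const.mult one_pCons)
  ultimately show ?case by (simp flip: mult.assoc)
qed

abbreviation hh :: "'n apoly" where "hh \<equiv> Const hA"

lemma hA_nz [simp]: "hA \<noteq> 0"
  by (simp add: hA_def)

lemma hh_power: "hh ^ n = Const (hA ^ n)"
  by (simp add: Const.power)

lemma hh_mult_eq_0: "hh ^ n * p = 0 \<Longrightarrow> p = 0"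
  unfolding hh_power by (erule Const_mult_eq_0) simp

context fl_rooted_tree
begin

text \<open>The ideal is taken in the ring with a variable for every element of the type of nodes;
  its intersection with the carrier is \<^term>\<open>I_ideal \<gamma>\<close>.\<close>

definition II :: "'n apoly set" where
  "II = idl.span ({Delta0 \<gamma> e | e. e \<in> inner_nodes \<gamma>} \<union>
      {Delta \<gamma> e' e | e e'. e \<in> inner_nodes \<gamma> \<and> e' \<in> Anc \<gamma> e})"

lemma II_subspace: "idl.subspace II"
  by (simp add: II_def)

lemmas II_0 [simp] = idl.subspace_0[OF II_subspace]
  and II_add = idl.subspace_add[OF II_subspace]
  and II_diff = idl.subspace_diff[OF II_subspace]
  and II_scale = idl.subspace_scale[OF II_subspace]

lemma II_mult_right: "x \<in> II \<Longrightarrow> x * c \<in> II"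
  unfolding II_def by (rule idl_mult_right)

lemma Delta0_II: "e \<in> inner_nodes \<gamma> \<Longrightarrow> Delta0 \<gamma> e \<in> II"
  unfolding II_def by (rule idl.span_base) blast

lemma Delta_II: "e \<in> inner_nodes \<gamma> \<Longrightarrow> a \<in> Anc \<gamma> e \<Longrightarrow> Delta \<gamma> a e \<in> II"
  unfolding II_def by (rule idl.span_base) blast

section \<open>The generic fibre of the surface\<close>

definition kap :: "complex poly \<Rightarrow> complex poly fract poly" where
  "kap a = [:to_fract a:]"

lemma kap_hom: "comm_hom kap"
  by unfold_locales (simp_all add: kap_def flip: one_pCons)

text \<open>The images of the variables in \<open>K[X\<^sub>0]\<close>, \<open>K\<close> the fraction field of \<open>A\<close>, under which
  \<open>h X\<^sub>e = Q\<^sub>e\<close>.\<close>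

definition coord :: "'n option \<Rightarrow> complex poly fract poly" where
  "coord = (SOME y. \<forall>v. y v = (case v of None \<Rightarrow> [:0, 1:]
     | Some e \<Rightarrow> if e \<in> nodes \<gamma> then [:1 / to_fract hA:] * subst kap y (Q_poly \<gamma> e) else 0))"

text \<open>The composite A[\<Gamma>] \<rightarrow> B \<rightarrow> K[X_0]. By
  \<open>kernel_Phi\<close> nothing beyond the ideal is lost, so \<open>B\<close> may be treated as
  a subring of K[X_0].\<close>

definition Phi :: "'n apoly \<Rightarrow> complex poly fract poly" where
  "Phi = subst kap coord"

lemma coord_eq: "coord v = (case v of None \<Rightarrow> [:0, 1:]
     | Some e \<Rightarrow> if e \<in> nodes \<gamma> then [:1 / to_fract hA:] * subst kap coord (Q_poly \<gamma> e) else 0)"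
proof -
  have "\<exists>y. \<forall>v. y v = (case v of None \<Rightarrow> [:0, 1:]
     | Some e \<Rightarrow> if e \<in> nodes \<gamma> then [:1 / to_fract hA:] * subst kap y (Q_poly \<gamma> e) else 0)"
  proof (rule level_recursion[where lv = level])
    fix v and y y' :: "'n option \<Rightarrow> complex poly fract poly"
    assume eq: "\<And>u. level u < level v \<Longrightarrow> y u = y' u"
    have "subst kap y (Q_poly \<gamma> e) = subst kap y' (Q_poly \<gamma> e)" if "v = Some e" "e \<in> nodes \<gamma>" for e
      using subst_cong_polys[OF Q_polys[OF that(2)]] eq level_lower_vars that(1) by blast
    then show "(case v of None \<Rightarrow> [:0, 1:]
       | Some e \<Rightarrow> if e \<in> nodes \<gamma> then [:1 / to_fract hA:] * subst kap y (Q_poly \<gamma> e) else 0)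
      = (case v of None \<Rightarrow> [:0, 1:]
       | Some e \<Rightarrow> if e \<in> nodes \<gamma> then [:1 / to_fract hA:] * subst kap y' (Q_poly \<gamma> e) else 0)"
      by (auto split: option.split)
  qed
  then have "\<forall>v. coord v = (case v of None \<Rightarrow> [:0, 1:]
     | Some e \<Rightarrow> if e \<in> nodes \<gamma> then [:1 / to_fract hA:] * subst kap coord (Q_poly \<gamma> e) else 0)"
    unfolding coord_def by (rule someI_ex)
  then show ?thesis by blast
qed

sublocale Phi: comm_hom Phi
  unfolding Phi_def by (rule comm_hom.subst_comm_hom[OF kap_hom])

lemma Phi_Const: "Phi (Const a) = [:to_fract a:]"
  unfolding Phi_def by (simp add: comm_hom_subst_simps[OF kap_hom] kap_def)

lemma Phi_X0: "Phi (X None) = [:0, 1:]"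
  unfolding Phi_def by (simp add: comm_hom_subst_simps[OF kap_hom] coord_eq)

lemma Phi_hX:
  assumes "e \<in> nodes \<gamma>"
  shows "Phi (hh * X (Some e)) = Phi (Q_poly \<gamma> e)"
proof -
  have "Phi (X (Some e)) = [:1 / to_fract hA:] * Phi (Q_poly \<gamma> e)"
    unfolding Phi_def comm_hom_subst_simps[OF kap_hom] using assms by (subst coord_eq) simp
  then show ?thesis by (simp add: Phi.mult Phi_Const)
qed

lemma Phi_Delta0: "e \<in> nodes \<gamma> \<Longrightarrow> Phi (Delta0 \<gamma> e) = 0"
  unfolding Delta0_def by (simp add: Phi.diff Phi_hX)

lemma Phi_hh_cancel: "Phi (hh ^ n * p) = 0 \<Longrightarrow> Phi p = 0"
  by (simp add: Phi.mult Phi_Const Phi.power)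

text \<open>Multiplied by \<open>h\<close>, the relation becomes l Q_e - Q_a (Q_e / R_c), with c the
  child of \<open>a\<close> towards \<open>e\<close> and l its linear factor. This vanishes since
  Q_a = l R_c, and \<open>h\<close> is invertible in K[X_0].\<close>

lemma Phi_Delta:
  assumes "e \<in> nodes \<gamma>" "a \<in> Anc \<gamma> e"
  shows "Phi (Delta \<gamma> a e) = 0"
proof -
  let ?c = "next_node \<gamma> a e"
  have a: "a \<in> nodes \<gamma>" using assms Anc_nodes by blast
  have c: "?c \<in> Child \<gamma> a" "?c \<in> down \<gamma> e" by (rule next_node_in[OF assms])+
  have "hh * Delta \<gamma> a e = lin a ?c * (hh * X (Some e)) - (hh * X (Some a)) * T_poly ?c e"
    unfolding Delta_eq[OF assms] by (simp add: algebra_simps)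
  then have "Phi (hh * Delta \<gamma> a e) = Phi (lin a ?c) * Phi (Q_poly \<gamma> e) - Phi (Q_poly \<gamma> a) * Phi (T_poly ?c e)"
    using assms a by (simp only: Phi.diff Phi.mult[of "lin a ?c"] Phi.mult[of _ "T_poly ?c e"] Phi_hX)
  also have "\<dots> = 0"
    unfolding Q_T[OF assms(1) c(2)] Q_lin[OF a c(1)] by (simp add: Phi.mult mult_ac)
  finally show ?thesis using Phi_hh_cancel[of 1] by simp
qed

lemma Phi_II: "p \<in> II \<Longrightarrow> Phi p = 0"
  unfolding II_def
  by (rule hom_idl_span[OF Phi.comm_hom_axioms])
    (auto simp: Phi_Delta0 Phi_Delta inner_nodesD)

lemma single_None:
  assumes "q \<in> polys {None}" "m \<in> Poly_Mapping.keys q"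
  shows "m = Poly_Mapping.single None (Poly_Mapping.lookup m None)"
proof (rule poly_mapping_eqI)
  fix v show "Poly_Mapping.lookup m v = Poly_Mapping.lookup (Poly_Mapping.single None (Poly_Mapping.lookup m None)) v"
    using assms by (cases v) (auto simp: polys_def lookup_single when_def in_keys_iff subset_iff)
qed

text \<open>On polynomials in X_0 alone, \<open>Phi\<close> is just the inclusion of A[X_0] into
  K[X_0].\<close>

lemma coeff_Phi:
  assumes q: "q \<in> polys {None}"
  shows "Polynomial.coeff (Phi q) k = to_fract (Poly_Mapping.lookup q (Poly_Mapping.single None k))"
proof -
  have eval: "mono_eval coord m = Polynomial.monom 1 (Poly_Mapping.lookup m None)" if "m \<in> Poly_Mapping.keys q" for m
  proof -
    have "mono_eval coord m = (\<Prod>v\<in>{None}. coord v ^ Poly_Mapping.lookup m v)"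
      by (rule mono_eval_superset) (use q that in \<open>auto simp: polys_def\<close>)
    then show ?thesis by (simp add: coord_eq monom_altdef)
  qed
  let ?m0 = "Poly_Mapping.single None k"
  have "Polynomial.coeff (Phi q) k = (\<Sum>m\<in>Poly_Mapping.keys q. Polynomial.coeff (kap (Poly_Mapping.lookup q m) * mono_eval coord m) k)"
    by (simp add: Phi_def subst_def coeff_sum)
  also have "\<dots> = (\<Sum>m\<in>Poly_Mapping.keys q. if m = ?m0 then to_fract (Poly_Mapping.lookup q ?m0) else 0)"
  proof (rule sum.cong[OF refl])
    fix m assume m: "m \<in> Poly_Mapping.keys q"
    have "m = ?m0 \<longleftrightarrow> Poly_Mapping.lookup m None = k"
      using single_None[OF q m] by (metis lookup_single_eq)
    then show "Polynomial.coeff (kap (Poly_Mapping.lookup q m) * mono_eval coord m) k =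
        (if m = ?m0 then to_fract (Poly_Mapping.lookup q ?m0) else 0)"
      unfolding eval[OF m] kap_def by auto
  qed
  also have "\<dots> = to_fract (Poly_Mapping.lookup q ?m0)" by (simp add: in_keys_iff)
  finally show ?thesis .
qed

lemma Phi_None_inj:
  assumes q: "q \<in> polys {None}" and "Phi q = 0"
  shows "q = 0"
proof (rule ccontr)
  assume "q \<noteq> 0"
  then obtain m where m: "m \<in> Poly_Mapping.keys q" by fastforce
  have "Poly_Mapping.lookup q (Poly_Mapping.single None k) = 0" for k
    using coeff_Phi[OF q, of k] assms(2) by simp
  with single_None[OF q m] m show False by (metis in_keys_iff)
qed

lemma Phi_None_const:
  assumes q: "q \<in> polys {None}" and "Phi q = [:z:]"
  shows "\<exists>c. q = Const c"
proof -
  let ?c = "Poly_Mapping.lookup q 0"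
  have "Phi (q - Const ?c) = 0"
  proof (rule poly_eqI)
    fix k show "Polynomial.coeff (Phi (q - Const ?c)) k = Polynomial.coeff 0 k"
      using coeff_Phi[OF q, of k] assms(2) by (cases k) (simp_all add: Phi.diff Phi_Const)
  qed
  moreover have "q - Const ?c \<in> polys {None}" by (rule polys_diff[OF q]) simp
  ultimately have "q - Const ?c = 0" by (rule Phi_None_inj[rotated])
  then show ?thesis by (intro exI[of _ ?c]) simp
qed

text \<open>Each X_e is traded for Q_e at the cost of one factor \<open>h\<close>, and Q_e involves
  only variables of proper ancestors. The set \<open>P\<close> is a parameter because the argument
  at a leaf allows only the relations along one path, while the slope argument uses all inner
  nodes.\<close>

lemma clear_denominators_aux:
  assumes P: "P \<subseteq> nodes \<gamma>" "\<And>e. e \<in> P \<Longrightarrow> Anc \<gamma> e \<subseteq> P"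
  shows "p \<in> polys (insert None (Some ` {e \<in> P. depth e < n})) \<Longrightarrow>
    \<exists>N q. q \<in> polys {None} \<and> hh ^ N * p - q \<in> idl.span (Delta0 \<gamma> ` P)"
proof (induction n arbitrary: p)
  case 0
  then have "p \<in> polys {None}" by simp
  then have "p \<in> polys {None} \<and> hh ^ 0 * p - p \<in> idl.span (Delta0 \<gamma> ` P)"
    by (simp add: idl.span_zero)
  then show ?case by blast
next
  case (Suc n)
  show ?case using Suc.prems
  proof (induction rule: polys_induct)
    case (Const c)
    have "Const c \<in> polys {None} \<and> hh ^ 0 * Const c - Const c \<in> idl.span (Delta0 \<gamma> ` P)"
      by (simp add: idl.span_zero)
    then show ?case by blast
  next
    case (X v)
    show ?case
    proof (cases v)
      case None
      have "X None \<in> polys {None} \<and> hh ^ 0 * X None - X None \<in> idl.span (Delta0 \<gamma> ` P)"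
        by (simp add: idl.span_zero polys_X)
      then show ?thesis using None by blast
    next
      case (Some e)
      then have e: "e \<in> P" "depth e < Suc n" "e \<in> nodes \<gamma>" using X P by auto
      have "lower_vars e \<subseteq> insert None (Some ` {e \<in> P. depth e < n})"
        using P(2)[OF e(1)] e(2) depth_Anc[of _ e] by (fastforce simp: lower_vars_def)
      then have "Q_poly \<gamma> e \<in> polys (insert None (Some ` {e \<in> P. depth e < n}))"
        using Q_polys[OF e(3)] polys_mono by blast
      then obtain N q where q: "q \<in> polys {None}" "hh ^ N * Q_poly \<gamma> e - q \<in> idl.span (Delta0 \<gamma> ` P)"
        using Suc.IH by blast
      have "hh ^ Suc N * X (Some e) - q = hh ^ N * Delta0 \<gamma> e + (hh ^ N * Q_poly \<gamma> e - q)"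
        by (simp add: Delta0_def algebra_simps)
      also have "\<dots> \<in> idl.span (Delta0 \<gamma> ` P)"
        using q e idl.span_base[of "Delta0 \<gamma> e" "Delta0 \<gamma> ` P"] by (intro idl.span_add idl.span_scale) auto
      finally show ?thesis using q Some by blast
    qed
  next
    case (add p p')
    then obtain N q N' q' where q: "q \<in> polys {None}" "hh ^ N * p - q \<in> idl.span (Delta0 \<gamma> ` P)"
      "q' \<in> polys {None}" "hh ^ N' * p' - q' \<in> idl.span (Delta0 \<gamma> ` P)" by blast
    have "hh ^ (N + N') * (p + p') - (hh ^ N' * q + hh ^ N * q')
        = hh ^ N' * (hh ^ N * p - q) + hh ^ N * (hh ^ N' * p' - q')"
      by (simp add: algebra_simps power_add)
    also have "\<dots> \<in> idl.span (Delta0 \<gamma> ` P)"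
      using q by (intro idl.span_add idl.span_scale)
    finally have "hh ^ (N + N') * (p + p') - (hh ^ N' * q + hh ^ N * q') \<in> idl.span (Delta0 \<gamma> ` P)" .
    moreover have "hh ^ N' * q + hh ^ N * q' \<in> polys {None}"
      using q by (intro polys_intros) auto
    ultimately show ?case by blast
  next
    case (mult p p')
    then obtain N q N' q' where q: "q \<in> polys {None}" "hh ^ N * p - q \<in> idl.span (Delta0 \<gamma> ` P)"
      "q' \<in> polys {None}" "hh ^ N' * p' - q' \<in> idl.span (Delta0 \<gamma> ` P)" by blast
    have "hh ^ (N + N') * (p * p') - q * q'
        = hh ^ N * p * (hh ^ N' * p' - q') + q' * (hh ^ N * p - q)"
      by (simp add: algebra_simps power_add)
    also have "\<dots> \<in> idl.span (Delta0 \<gamma> ` P)"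
      using q by (intro idl.span_add idl.span_scale)
    finally show ?case using q polys_mult by blast
  qed
qed

lemma clear_denominators:
  assumes P: "P \<subseteq> nodes \<gamma>" "\<And>e. e \<in> P \<Longrightarrow> Anc \<gamma> e \<subseteq> P" and p: "p \<in> polys (insert None (Some ` P))"
  shows "\<exists>N q. q \<in> polys {None} \<and> hh ^ N * p - q \<in> idl.span (Delta0 \<gamma> ` P)"
proof -
  have fin: "finite (depth ` P)" using P(1) finite_nodes finite_subset by blast
  have "{e \<in> P. depth e < Suc (Max (depth ` P))} = P"
    using Max_ge[OF fin] by (auto simp: less_Suc_eq_le)
  then show ?thesis using clear_denominators_aux[OF P, of p "Suc (Max (depth ` P))"] p by simp
qed

section \<open>The surface after inverting R_f, for a leaf f\<close>

context
  fixes f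
  assumes f: "f \<in> Leaves \<gamma>"
begin

lemma leaf_node: "f \<in> nodes \<gamma>"
  using f by (rule LeavesD)

text \<open>Reduction modulo \<open>h\<close> and the linear factors \<open>X\<^bsub>Par(a)\<^esub> - lb(a'')\<close>, \<open>a \<in> P\<close>, where
  \<open>a''\<close> is the child of \<open>a\<close> towards the leaf \<open>f\<close>.\<close>

definition spec_hom :: "'n set \<Rightarrow> 'n apoly \<Rightarrow> 'n apoly" where
  "spec_hom P = subst (\<lambda>a. Const [:poly a 0:])
     (\<lambda>v. if v \<in> ParX \<gamma> ` P then Const [:lb \<gamma> (next_node \<gamma> (inv_into (Anc \<gamma> f) (ParX \<gamma>) v) f):] else X v)"

lemma const_coeff_hom: "comm_hom (\<lambda>a. Const [:poly a 0:] :: 'n apoly)"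
proof
  show "(Const [:poly 1 0:] :: 'n apoly) = 1" using Const.one by (simp flip: one_pCons)
next
  fix a b :: "complex poly"
  show "(Const [:poly (a + b) 0:] :: 'n apoly) = Const [:poly a 0:] + Const [:poly b 0:]"
    by (simp flip: Const.add)
  show "(Const [:poly (a * b) 0:] :: 'n apoly) = Const [:poly a 0:] * Const [:poly b 0:]"
    by (simp add: mult.commute flip: Const.mult)
qed

interpretation spec: comm_hom "spec_hom P" for P
  unfolding spec_hom_def by (rule comm_hom.subst_comm_hom[OF const_coeff_hom])

lemma spec_Const: "spec_hom P (Const c) = Const [:poly c 0:]"
  unfolding spec_hom_def by (simp add: comm_hom_subst_simps[OF const_coeff_hom])

lemma spec_hh: "spec_hom P hh = 0"
  by (simp add: spec_Const hA_def Const.zero)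

lemma spec_X: "v \<notin> ParX \<gamma> ` P \<Longrightarrow> spec_hom P (X v) = X v"
  unfolding spec_hom_def by (simp add: comm_hom_subst_simps[OF const_coeff_hom])

lemma spec_X_ParX:
  assumes "a \<in> P" "P \<subseteq> Anc \<gamma> f"
  shows "spec_hom P (X (ParX \<gamma> a)) = Const [:lb \<gamma> (next_node \<gamma> a f):]"
proof -
  have "inv_into (Anc \<gamma> f) (ParX \<gamma>) (ParX \<gamma> a) = a"
    using assms by (intro inv_into_f_f ParX_inj leaf_node) auto
  then show ?thesis
    using assms unfolding spec_hom_def by (simp add: comm_hom_subst_simps[OF const_coeff_hom])
qed

lemma spec_lin: "a \<in> P \<Longrightarrow> P \<subseteq> Anc \<gamma> f \<Longrightarrow> spec_hom P (lin a (next_node \<gamma> a f)) = 0"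
  by (simp add: lin_def spec.diff spec_X_ParX spec_Const)

lemma Delta0_path:
  assumes "a \<in> Anc \<gamma> f"
  shows "Delta0 \<gamma> a = hh * X (Some a) - lin a (next_node \<gamma> a f) * R_poly \<gamma> (next_node \<gamma> a f)"
  unfolding Delta0_def Q_lin[OF Anc_nodes[OF assms] next_node_in(1)[OF leaf_node assms]] ..

text \<open>Generators suffice: a constant changes by a multiple of \<open>h\<close>, and X_{Par(a)}
  with \<open>a\<close> in \<open>P\<close> changes by its linear factor. So the kernel of
  \<open>spec_hom P\<close> lies in the ideal of \<open>h\<close> and these factors.\<close>

lemma minus_spec_hom:
  assumes "P \<subseteq> Anc \<gamma> f"
  shows "p - spec_hom P p \<in> idl.span (insert hh ((\<lambda>a. lin a (next_node \<gamma> a f)) ` P))"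
proof -
  let ?S = "idl.span (insert hh ((\<lambda>a. lin a (next_node \<gamma> a f)) ` P))"
  have "p \<in> polys UNIV" by simp
  then show ?thesis
  proof (induction rule: polys_induct)
    case (Const c)
    obtain a c' where c: "c = pCons a c'" by (cases c)
    then have "Const c - spec_hom P (Const c) = Const c' * hh"
      by (simp add: spec_Const hA_def flip: Const.diff Const.mult)
    moreover have "hh \<in> idl.span (insert hh ((\<lambda>a. lin a (next_node \<gamma> a f)) ` P))"
      by (rule idl.span_base) simp
    ultimately show ?case using idl.span_scale by metis
  next
    case (X v)
    show ?case
    proof (cases "v \<in> ParX \<gamma> ` P")
      case True
      then obtain a where a: "a \<in> P" "v = ParX \<gamma> a" by blast
      then have "X v - spec_hom P (X v) = lin a (next_node \<gamma> a f)"
        using assms by (simp add: spec_X_ParX lin_def)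
      then show ?thesis using a by (simp add: idl.span_base)
    next
      case False
      then show ?thesis by (simp add: spec_X idl.span_zero)
    qed
  next
    case (add p q)
    have "p + q - spec_hom P (p + q) = (p - spec_hom P p) + (q - spec_hom P q)"
      by (simp add: spec.add)
    then show ?case by (simp only: idl.span_add[OF add])
  next
    case (mult p q)
    have "p * q - spec_hom P (p * q) = p * (q - spec_hom P q) + spec_hom P q * (p - spec_hom P p)"
      by (simp add: spec.mult algebra_simps)
    then show ?case
      by (simp only: idl.span_add[OF idl.span_scale[OF mult(2)] idl.span_scale[OF mult(1)]])
  qed
qed

text \<open>R_f trades linear factors for relations: with c the child of \<open>a\<close> towards
  \<open>f\<close>, R_f is a multiple of R_c, and the linear factor times R_c is Q_a = h X_a -
  \<Delta>_{0,a}.\<close>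

lemma spec_hom_eq_0:
  assumes "P \<subseteq> Anc \<gamma> f" "spec_hom P p = 0"
  shows "R_poly \<gamma> f * p \<in> idl.span (insert hh (Delta0 \<gamma> ` P))"
proof (rule idl_mult_span)
  show "p \<in> idl.span (insert hh ((\<lambda>a. lin a (next_node \<gamma> a f)) ` P))"
    using minus_spec_hom[OF assms(1), of p] assms(2) by simp
  fix s assume "s \<in> insert hh ((\<lambda>a. lin a (next_node \<gamma> a f)) ` P)"
  then consider "s = hh" | a where "a \<in> P" "s = lin a (next_node \<gamma> a f)" by blast
  then show "R_poly \<gamma> f * s \<in> idl.span (insert hh (Delta0 \<gamma> ` P))"
  proof cases
    case 1
    then show ?thesis by (intro idl.span_scale idl.span_base) simp
  next
    case 2
    let ?c = "next_node \<gamma> a f"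
    have a: "a \<in> Anc \<gamma> f" using 2 assms(1) by blast
    have "R_poly \<gamma> f * s = U_poly ?c f * (X (Some a) * hh - Delta0 \<gamma> a)"
      unfolding Delta0_path[OF a] R_split[OF leaf_node next_node_in(2)[OF leaf_node a]] 2
      by (simp add: algebra_simps)
    also have "\<dots> \<in> idl.span (insert hh (Delta0 \<gamma> ` P))"
      using 2 by (intro idl.span_scale idl.span_diff idl.span_base) auto
    finally show ?thesis .
  qed
qed

text \<open>The elements \<open>\<Delta>\<^bsub>0,a\<^esub>\<close> with \<open>a\<close> below the leaf form a regular sequence
  modulo \<open>h\<close> after inverting \<open>R\<^sub>f\<close>, hence \<open>h\<close> remains regular modulo them.\<close>

lemma h_regular_at_leaf:
  assumes "finite P" "P \<subseteq> Anc \<gamma> f" "hh * p \<in> idl.span (Delta0 \<gamma> ` P)"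
  shows "\<exists>m. R_poly \<gamma> f ^ m * p \<in> idl.span (Delta0 \<gamma> ` P)"
  using assms
proof (induction P arbitrary: p)
  case empty
  then have "p = 0" using hh_mult_eq_0[of 1 p] by simp
  then show ?case by (simp add: idl.span_zero)
next
  case (insert b P)
  let ?r = "R_poly \<gamma> f" and ?D = "Delta0 \<gamma> b" and ?c = "next_node \<gamma> b f"
  have b: "b \<in> Anc \<gamma> f" and P: "P \<subseteq> Anc \<gamma> f" using insert.prems by auto
  have "spec_hom P (Delta0 \<gamma> a) = 0" if "a \<in> P" for a
  proof -
    have "a \<in> Anc \<gamma> f" using that P by blast
    then show ?thesis
      unfolding Delta0_path[OF \<open>a \<in> Anc \<gamma> f\<close>] by (simp only: spec.diff spec.mult spec_hh spec_lin[OF that P]) simp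
  qed
  then have sp: "x \<in> idl.span (Delta0 \<gamma> ` P) \<Longrightarrow> spec_hom P x = 0" for x
    using hom_idl_span[OF spec.comm_hom_axioms, of "Delta0 \<gamma> ` P" P x] by auto
  \<comment> \<open>Modulo the relations of \<open>P\<close>, h p is a multiple k D of the new
    relation D; up to powers of R_f, k has to be shown divisible by \<open>h\<close>.\<close>
  have "hh * p \<in> idl.span (insert ?D (Delta0 \<gamma> ` P))"
    using insert.prems(2) by simp
  then obtain k where k: "hh * p - k * ?D \<in> idl.span (Delta0 \<gamma> ` P)"
    by (subst (asm) idl.span_breakdown_eq) blast
  \<comment> \<open>The variable of \<open>b\<close> is not specialised, so its linear factor
    survives and can be cancelled.\<close>
  have nb: "ParX \<gamma> b \<notin> ParX \<gamma> ` P"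
    using ParX_inj[OF leaf_node] b P insert.hyps(2) by (auto dest: inj_onD)
  have "spec_hom P (lin b ?c) = lin b ?c"
    by (simp add: lin_def spec.diff spec_X[OF nb] spec_Const)
  then have "lin b ?c * (spec_hom P (R_poly \<gamma> ?c) * spec_hom P k) = 0"
    using sp[OF k] unfolding Delta0_path[OF b]
    by (simp add: spec.diff spec.mult spec_hh mult_ac)
  then have "spec_hom P (R_poly \<gamma> ?c) * spec_hom P k = 0"
    unfolding lin_def by (rule X_minus_Const_mult_eq_0)
  \<comment> \<open>One power of R_f, a multiple of R_c, makes k vanish under specialisation; a
    second one pays for passing from linear factors to relations. Hence the square of R_f in what
    follows.\<close>
  then have "spec_hom P (?r * k) = 0"
    unfolding R_split[OF leaf_node next_node_in(2)[OF leaf_node b]]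
    by (simp add: spec.mult mult.assoc)
  then have "?r * (?r * k) \<in> idl.span (insert hh (Delta0 \<gamma> ` P))"
    by (rule spec_hom_eq_0[OF P])
  then obtain c' where c': "?r * (?r * k) - c' * hh \<in> idl.span (Delta0 \<gamma> ` P)"
    by (subst (asm) idl.span_breakdown_eq) blast
  \<comment> \<open>The two congruences combine so that \<open>h\<close> times R_f^2 p - c' D lies
    in the ideal of \<open>P\<close>, which is the situation of the induction hypothesis.\<close>
  have "hh * (?r\<^sup>2 * p - c' * ?D) = ?r\<^sup>2 * (hh * p - k * ?D) + ?D * (?r * (?r * k) - c' * hh)"
    by (simp add: algebra_simps power2_eq_square)
  also have "\<dots> \<in> idl.span (Delta0 \<gamma> ` P)"
    by (rule idl.span_add[OF idl.span_scale[OF k] idl.span_scale[OF c']])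
  finally obtain m where m: "?r ^ m * (?r\<^sup>2 * p - c' * ?D) \<in> idl.span (Delta0 \<gamma> ` P)"
    using insert.IH[OF P] by blast
  have "?r ^ (m + 2) * p = ?r ^ m * (?r\<^sup>2 * p - c' * ?D) + (?r ^ m * c') * ?D"
    by (simp add: algebra_simps power_add power2_eq_square)
  also have "\<dots> \<in> idl.span (Delta0 \<gamma> ` insert b P)"
  proof (rule idl.span_add)
    show "?r ^ m * (?r\<^sup>2 * p - c' * ?D) \<in> idl.span (Delta0 \<gamma> ` insert b P)"
      using m idl.span_mono[of "Delta0 \<gamma> ` P" "Delta0 \<gamma> ` insert b P"] by blast
    show "(?r ^ m * c') * ?D \<in> idl.span (Delta0 \<gamma> ` insert b P)"
      by (intro idl.span_scale idl.span_base) simp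
  qed
  finally show ?case by blast
qed

lemma h_power_regular_at_leaf:
  assumes "hh ^ N * p \<in> idl.span (Delta0 \<gamma> ` Anc \<gamma> f)"
  shows "\<exists>m. R_poly \<gamma> f ^ m * p \<in> idl.span (Delta0 \<gamma> ` Anc \<gamma> f)"
  using assms
proof (induction N arbitrary: p)
  case 0
  then have "R_poly \<gamma> f ^ 0 * p \<in> idl.span (Delta0 \<gamma> ` Anc \<gamma> f)" by simp
  then show ?case by blast
next
  case (Suc N)
  let ?r = "R_poly \<gamma> f"
  have "hh ^ N * (hh * p) \<in> idl.span (Delta0 \<gamma> ` Anc \<gamma> f)"
    using Suc.prems by (simp add: mult_ac)
  then obtain m where "?r ^ m * (hh * p) \<in> idl.span (Delta0 \<gamma> ` Anc \<gamma> f)"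
    using Suc.IH by blast
  then have "hh * (?r ^ m * p) \<in> idl.span (Delta0 \<gamma> ` Anc \<gamma> f)"
    by (simp add: mult_ac)
  then obtain n where "?r ^ n * (?r ^ m * p) \<in> idl.span (Delta0 \<gamma> ` Anc \<gamma> f)"
    using h_regular_at_leaf[OF finite_Anc subset_refl] by blast
  then have "?r ^ (n + m) * p \<in> idl.span (Delta0 \<gamma> ` Anc \<gamma> f)"
    by (simp add: power_add mult.assoc)
  then show ?case by blast
qed

text \<open>A variable X_e off the path is eliminated by the relation \<Delta>_{a,e} at the node
  \<open>a\<close> where the path to \<open>e\<close> leaves the path to \<open>f\<close>: the
  coefficient of X_e there, the linear factor of the child towards \<open>e\<close>, divides R_f,
  and the other term has variables of smaller level only.\<close>

lemma path_reduction_aux: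
  "p \<in> polys {v \<in> all_vars. level v < n} \<Longrightarrow>
    \<exists>m q. q \<in> polys (lower_vars f) \<and> R_poly \<gamma> f ^ m * p - q \<in> II"
proof (induction n arbitrary: p)
  case 0
  then have "p \<in> polys (lower_vars f)" using polys_mono[of "{}" "lower_vars f"] by auto
  then have "p \<in> polys (lower_vars f) \<and> R_poly \<gamma> f ^ 0 * p - p \<in> II"
    by simp
  then show ?case by blast
next
  case (Suc n)
  let ?r = "R_poly \<gamma> f"
  have path: "\<exists>m q. q \<in> polys (lower_vars f) \<and> ?r ^ m * p - q \<in> II" if "p \<in> polys (lower_vars f)" for p
  proof -
    have "p \<in> polys (lower_vars f) \<and> ?r ^ 0 * p - p \<in> II"
      using that by simp
    then show ?thesis by blast
  qed
  have plus: "\<exists>m q. q \<in> polys (lower_vars f) \<and> ?r ^ m * (p + p') - q \<in> II"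
    if *: "\<exists>m q. q \<in> polys (lower_vars f) \<and> ?r ^ m * p - q \<in> II"
      "\<exists>m q. q \<in> polys (lower_vars f) \<and> ?r ^ m * p' - q \<in> II" for p p'
  proof -
    obtain m q m' q' where q: "q \<in> polys (lower_vars f)" "?r ^ m * p - q \<in> II"
      "q' \<in> polys (lower_vars f)" "?r ^ m' * p' - q' \<in> II" using * by blast
    have "?r ^ (m + m') * (p + p') - (?r ^ m' * q + ?r ^ m * q')
        = ?r ^ m' * (?r ^ m * p - q) + ?r ^ m * (?r ^ m' * p' - q')"
      by (simp add: algebra_simps power_add)
    also have "\<dots> \<in> II" by (rule II_add[OF II_scale[OF q(2)] II_scale[OF q(4)]])
    finally have "?r ^ (m + m') * (p + p') - (?r ^ m' * q + ?r ^ m * q') \<in> II" .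
    moreover have "?r ^ m' * q + ?r ^ m * q' \<in> polys (lower_vars f)"
      using q R_polys[OF leaf_node] by (intro polys_intros)
    ultimately show ?thesis by blast
  qed
  have times: "\<exists>m q. q \<in> polys (lower_vars f) \<and> ?r ^ m * (p * p') - q \<in> II"
    if *: "\<exists>m q. q \<in> polys (lower_vars f) \<and> ?r ^ m * p - q \<in> II"
      "\<exists>m q. q \<in> polys (lower_vars f) \<and> ?r ^ m * p' - q \<in> II" for p p'
  proof -
    obtain m q m' q' where q: "q \<in> polys (lower_vars f)" "?r ^ m * p - q \<in> II"
      "q' \<in> polys (lower_vars f)" "?r ^ m' * p' - q' \<in> II" using * by blast
    have "?r ^ (m + m') * (p * p') - q * q'
        = (?r ^ m * p) * (?r ^ m' * p' - q') + q' * (?r ^ m * p - q)"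
      by (simp add: algebra_simps power_add)
    also have "\<dots> \<in> II" by (rule II_add[OF II_scale[OF q(4)] II_scale[OF q(2)]])
    finally show ?thesis using q polys_mult by blast
  qed
  show ?case using Suc.prems
  proof (induction rule: polys_induct)
    case (X v)
    show ?case
    proof (cases "v \<in> lower_vars f")
      case True
      then show ?thesis by (intro path polys_X)
    next
      case False
      then obtain e where e: "v = Some e" "e \<in> inner_nodes \<gamma>" "e \<notin> Anc \<gamma> f" "depth e < n"
        using X by (auto simp: lower_vars_def all_vars_def image_iff)
      have en: "e \<in> nodes \<gamma>" "e \<noteq> f" using e f by (auto simp: inner_nodes_def)
      obtain a where a: "a \<in> Anc \<gamma> e" "a \<in> Anc \<gamma> f" "next_node \<gamma> a e \<noteq> next_node \<gamma> a f"
        using branching_exists[OF en(1) f en(2) e(3)] by blast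
      let ?c = "next_node \<gamma> a e"
      obtain s where sV: "s \<in> polys (lower_vars f)" and s: "?r = lin a ?c * s"
        using lin_factor_R[OF leaf_node a(2) next_node_in(1)[OF en(1) a(1)] a(3)] by blast
      have lowvars: "lower_vars e \<subseteq> {v \<in> all_vars. level v < n}"
        using lower_vars_subset[OF en(1)] level_lower_vars[of _ e] e(4) by fastforce
      then have "X (Some a) * T_poly ?c e \<in> polys {v \<in> all_vars. level v < n}"
        using a(1) T_polys[OF en(1)] polys_mono[OF lowvars]
        by (intro polys_mult polys_X) (auto simp: lower_vars_def)
      then obtain m q where q: "q \<in> polys (lower_vars f)" "?r ^ m * (X (Some a) * T_poly ?c e) - q \<in> II"
        using Suc.IH by blast
      have rX: "?r * X (Some e) = s * (X (Some a) * T_poly ?c e) + s * Delta \<gamma> a e"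
        unfolding Delta_eq[OF en(1) a(1)] s by (simp add: algebra_simps)
      have "?r ^ Suc m * X (Some e) = ?r ^ m * (?r * X (Some e))"
        by (simp add: mult_ac)
      also have "\<dots> = s * (?r ^ m * (X (Some a) * T_poly ?c e)) + ?r ^ m * (s * Delta \<gamma> a e)"
        unfolding rX by (simp add: algebra_simps)
      finally have "?r ^ Suc m * X (Some e)
          = s * (?r ^ m * (X (Some a) * T_poly ?c e)) + ?r ^ m * (s * Delta \<gamma> a e)" .
      then have eq: "?r ^ Suc m * X (Some e) - s * q
          = s * (?r ^ m * (X (Some a) * T_poly ?c e) - q) + ?r ^ m * (s * Delta \<gamma> a e)"
        by (simp only: right_diff_distrib) simp
      have "\<dots> \<in> II"
        by (rule II_add[OF II_scale[OF q(2)] II_scale[OF II_scale[OF Delta_II[OF e(2) a(1)]]]])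
      then have *: "?r ^ Suc m * X (Some e) - s * q \<in> II" unfolding eq .
      then show ?thesis using polys_mult[OF sV q(1)] e(1) by blast
    qed
  next
    case (Const c)
    show ?case by (rule path) simp
  next
    case (add p q)
    then show ?case by (rule plus)
  next
    case (mult p q)
    then show ?case by (rule times)
  qed
qed

end

lemma Anc_linear:
  assumes "e \<in> nodes \<gamma>" "a \<in> Anc \<gamma> e" "b \<in> Anc \<gamma> e"
  shows "a = b \<or> a \<in> Anc \<gamma> b \<or> b \<in> Anc \<gamma> a"
  using down_total[OF assms(1), of a b] assms(2,3) by (auto simp: Anc_def down_def)

lemma span_Delta0_II:
  assumes "P \<subseteq> inner_nodes \<gamma>" "x \<in> idl.span (Delta0 \<gamma> ` P)"
  shows "x \<in> II"
proof -
  have "Delta0 \<gamma> ` P \<subseteq> II" using assms(1) Delta0_II by blast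
  then show ?thesis using idl.span_minimal[OF _ II_subspace] assms(2) by blast
qed

text \<open>After reduction to the path and clearing of denominators a polynomial in X_0 remains. It
  is zero because \<open>Phi\<close> is injective on such polynomials, and regularity of
  \<open>h\<close> on the path removes the power of \<open>h\<close>.\<close>

lemma leaf_kernel:
  assumes f: "f \<in> Leaves \<gamma>" and p: "p \<in> polys all_vars" "Phi p = 0"
  shows "\<exists>n. R_poly \<gamma> f ^ n * p \<in> II"
proof -
  let ?r = "R_poly \<gamma> f"
  have fn: "f \<in> nodes \<gamma>" using f by (rule LeavesD)
  have inner: "Anc \<gamma> f \<subseteq> inner_nodes \<gamma>" using Anc_inner fn by blast
  have "depth e \<le> Max (depth ` nodes \<gamma>)" if "e \<in> inner_nodes \<gamma>" for e
    using inner_nodesD[OF that] finite_nodes by simp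
  then have "{v \<in> all_vars. level v < Suc (Suc (Max (depth ` nodes \<gamma>)))} = all_vars"
    by (auto simp: all_vars_def less_Suc_eq_le)
  then obtain m q where q: "q \<in> polys (lower_vars f)" "?r ^ m * p - q \<in> II"
    using path_reduction_aux[OF f, of p "Suc (Suc (Max (depth ` nodes \<gamma>)))"] p(1) by auto
  have "Phi q = 0" using Phi_II[OF q(2)] p(2) by (simp add: Phi.diff Phi.mult)
  obtain N q0 where q0: "q0 \<in> polys {None}" "hh ^ N * q - q0 \<in> idl.span (Delta0 \<gamma> ` Anc \<gamma> f)"
    using clear_denominators[of "Anc \<gamma> f" q] q(1) Anc_nodes Anc_trans unfolding lower_vars_def by blast
  have "Phi (hh ^ N * q - q0) = 0"
    by (rule Phi_II, rule span_Delta0_II[OF inner q0(2)])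
  then have "Phi q0 = 0" using \<open>Phi q = 0\<close> by (simp add: Phi.diff Phi.mult)
  then have "q0 = 0" by (rule Phi_None_inj[OF q0(1)])
  then obtain k where "?r ^ k * q \<in> idl.span (Delta0 \<gamma> ` Anc \<gamma> f)"
    using h_power_regular_at_leaf[OF f, of N q] q0(2) by auto
  then have "?r ^ k * q \<in> II" by (rule span_Delta0_II[OF inner])
  then have "?r ^ k * (?r ^ m * p - q) + ?r ^ k * q \<in> II"
    by (rule II_add[OF II_scale[OF q(2)]])
  then have "?r ^ (k + m) * p \<in> II" by (simp add: algebra_simps power_add)
  then show ?thesis by blast
qed

text \<open>Induction runs from the leaves to the root; at an inner node \<open>e\<close>,
  \<open>comaximal_linear_factors\<close> is applied to y = R_e and the labels of the
  children.\<close>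

lemma R_leaves_comaximal: "e \<in> nodes \<gamma> \<Longrightarrow> R_poly \<gamma> e \<in> idl.span (R_poly \<gamma> ` Leaves \<gamma>)"
proof (induction "Max (depth ` nodes \<gamma>) - depth e" arbitrary: e rule: less_induct)
  case less
  show ?case
  proof (cases "e \<in> Leaves \<gamma>")
    case True
    then show ?thesis by (intro idl.span_base imageI)
  next
    case False
    then have e: "e \<in> inner_nodes \<gamma>" using less.prems by (simp add: inner_nodes_def)
    show ?thesis
    proof (rule comaximal_linear_factors[OF idl.subspace_span finite_Child Child_nonempty[OF e]])
      show "inj_on (lb \<gamma>) (Child \<gamma> e)"
        using lb_inj[OF less.prems] by (auto intro!: inj_onI)
      fix g assume g: "g \<in> Child \<gamma> e"
      note gD = ChildD[OF g less.prems]
      have "depth g \<le> Max (depth ` nodes \<gamma>)" using gD(1) finite_nodes by simp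
      then have "R_poly \<gamma> g \<in> idl.span (R_poly \<gamma> ` Leaves \<gamma>)"
        using gD by (intro less.hyps) auto
      then show "(\<Prod>g'\<in>Child \<gamma> e - {g}. X (ParX \<gamma> e) - Const [:lb \<gamma> g':]) * R_poly \<gamma> e
          \<in> idl.span (R_poly \<gamma> ` Leaves \<gamma>)"
        unfolding R_Child[OF g less.prems] S_poly_def .
    qed
  qed
qed

text \<open>The elements carrying \<open>p\<close> into \<open>II\<close> form an ideal that
  contains a power of R_f for every leaf f, hence 1. The embedding of \<open>B\<close> into K[X_0]
  excludes \<open>h\<close>-torsion.\<close>

lemma kernel_Phi:
  assumes p: "p \<in> polys all_vars" "Phi p = 0"
  shows "p \<in> II"
proof -
  let ?J = "{s. s * p \<in> II}"
  have J: "idl.subspace ?J"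
    by (rule idl.subspaceI) (auto simp: distrib_right mult.assoc intro: II_add II_scale)
  have "1 \<in> ?J"
  proof (rule comaximal_powers[OF J])
    show "1 \<in> idl.span (R_poly \<gamma> ` Leaves \<gamma>)"
      using R_leaves_comaximal[OF root_node] by (simp add: R_root)
  qed (use leaf_kernel[OF _ p] in auto)
  then show ?thesis by simp
qed

lemma II_hh_cancel:
  assumes "p \<in> polys all_vars" "hh ^ n * p \<in> II"
  shows "p \<in> II"
  using kernel_Phi[OF assms(1) Phi_hh_cancel] Phi_II[OF assms(2)] by blast

text \<open>Let d be the child of \<open>b\<close> towards \<open>e\<close> and l its linear factor.
  From Q_b = l R_d follows l Q_e = Q_b (Q_e / R_d), and R_c is cancelled. The identity makes the
  relations at different ancestors of \<open>e\<close> compatible.\<close>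

lemma lin_T:
  assumes e: "e \<in> nodes \<gamma>" and b: "b \<in> Anc \<gamma> e" and c: "c \<in> down \<gamma> b"
  shows "lin b (next_node \<gamma> b e) * T_poly c e = T_poly c b * T_poly (next_node \<gamma> b e) e"
proof -
  let ?d = "next_node \<gamma> b e"
  have bn: "b \<in> nodes \<gamma>" and cn: "c \<in> nodes \<gamma>" using Anc_nodes[OF b] c by (auto simp: down_def)
  have ce: "c \<in> down \<gamma> e" using down_mono[of b e] b c by (auto simp: Anc_def)
  have "lin b ?d * Q_poly \<gamma> e = Q_poly \<gamma> b * T_poly ?d e"
    unfolding Q_T[OF e next_node_in(2)[OF e b]] Q_lin[OF bn next_node_in(1)[OF e b]]
    by (simp add: mult_ac)
  then have "R_poly \<gamma> c * (lin b ?d * T_poly c e - T_poly c b * T_poly ?d e) = 0"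
    unfolding Q_T[OF e ce] Q_T[OF bn c] by (simp add: algebra_simps)
  from R_mult_eq_0[OF cn this] show ?thesis by simp
qed

section \<open>A closed point of the fibre h = 0 for each leaf\<close>

definition at0 :: "complex poly \<Rightarrow> complex" where "at0 a = poly a 0"

lemma at0_hom: "comm_hom at0"
  by unfold_locales (simp_all add: at0_def)

definition branching :: "'n \<Rightarrow> 'n \<Rightarrow> 'n" where
  "branching f e = (SOME a. a \<in> Anc \<gamma> e \<and> a \<in> Anc \<gamma> f \<and> next_node \<gamma> a e \<noteq> next_node \<gamma> a f)"

text \<open>A closed point of the component of the fibre \<open>h = 0\<close> that belongs to the leaf \<open>f\<close>.  Off the
  path to \<open>f\<close>, the coordinate is forced by the relation \<open>\<Delta>\<^bsub>a,e\<^esub>\<close> at the node \<open>a\<close> where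
  the path to \<open>e\<close> leaves it.  At the parent of \<open>f\<close> the coordinate is free; the junk label
  assigned to it here is harmless, as is the value at \<open>X\<^sub>0\<close> when \<open>f\<close> is the root.\<close>

definition point_step :: "'n \<Rightarrow> 'n option \<Rightarrow> ('n option \<Rightarrow> complex) \<Rightarrow> complex" where
  "point_step f v y = (case v of
      None \<Rightarrow> lb \<gamma> (next_node \<gamma> rt f)
    | Some e \<Rightarrow>
        if e \<in> Anc \<gamma> f then lb \<gamma> (next_node \<gamma> (next_node \<gamma> e f) f)
        else if e \<in> inner_nodes \<gamma> \<and> f \<in> Leaves \<gamma> then
          y (Some (branching f e)) * subst at0 y (T_poly (next_node \<gamma> (branching f e) e) e)
            / subst at0 y (lin (branching f e) (next_node \<gamma> (branching f e) e))
        else 0)"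

definition point :: "'n \<Rightarrow> 'n option \<Rightarrow> complex" where
  "point f = (SOME y. \<forall>v. y v = point_step f v y)"

definition eval_point :: "'n \<Rightarrow> 'n apoly \<Rightarrow> complex" where
  "eval_point f = subst at0 (point f)"

sublocale ev: comm_hom "eval_point f" for f
  unfolding eval_point_def by (rule comm_hom.subst_comm_hom[OF at0_hom])

lemma ev_Const: "eval_point f (Const a) = poly a 0"
  unfolding eval_point_def by (simp add: comm_hom_subst_simps[OF at0_hom] at0_def)

lemma ev_hh: "eval_point f hh = 0"
  by (simp add: ev_Const hA_def)

lemma ev_X: "eval_point f (X v) = point f v"
  unfolding eval_point_def by (simp add: comm_hom_subst_simps[OF at0_hom])

context
  fixes f
  assumes f: "f \<in> Leaves \<gamma>"
begin

lemma fn: "f \<in> nodes \<gamma>"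
  using f by (rule LeavesD)

lemma branching:
  assumes "e \<in> inner_nodes \<gamma>" "e \<notin> Anc \<gamma> f"
  shows "branching f e \<in> Anc \<gamma> e" "branching f e \<in> Anc \<gamma> f"
    "next_node \<gamma> (branching f e) e \<noteq> next_node \<gamma> (branching f e) f"
proof -
  have "e \<in> nodes \<gamma>" "e \<noteq> f" using assms f by (auto simp: inner_nodes_def)
  then have "\<exists>a. a \<in> Anc \<gamma> e \<and> a \<in> Anc \<gamma> f \<and> next_node \<gamma> a e \<noteq> next_node \<gamma> a f"
    using branching_exists f assms(2) by blast
  from someI_ex[OF this] show "branching f e \<in> Anc \<gamma> e" "branching f e \<in> Anc \<gamma> f"
    "next_node \<gamma> (branching f e) e \<noteq> next_node \<gamma> (branching f e) f"
    unfolding branching_def by blast+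
qed

text \<open>Of two different common ancestors, the one nearer the root has the same successor
  towards \<open>e\<close> and \<open>f\<close>, namely the one towards the other ancestor. So it
  does not separate the paths.\<close>

lemma branching_unique:
  assumes e: "e \<in> nodes \<gamma>" and a: "a \<in> Anc \<gamma> e" "a \<in> Anc \<gamma> f" "next_node \<gamma> a e \<noteq> next_node \<gamma> a f"
    and b: "b \<in> Anc \<gamma> e" "b \<in> Anc \<gamma> f" "next_node \<gamma> b e \<noteq> next_node \<gamma> b f"
  shows "a = b"
proof -
  have "next_node \<gamma> x e = next_node \<gamma> x f" if x: "x \<in> Anc \<gamma> y" and y: "y \<in> Anc \<gamma> e" "y \<in> Anc \<gamma> f" for x y
  proof -
    have "y \<in> down \<gamma> e" "y \<in> down \<gamma> f" using y by (auto simp: Anc_def)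
    from next_node_down[OF e this(1) x] next_node_down[OF fn this(2) x] show ?thesis by simp
  qed
  then show ?thesis using Anc_linear[OF e a(1) b(1)] a b by blast
qed

text \<open>Only off the path does \<open>point_step\<close> consult other values, and then only at
  variables of smaller level.\<close>

lemma point_eq: "point f v = point_step f v (point f)"
proof -
  have "\<exists>y. \<forall>v. y v = point_step f v y"
  proof (rule level_recursion[where lv = level])
    fix v and y y' :: "'n option \<Rightarrow> complex"
    assume eq: "\<And>u. level u < level v \<Longrightarrow> y u = y' u"
    show "point_step f v y = point_step f v y'"
    proof (cases "\<exists>e. v = Some e \<and> e \<in> inner_nodes \<gamma> \<and> e \<notin> Anc \<gamma> f")
      case True
      then obtain e where e: "v = Some e" "e \<in> inner_nodes \<gamma>" "e \<notin> Anc \<gamma> f" by blast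
      have en: "e \<in> nodes \<gamma>" using e inner_nodesD by blast
      have yy: "y v = y' v" if "v \<in> lower_vars e" for v
        using eq level_lower_vars[OF that] e(1) by simp
      let ?b = "branching f e"
      have b: "?b \<in> Anc \<gamma> e" "Some ?b \<in> lower_vars e"
        using branching(1)[OF e(2,3)] by (auto simp: lower_vars_def)
      have bd: "?b \<in> down \<gamma> e" using b(1) by (simp add: Anc_def)
      have "subst at0 y (T_poly c e) = subst at0 y' (T_poly c e)" for c
        by (rule subst_cong_polys[OF T_polys[OF en]]) (rule yy)
      moreover have "subst at0 y (lin ?b c) = subst at0 y' (lin ?b c)" for c
        using lower_vars_mono[OF bd] by (intro subst_cong_polys[OF lin_polys[OF Anc_nodes[OF b(1)]]] yy) blast
      ultimately show ?thesis
        unfolding point_step_def e(1) option.case using yy[OF b(2)] by simp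
    next
      case False
      then show ?thesis by (auto simp: point_step_def split: option.split)
    qed
  qed
  then have "\<forall>v. point f v = point_step f v (point f)"
    unfolding point_def by (rule someI_ex)
  then show ?thesis by blast
qed

text \<open>This accounts for the double \<open>next_node\<close> in \<open>point_step\<close>: X_e
  enters the linear factors at the child of \<open>e\<close> towards \<open>f\<close>, and its value
  is the label of the node following that child.\<close>

lemma point_ParX:
  assumes "a \<in> Anc \<gamma> f"
  shows "point f (ParX \<gamma> a) = lb \<gamma> (next_node \<gamma> a f)"
proof (cases "a = rt")
  case True
  then show ?thesis by (simp add: ParX_def point_eq[of None] point_step_def)
next
  case False
  have an: "a \<in> nodes \<gamma>" using assms Anc_nodes by blast
  have P: "Par \<gamma> a \<in> Anc \<gamma> a" using Par_Anc an False by blast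
  have "a \<in> down \<gamma> f" using assms by (simp add: Anc_def)
  then have "next_node \<gamma> (Par \<gamma> a) f = a"
    using next_node_down[OF fn _ P] next_node_Par[OF an False] by simp
  then show ?thesis
    using False Anc_trans[OF assms P] by (simp add: ParX_def point_eq[of "Some _"] point_step_def)
qed

lemma ev_lin: "a \<in> Anc \<gamma> f \<Longrightarrow> eval_point f (lin a g) = lb \<gamma> (next_node \<gamma> a f) - lb \<gamma> g"
  by (simp add: lin_def ev.diff ev_X ev_Const point_ParX)

lemma ev_lin_next: "a \<in> Anc \<gamma> f \<Longrightarrow> eval_point f (lin a (next_node \<gamma> a f)) = 0"
  by (simp add: ev_lin)

lemma ev_lin_other:
  assumes "a \<in> Anc \<gamma> f" "g \<in> Child \<gamma> a" "g \<noteq> next_node \<gamma> a f"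
  shows "eval_point f (lin a g) \<noteq> 0"
  using lb_inj[OF Anc_nodes[OF assms(1)] next_node_in(1)[OF fn assms(1)] assms(2)] assms
  by (simp add: ev_lin)

lemma ev_dvd_0: "x dvd y \<Longrightarrow> eval_point f x = 0 \<Longrightarrow> eval_point f y = 0"
  by (auto simp: ev.mult elim!: dvdE)

lemma ev_S_0:
  assumes "a \<in> Anc \<gamma> f" "next_node \<gamma> a f \<notin> J"
  shows "eval_point f (S_poly \<gamma> a J) = 0"
  by (rule ev_dvd_0[OF lin_dvd_S_poly ev_lin_next])
    (use assms next_node_in(1)[OF fn assms(1)] in auto)

text \<open>R_f contains only factors belonging to siblings of nodes on the path, and sibling labels
  differ.\<close>

lemma ev_R_f: "eval_point f (R_poly \<gamma> f) \<noteq> 0"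
proof -
  have "eval_point f (S_poly \<gamma> a {next_node \<gamma> a f}) \<noteq> 0" if "a \<in> Anc \<gamma> f" for a
    unfolding S_poly_lin ev.prod using finite_Child ev_lin_other[OF that] by (auto simp: prod_zero_iff)
  then show ?thesis
    unfolding R_prod[OF fn] ev.prod using finite_Anc by (simp add: prod_zero_iff)
qed

text \<open>On the path the vanishing factor sits in S_e. Off the path it sits in R_e, as the factor
  of the child leading to \<open>f\<close> at the branching node.\<close>

lemma ev_Q:
  assumes e: "e \<in> inner_nodes \<gamma>"
  shows "eval_point f (Q_poly \<gamma> e) = 0"
proof (cases "e \<in> Anc \<gamma> f")
  case True
  then show ?thesis by (simp add: Q_poly_def ev.mult ev_S_0)
next
  case False
  note b = branching[OF e False]
  have "lin (branching f e) (next_node \<gamma> (branching f e) f) dvd R_poly \<gamma> e"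
    using lin_factor_R[OF inner_nodesD[OF e] b(1) next_node_in(1)[OF fn b(2)]] b(3) by auto
  then have "eval_point f (R_poly \<gamma> e) = 0" by (rule ev_dvd_0) (rule ev_lin_next[OF b(2)])
  then show ?thesis by (simp add: Q_poly_def ev.mult)
qed

lemma ev_branching:
  assumes e: "e \<in> inner_nodes \<gamma>" and a: "a \<in> Anc \<gamma> e" "a \<in> Anc \<gamma> f" "next_node \<gamma> a e \<noteq> next_node \<gamma> a f"
  shows "eval_point f (lin a (next_node \<gamma> a e)) \<noteq> 0"
    "eval_point f (lin a (next_node \<gamma> a e)) * point f (Some e)
      = point f (Some a) * eval_point f (T_poly (next_node \<gamma> a e) e)"
proof -
  note en = inner_nodesD[OF e]
  show nz: "eval_point f (lin a (next_node \<gamma> a e)) \<noteq> 0"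
    by (rule ev_lin_other[OF a(2) next_node_in(1)[OF en a(1)] a(3)])
  have eA: "e \<notin> Anc \<gamma> f"
  proof
    assume "e \<in> Anc \<gamma> f"
    then have "e \<in> down \<gamma> f" by (simp add: Anc_def)
    with next_node_down[OF fn this a(1)] a(3) show False by simp
  qed
  have "branching f e = a"
    by (rule branching_unique[OF en branching[OF e eA] a])
  then have "point f (Some e) = point f (Some a) * eval_point f (T_poly (next_node \<gamma> a e) e)
      / eval_point f (lin a (next_node \<gamma> a e))"
    by (subst point_eq) (use eA e f in \<open>simp add: point_step_def eval_point_def\<close>)
  then show "eval_point f (lin a (next_node \<gamma> a e)) * point f (Some e)
      = point f (Some a) * eval_point f (T_poly (next_node \<gamma> a e) e)"
    using nz by simp
qed

text \<open>Only the relation at the branching node \<open>a\<close> of an \<open>e\<close> off the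
  path is built into the point. For \<open>b\<close> nearer the root than \<open>a\<close> both
  terms vanish, as they do for \<open>e\<close> on the path. For \<open>b\<close> between
  \<open>a\<close> and \<open>e\<close>, the relations at \<open>a\<close> for \<open>b\<close> and
  for \<open>e\<close> imply the one at \<open>b\<close>, by \<open>lin_T\<close> and since the
  linear factor at \<open>a\<close> is nonzero.\<close>

lemma ev_Delta:
  assumes e: "e \<in> inner_nodes \<gamma>" and b: "b \<in> Anc \<gamma> e"
  shows "eval_point f (Delta \<gamma> b e) = 0"
proof -
  note en = inner_nodesD[OF e]
  let ?c = "next_node \<gamma> b e"
  have D: "eval_point f (Delta \<gamma> b e)
      = eval_point f (lin b ?c) * point f (Some e) - point f (Some b) * eval_point f (T_poly ?c e)"
    unfolding Delta_eq[OF en b] by (simp add: ev.diff ev.mult ev_X)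
  show ?thesis
  proof (cases "e \<in> Anc \<gamma> f")
    case True
    then have "?c = next_node \<gamma> b f" "b \<in> Anc \<gamma> f"
      using next_node_down[OF fn _ b] Anc_trans[OF True b] by (auto simp: Anc_def)
    then have "eval_point f (lin b ?c) = 0" using ev_lin_next by simp
    moreover have "eval_point f (T_poly ?c e) = 0"
      unfolding T_poly_def ev.mult using ev_S_0[OF True] by simp
    ultimately show ?thesis unfolding D by simp
  next
    case False
    define a where "a = branching f e"
    have a: "a \<in> Anc \<gamma> e" "a \<in> Anc \<gamma> f" "next_node \<gamma> a e \<noteq> next_node \<gamma> a f"
      unfolding a_def by (rule branching[OF e False])+
    consider "a = b" | "b \<in> Anc \<gamma> a" | "a \<in> Anc \<gamma> b"
      using Anc_linear[OF en a(1) b] by blast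
    then show ?thesis
    proof cases
      case 1
      then show ?thesis unfolding D using ev_branching(2)[OF e a] by simp
    next
      case 2
      have ad: "a \<in> down \<gamma> e" "a \<in> down \<gamma> f" using a by (auto simp: Anc_def)
      have an: "a \<in> nodes \<gamma>" using Anc_nodes[OF a(1)] .
      have c: "?c = next_node \<gamma> b a" "next_node \<gamma> b f = next_node \<gamma> b a"
        using next_node_down[OF en ad(1) 2] next_node_down[OF fn ad(2) 2] by auto
      have "eval_point f (lin b ?c) = 0"
        using ev_lin_next[OF Anc_trans[OF a(2) 2]] c by simp
      \<comment> \<open>So the product at \<open>a\<close> is not removed from Q_e / R_c, and it
        contains the linear factor towards \<open>f\<close>.\<close>
      moreover have "a \<notin> Anc \<gamma> ?c"
        using Anc_mono[OF next_node_in(2)[OF an 2]] self_notin_Anc[of a] c(1) by auto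
      then have "S_poly \<gamma> a {next_node \<gamma> a e} dvd U_poly ?c e"
        unfolding U_poly_def using a(1) finite_Anc by (intro dvd_prodI) auto
      then have "eval_point f (U_poly ?c e) = 0"
        by (rule ev_dvd_0) (rule ev_S_0, use a in auto)
      then have "eval_point f (T_poly ?c e) = 0"
        unfolding T_poly_def ev.mult by simp
      ultimately show ?thesis unfolding D by simp
    next
      case 3
      have bn: "b \<in> nodes \<gamma>" and bi: "b \<in> inner_nodes \<gamma>" and bd: "b \<in> down \<gamma> e"
        using Anc_nodes[OF b] Anc_inner[OF b en] b by (auto simp: Anc_def)
      let ?d = "next_node \<gamma> a e"
      have d: "next_node \<gamma> a b = ?d" using next_node_down[OF en bd 3] by simp
      have dd: "?d \<in> down \<gamma> b" using next_node_in(2)[OF bn 3] d by simp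
      have B: "eval_point f (lin a ?d) * point f (Some b) = point f (Some a) * eval_point f (T_poly ?d b)"
        using ev_branching(2)[OF bi 3 a(2)] a(3) d by simp
      have "eval_point f (lin b ?c) * eval_point f (T_poly ?d e)
          = eval_point f (T_poly ?d b) * eval_point f (T_poly ?c e)"
        using lin_T[OF en b dd] by (metis ev.mult)
      moreover have "eval_point f (lin a ?d) * eval_point f (Delta \<gamma> b e)
          = eval_point f (lin b ?c) * (eval_point f (lin a ?d) * point f (Some e))
            - (eval_point f (lin a ?d) * point f (Some b)) * eval_point f (T_poly ?c e)"
        unfolding D by (simp add: algebra_simps)
      ultimately have "eval_point f (lin a ?d) * eval_point f (Delta \<gamma> b e) = 0"
        unfolding B ev_branching(2)[OF e a] by (simp add: mult_ac)
      then show ?thesis using ev_branching(1)[OF e a] by simp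
    qed
  qed
qed

lemma ev_II: "p \<in> II \<Longrightarrow> eval_point f p = 0"
  unfolding II_def
  by (rule hom_idl_span[OF ev.comm_hom_axioms])
    (auto simp: ev_Delta Delta0_def ev.diff ev.mult ev_hh ev_Q)

end

end


section \<open>Derivations and divided powers\<close>

lemma of_nat_fract: "(of_nat n :: complex poly fract) = to_fract (of_nat n)"
  by (induction n) simp_all

text \<open>In characteristic zero differentiation lowers a positive degree by exactly one, and
  multiplication by \<open>g\<close> restores at least that.\<close>

lemma degree_mult_pderiv:
  fixes g p :: "complex poly fract poly"
  assumes "1 \<le> degree g" "1 \<le> degree p"
  shows "1 \<le> degree (g * pderiv p)"
proof -
  have "Polynomial.coeff (pderiv p) (degree p - 1) = of_nat (degree p) * Polynomial.coeff p (degree p)"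
    using assms(2) by (simp add: coeff_pderiv)
  also have "\<dots> \<noteq> 0"
    using assms(2) by (auto simp: of_nat_fract)
  finally have c: "Polynomial.coeff (pderiv p) (degree p - 1) \<noteq> 0" .
  then have "degree p - 1 \<le> degree (pderiv p)" "pderiv p \<noteq> 0"
    by (auto intro: le_degree)
  moreover have "g \<noteq> 0" using assms(1) by auto
  ultimately show ?thesis using assms by (simp add: degree_mult_eq)
qed

lemma hA_power_dvd_or:
  "hA ^ M dvd c \<or> (\<exists>j a. j < M \<and> c = hA ^ j * a \<and> poly a 0 \<noteq> 0)"
proof (induction M)
  case (Suc M)
  show ?case
  proof (cases "hA ^ M dvd c")
    case True
    then obtain a where a: "c = hA ^ M * a" by (elim dvdE)
    show ?thesis
    proof (cases "poly a 0 = 0")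
      case True
      then have "hA dvd a" by (simp add: poly_eq_0_iff_dvd hA_def)
      then have "hA ^ M * hA dvd hA ^ M * a" by (rule mult_dvd_mono[OF dvd_refl])
      then show ?thesis using a by (simp add: mult.commute)
    next
      case False
      then show ?thesis using a by blast
    qed
  next
    case False
    then show ?thesis using Suc.IH less_Suc_eq by blast
  qed
qed simp

text \<open>The derivation with prescribed values on the variables, read off from the homomorphism
  \<open>X\<^sub>v \<mapsto> X\<^sub>v + d\<^sub>v t\<close> to first order in \<open>t\<close>.\<close>

definition der :: "('n option \<Rightarrow> 'n apoly) \<Rightarrow> 'n apoly \<Rightarrow> 'n apoly" where
  "der d p = Polynomial.coeff (subst (\<lambda>a. [:Const a:]) (\<lambda>v. [:X v, d v:]) p) 1"

lemma const_poly_hom: "comm_hom (\<lambda>a. [:Const a:] :: 'n apoly poly)"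
  by unfold_locales (simp_all add: Const.hom_simps flip: one_pCons)

lemma der_subst_0: "Polynomial.coeff (subst (\<lambda>a. [:Const a:]) (\<lambda>v. [:X v, d v:]) p) 0 = p"
proof -
  have "p \<in> polys UNIV" by simp
  then show ?thesis
    by (induction rule: polys_induct)
      (simp_all add: comm_hom_subst_simps[OF const_poly_hom] comm_hom.subst_add[OF const_poly_hom]
        comm_hom.subst_mult[OF const_poly_hom] coeff_mult)
qed

lemma der_Const [simp]: "der d (Const c) = 0"
  by (simp add: der_def comm_hom_subst_simps[OF const_poly_hom])

lemma der_X [simp]: "der d (X v) = d v"
  by (simp add: der_def comm_hom_subst_simps[OF const_poly_hom])

lemma der_add: "der d (p + q) = der d p + der d q"
  by (simp add: der_def comm_hom.subst_add[OF const_poly_hom])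

lemma der_mult: "der d (p * q) = p * der d q + q * der d p"
  by (simp add: der_def comm_hom.subst_mult[OF const_poly_hom] coeff_mult
      der_subst_0[simplified] mult.commute add.commute)

lemma der_Const_mult: "der d (Const c * p) = Const c * der d p"
  by (simp add: der_mult)

lemma der_sum: "der d (sum f S) = (\<Sum>x\<in>S. der d (f x))"
  by (induction S rule: infinite_finite_induct)
    (simp_all add: der_add der_Const[of d 0, unfolded Const.zero])

lemma der_cong_polys:
  assumes "p \<in> polys V" "\<And>v. v \<in> V \<Longrightarrow> d v = d' v"
  shows "der d p = der d' p"
  unfolding der_def using subst_cong_polys[OF assms(1), of "\<lambda>v. [:X v, d v:]" "\<lambda>v. [:X v, d' v:]"] assms(2) by simp

lemma der_polys:
  assumes "p \<in> polys U" "U \<subseteq> V" "\<And>v. v \<in> U \<Longrightarrow> d v \<in> polys V"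
  shows "der d p \<in> polys V"
proof -
  from assms(1) have "p \<in> polys V \<and> der d p \<in> polys V"
    by (induction rule: polys_induct)
      (use assms(2,3) in \<open>auto simp: der_add der_mult intro!: polys_add polys_mult polys_X\<close>)
  then show ?thesis ..
qed

lemma der_dvd:
  assumes "p \<in> polys U" "\<And>v. v \<in> U \<Longrightarrow> x dvd d v"
  shows "x dvd der d p"
  using assms(1)
  by (induction rule: polys_induct) (use assms(2) in \<open>auto simp: der_add der_mult intro!: dvd_add\<close>)

lemma der_funpow_0: "(der d ^^ n) 0 = 0"
  using der_Const[of d 0] by (induction n) (simp_all add: Const.zero)

lemma der_funpow_add: "(der d ^^ n) (p + q) = (der d ^^ n) p + (der d ^^ n) q"
  by (induction n) (simp_all add: der_add)

lemma der_funpow_Const_mult: "(der d ^^ n) (Const c * p) = Const c * (der d ^^ n) p"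
  by (induction n) (simp_all add: der_Const_mult)

section \<open>Divided powers of a derivation\<close>

definition divpow :: "('n option \<Rightarrow> 'n apoly) \<Rightarrow> nat \<Rightarrow> 'n apoly \<Rightarrow> 'n apoly" where
  "divpow d n p = Const [:1 / fact n:] * (der d ^^ n) p"

lemma divpow_0 [simp]: "divpow d 0 p = p"
  by (simp add: divpow_def Const.one flip: one_pCons)

lemma of_nat_Const: "of_nat n = (Const [:of_nat n:] :: 'n apoly)"
proof (induction n)
  case (Suc n)
  have "Const [:of_nat (Suc n):] = Const 1 + (Const [:of_nat n:] :: 'n apoly)"
    by (simp add: one_pCons flip: Const.add)
  then show ?case using Suc by (simp add: Const.one)
qed (simp add: Const.zero)

lemma divpow_Suc: "of_nat (Suc n) * divpow d (Suc n) p = der d (divpow d n p)"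
proof -
  have "of_nat (Suc n) * (1 / fact (Suc n)) = (1 / fact n :: complex)"
    by (simp add: divide_simps del: of_nat_Suc)
  then have "Const [:of_nat (Suc n):] * Const [:1 / fact (Suc n):] = (Const [:1 / fact n:] :: 'a apoly)"
    by (simp del: of_nat_Suc fact_Suc flip: Const.mult)
  then show ?thesis
    unfolding divpow_def der_Const_mult of_nat_Const by (simp del: of_nat_Suc fact_Suc flip: mult.assoc)
qed

lemma of_nat_apoly_cancel:
  assumes "of_nat (Suc n) * x = of_nat (Suc n) * (y :: 'n apoly)"
  shows "x = y"
proof -
  have "Const [:of_nat (Suc n):] * (x - y) = 0"
    using assms by (simp add: of_nat_Const right_diff_distrib del: of_nat_Suc)
  moreover have "[:of_nat (Suc n):] \<noteq> (0 :: complex poly)"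
    by (simp del: of_nat_Suc)
  ultimately have "x - y = 0" by (rule Const_mult_eq_0)
  then show ?thesis by simp
qed

lemma divpow_add: "divpow d n (p + q) = divpow d n p + divpow d n q"
  by (simp add: divpow_def der_funpow_add distrib_left)

text \<open>Induction: n+1 times the divided power of order n+1 is the derivative of the one of
  order n, and n+1 can be cancelled. The rule makes the exponential multiplicative.\<close>

lemma divpow_mult: "divpow d n (p * q) = (\<Sum>i\<le>n. divpow d i p * divpow d (n - i) q)"
proof (induction n)
  case (Suc n)
  let ?f = "\<lambda>i. divpow d i p * divpow d (Suc n - i) q"
  have "of_nat (Suc n) * divpow d (Suc n) (p * q) = der d (\<Sum>i\<le>n. divpow d i p * divpow d (n - i) q)"
    by (simp only: divpow_Suc Suc.IH)
  also have "\<dots> = (\<Sum>i\<le>n. of_nat (Suc i) * ?f (Suc i)) + (\<Sum>i\<le>n. of_nat (Suc n - i) * ?f i)"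
    unfolding der_sum der_mult sum.distrib[symmetric]
  proof (rule sum.cong[OF refl])
    fix i assume "i \<in> {..n}"
    then have i: "Suc n - i = Suc (n - i)" "Suc n - Suc i = n - i" by auto
    show "divpow d i p * der d (divpow d (n - i) q) + divpow d (n - i) q * der d (divpow d i p)
        = of_nat (Suc i) * ?f (Suc i) + of_nat (Suc n - i) * ?f i"
      unfolding i divpow_Suc[symmetric] by (simp add: mult_ac add.commute del: of_nat_Suc)
  qed
  \<comment> \<open>Both sums are extended to i \<le> n+1 by terms with coefficient 0; then the
    coefficients i and n+1-i add up to n+1.\<close>
  also have "(\<Sum>i\<le>n. of_nat (Suc i) * ?f (Suc i)) = (\<Sum>i\<le>Suc n. of_nat i * ?f i)"
    by (subst sum.atMost_Suc_shift) simp
  also have "(\<Sum>i\<le>n. of_nat (Suc n - i) * ?f i) = (\<Sum>i\<le>Suc n. of_nat (Suc n - i) * ?f i)"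
    by simp
  also have "(\<Sum>i\<le>Suc n. of_nat i * ?f i) + (\<Sum>i\<le>Suc n. of_nat (Suc n - i) * ?f i)
      = (\<Sum>i\<le>Suc n. of_nat (Suc n) * ?f i)"
    unfolding sum.distrib[symmetric]
    by (rule sum.cong[OF refl]) (simp add: of_nat_diff algebra_simps)
  finally show ?case
    unfolding sum_distrib_left[symmetric] by (rule of_nat_apoly_cancel)
qed simp

text \<open>The factor is (n+k)! / (n! k!). As the coefficient of s^n t^k in (s+t)^(n+k), it yields
  the composition law of the action.\<close>

lemma divpow_divpow: "divpow d k (divpow d n p) = of_nat ((n + k) choose n) * divpow d (n + k) p"
proof -
  have "(der d ^^ k) ((der d ^^ n) p) = (der d ^^ (n + k)) p"
    by (simp add: funpow_add add.commute[of n k])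
  then have "divpow d k (divpow d n p) = (Const [:1 / fact k:] * Const [:1 / fact n:]) * (der d ^^ (n + k)) p"
    by (simp add: divpow_def der_funpow_Const_mult mult.assoc)
  also have "Const [:1 / fact k:] * Const [:1 / fact n:]
      = (Const [:of_nat ((n + k) choose n):] * Const [:1 / fact (n + k):] :: 'a apoly)"
    by (simp add: binomial_fact divide_simps flip: Const.mult)
  finally show ?thesis by (simp add: divpow_def of_nat_Const mult.assoc)
qed

lemma nilpotent_mono: "(der d ^^ n) p = 0 \<Longrightarrow> n \<le> m \<Longrightarrow> (der d ^^ m) p = 0"
  using funpow_add[of "m - n" n "der d"] by (simp add: der_funpow_0)

lemma nilpotent_add:
  assumes "(der d ^^ n) p = 0" "(der d ^^ m) q = 0"
  shows "(der d ^^ (n + m)) (p + q) = 0"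
  by (simp add: der_funpow_add nilpotent_mono[OF assms(1)] nilpotent_mono[OF assms(2)])

lemma divpow_eq_0_iff: "divpow d n p = 0 \<longleftrightarrow> (der d ^^ n) p = 0"
  unfolding divpow_def using Const_mult_eq_0[of "[:1 / fact n:]" "(der d ^^ n) p"] by auto

text \<open>Every term of the Leibniz sum of order n+m has i \<ge> n or n+m-i \<ge> m.\<close>

lemma nilpotent_mult:
  assumes "(der d ^^ n) p = 0" "(der d ^^ m) q = 0"
  shows "(der d ^^ (n + m)) (p * q) = 0"
proof -
  have z: "divpow d i p * divpow d (n + m - i) q = 0" for i
  proof (cases "n \<le> i")
    case True
    then have "divpow d i p = 0"
      unfolding divpow_eq_0_iff by (rule nilpotent_mono[OF assms(1)])
    then show ?thesis by simp
  next
    case False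
    then have "m \<le> n + m - i" by simp
    then have "divpow d (n + m - i) q = 0"
      unfolding divpow_eq_0_iff by (rule nilpotent_mono[OF assms(2)])
    then show ?thesis by simp
  qed
  have "divpow d (n + m) (p * q) = 0"
    unfolding divpow_mult using z by (intro sum.neutral) blast
  then show ?thesis unfolding divpow_eq_0_iff .
qed


section \<open>Lifting locally nilpotent derivations\<close>

text \<open>\<open>D0\<close> picks polynomial representatives for a derivation of \<open>B\<close>
  over \<open>A\<close>. It need not be additive or satisfy the product rule exactly, so each law is
  stated modulo \<open>II\<close>.\<close>

locale derivation_mod = fl_rooted_tree \<gamma> for \<gamma> :: "'n fl_tree" +
  fixes D0 :: "'n apoly \<Rightarrow> 'n apoly"
  assumes D0_closed: "p \<in> polys all_vars \<Longrightarrow> D0 p \<in> polys all_vars"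
    and D0_add: "p \<in> polys all_vars \<Longrightarrow> q \<in> polys all_vars \<Longrightarrow> D0 (p + q) - (D0 p + D0 q) \<in> II"
    and D0_mult: "p \<in> polys all_vars \<Longrightarrow> q \<in> polys all_vars \<Longrightarrow> D0 (p * q) - (p * D0 q + q * D0 p) \<in> II"
    and D0_Const: "D0 (Const a) \<in> II"
    and D0_II: "p \<in> polys all_vars \<Longrightarrow> p \<in> II \<Longrightarrow> D0 p \<in> II"
    and D0_nilpotent: "\<exists>n. (D0 ^^ n) (X None) \<in> II"
begin

abbreviation "V \<equiv> polys all_vars"

lemma X_V: "e \<in> inner_nodes \<gamma> \<Longrightarrow> X (Some e) \<in> V" "X None \<in> V"
  by (simp_all add: polys_X all_vars_def)

lemma lower_V: "e \<in> nodes \<gamma> \<Longrightarrow> p \<in> polys (lower_vars e) \<Longrightarrow> p \<in> V"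
  using polys_mono[OF lower_vars_subset] by blast

lemma Delta0_V: "e \<in> inner_nodes \<gamma> \<Longrightarrow> Delta0 \<gamma> e \<in> V"
  unfolding Delta0_def
  by (intro polys_diff polys_mult polys_Const X_V lower_V[OF _ Q_polys] inner_nodesD)

lemma D0_hX:
  assumes e: "e \<in> inner_nodes \<gamma>"
  shows "hh * D0 (X (Some e)) - D0 (Q_poly \<gamma> e) \<in> II"
proof -
  let ?X = "X (Some e) :: 'n apoly" and ?Q = "Q_poly \<gamma> e"
  have QV: "?Q \<in> V" using lower_V[OF inner_nodesD[OF e] Q_polys[OF inner_nodesD[OF e]]] .
  have XV: "hh * ?X \<in> V" using X_V(1)[OF e] by (intro polys_mult) auto
  have 1: "D0 (Delta0 \<gamma> e + ?Q) - (D0 (Delta0 \<gamma> e) + D0 ?Q) \<in> II"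
    by (rule D0_add[OF Delta0_V[OF e] QV])
  have 2: "D0 (Delta0 \<gamma> e) \<in> II" by (rule D0_II[OF Delta0_V[OF e] Delta0_II[OF e]])
  have 3: "D0 (hh * ?X) - (hh * D0 ?X + ?X * D0 hh) \<in> II"
    by (rule D0_mult) (simp_all add: X_V e)
  have 4: "?X * D0 hh \<in> II" by (rule II_scale[OF D0_Const])
  have "hh * D0 ?X - D0 ?Q = (D0 (Delta0 \<gamma> e + ?Q) - (D0 (Delta0 \<gamma> e) + D0 ?Q)) + D0 (Delta0 \<gamma> e)
      - (D0 (hh * ?X) - (hh * D0 ?X + ?X * D0 hh)) - ?X * D0 hh"
    by (simp add: Delta0_def)
  also have "\<dots> \<in> II" by (rule II_diff[OF II_diff[OF II_add[OF 1 2] 3] 4])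
  finally show ?thesis .
qed

text \<open>The case X_e may use the claim for polynomials in the variables of proper ancestors,
  such as Q_e. This suits statements that are transferred along h X_e = Q_e.\<close>

lemma poly_level_induct [consumes 1, case_names Const None Some add mult]:
  assumes p: "p \<in> V" and C: "\<And>c. P (Const c)" and N: "P (X None)"
    and S: "\<And>e. e \<in> inner_nodes \<gamma> \<Longrightarrow> (\<And>q. q \<in> polys (lower_vars e) \<Longrightarrow> q \<in> V \<Longrightarrow> P q) \<Longrightarrow> P (X (Some e))"
    and A: "\<And>p q. p \<in> V \<Longrightarrow> q \<in> V \<Longrightarrow> P p \<Longrightarrow> P q \<Longrightarrow> P (p + q)"
    and M: "\<And>p q. p \<in> V \<Longrightarrow> q \<in> V \<Longrightarrow> P p \<Longrightarrow> P q \<Longrightarrow> P (p * q)"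
  shows "P p"
proof -
  have X: "P (X v)" if "v \<in> all_vars" for v
    using that
  proof (induction "level v" arbitrary: v rule: less_induct)
    case less
    show ?case
    proof (cases v)
      case None
      then show ?thesis using N by simp
    next
      case (Some e)
      then have e: "e \<in> inner_nodes \<gamma>" using less.prems by (auto simp: all_vars_def)
      have "P (X (Some e))"
      proof (rule S[OF e])
        fix q assume "q \<in> polys (lower_vars e)"
        then have "q \<in> V \<and> P q"
        proof (induction rule: polys_induct)
          case (X u)
          have "u \<in> all_vars" using X lower_vars_subset[OF inner_nodesD[OF e]] by blast
          moreover have "level u < level v" using level_lower_vars[OF X] Some by simp
          ultimately show ?case using less.hyps polys_X by blast
        qed (use C A M polys_add polys_mult in auto)
        then show "P q" ..
      qed
      then show ?thesis using Some by simp
    qed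
  qed
  from p have "p \<in> V \<and> P p"
  proof (induction rule: polys_induct)
    case (X v)
    then show ?case using \<open>v \<in> all_vars \<Longrightarrow> P (X v)\<close> polys_X by blast
  qed (use C A M polys_add polys_mult in auto)
  then show ?thesis ..
qed

section \<open>The derivation on the generic fibre\<close>

definition slope :: "complex poly fract poly" where
  "slope = Phi (D0 (X None))"

lemma Phi_hh_nz: "Phi hh \<noteq> 0"
  by (simp add: Phi_Const)

lemma Phi_eq: "x - y \<in> II \<Longrightarrow> Phi x = Phi y"
  using Phi_II[of "x - y"] by (simp add: Phi.diff)

text \<open>Both sides obey the same rules and agree on X_0; at X_e the relation h X_e = Q_e reduces
  the claim to Q_e, and \<open>h\<close> is a unit of K[X_0].\<close>

lemma Phi_D0: "p \<in> V \<Longrightarrow> Phi (D0 p) = slope * pderiv (Phi p)"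
proof (induction rule: poly_level_induct)
  case (Const c)
  then show ?case using Phi_II[OF D0_Const] by (simp add: Phi_Const)
next
  case None
  then show ?case by (simp add: slope_def Phi_X0 pderiv_pCons)
next
  case (Some e)
  note en = inner_nodesD[OF Some(1)]
  have "Phi hh * Phi (D0 (X (Some e))) = Phi (D0 (Q_poly \<gamma> e))"
    using Phi_eq[OF D0_hX[OF Some(1)]] by (simp add: Phi.mult)
  also have "\<dots> = slope * pderiv (Phi hh * Phi (X (Some e)))"
    using Some(2)[OF Q_polys[OF en] lower_V[OF en Q_polys[OF en]]] Phi_hX[OF en] by (simp add: Phi.mult)
  also have "\<dots> = Phi hh * (slope * pderiv (Phi (X (Some e))))"
    by (simp add: Phi_Const pderiv_mult pderiv_smult pderiv_pCons algebra_simps)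
  finally show ?case using Phi_hh_nz by simp
next
  case (add p q)
  then show ?case using Phi_eq[OF D0_add[OF add(1,2)]]
    by (simp add: Phi.add pderiv_add distrib_left)
next
  case (mult p q)
  then show ?case using Phi_eq[OF D0_mult[OF mult(1,2)]]
    by (simp add: Phi.add Phi.mult pderiv_mult algebra_simps)
qed

text \<open>With a slope of positive degree, all iterates on X_0 would keep degree at least one in
  K[X_0] and never vanish.\<close>

lemma slope_const: "degree slope = 0"
proof (rule ccontr)
  assume "degree slope \<noteq> 0"
  then have s: "1 \<le> degree slope" by simp
  have "(D0 ^^ n) (X None) \<in> V \<and> 1 \<le> degree (Phi ((D0 ^^ n) (X None)))" for n
  proof (induction n)
    case 0
    then show ?case by (simp add: X_V Phi_X0)
  next
    case (Suc n)
    then show ?case using degree_mult_pderiv[OF s] Phi_D0 D0_closed by simp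
  qed
  moreover obtain n where "(D0 ^^ n) (X None) \<in> II" using D0_nilpotent by blast
  ultimately show False using Phi_II by (metis degree_0 not_one_le_zero)
qed

section \<open>Divisibility by powers of h at the deepest leaf\<close>

definition deep_leaf :: 'n where
  "deep_leaf = (SOME f. f \<in> Leaves \<gamma> \<and> (\<forall>e\<in>inner_nodes \<gamma>. depth e < depth f))"

lemma deep_leaf: "deep_leaf \<in> Leaves \<gamma>" "e \<in> inner_nodes \<gamma> \<Longrightarrow> depth e < depth deep_leaf"
proof -
  have "\<exists>f. f \<in> Leaves \<gamma> \<and> (\<forall>e\<in>inner_nodes \<gamma>. depth e < depth f)"
    using depth_less_leaf_exists by metis
  from someI_ex[OF this] show "deep_leaf \<in> Leaves \<gamma>"
    "e \<in> inner_nodes \<gamma> \<Longrightarrow> depth e < depth deep_leaf"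
    unfolding deep_leaf_def by blast+
qed

abbreviation "df \<equiv> deep_leaf"
abbreviation "rf \<equiv> R_poly \<gamma> deep_leaf"

lemma df_node: "df \<in> nodes \<gamma>"
  using deep_leaf(1) by (rule LeavesD)

lemma rf_V: "rf \<in> V"
  using lower_V[OF df_node R_polys[OF df_node]] .

text \<open>The elements that become divisible by \<open>h\<^sup>k\<close> in the localization of \<open>B\<close> at \<open>R\<^sub>f\<close>.\<close>

definition W :: "nat \<Rightarrow> 'n apoly set" where
  "W k = {p \<in> V. \<exists>n. \<exists>b\<in>V. rf ^ n * p - hh ^ k * b \<in> II}"

lemma WI: "p \<in> V \<Longrightarrow> b \<in> V \<Longrightarrow> rf ^ n * p - hh ^ k * b \<in> II \<Longrightarrow> p \<in> W k"
  unfolding W_def by blast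

lemma WE:
  assumes "p \<in> W k"
  obtains n b where "p \<in> V" "b \<in> V" "rf ^ n * p - hh ^ k * b \<in> II"
  using assms unfolding W_def by blast

lemma W_0: "p \<in> V \<Longrightarrow> p \<in> W 0"
  by (rule WI[of p p 0]) simp_all

lemma W_II: "p \<in> V \<Longrightarrow> p \<in> II \<Longrightarrow> p \<in> W k"
  by (rule WI[of p 0 0]) simp_all

lemma W_add:
  assumes "p \<in> W k" "q \<in> W k" shows "p + q \<in> W k"
proof -
  obtain n b where p: "p \<in> V" "b \<in> V" "rf ^ n * p - hh ^ k * b \<in> II" using assms(1) by (rule WE)
  obtain m c where q: "q \<in> V" "c \<in> V" "rf ^ m * q - hh ^ k * c \<in> II" using assms(2) by (rule WE)
  show ?thesis
  proof (rule WI)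
    have "rf ^ (n + m) * (p + q) - hh ^ k * (rf ^ m * b + rf ^ n * c)
        = rf ^ m * (rf ^ n * p - hh ^ k * b) + rf ^ n * (rf ^ m * q - hh ^ k * c)"
      by (simp add: algebra_simps power_add)
    also have "\<dots> \<in> II" by (rule II_add[OF II_scale[OF p(3)] II_scale[OF q(3)]])
    finally show "rf ^ (n + m) * (p + q) - hh ^ k * (rf ^ m * b + rf ^ n * c) \<in> II" .
  qed (use p q in \<open>auto intro!: polys_add polys_mult polys_power rf_V\<close>)
qed

lemma W_mult:
  assumes "p \<in> W k" "q \<in> W l" shows "p * q \<in> W (k + l)"
proof -
  obtain n b where p: "p \<in> V" "b \<in> V" "rf ^ n * p - hh ^ k * b \<in> II" using assms(1) by (rule WE)
  obtain m c where q: "q \<in> V" "c \<in> V" "rf ^ m * q - hh ^ l * c \<in> II" using assms(2) by (rule WE)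
  show ?thesis
  proof (rule WI)
    have "rf ^ (n + m) * (p * q) - hh ^ (k + l) * (b * c)
        = (rf ^ m * q) * (rf ^ n * p - hh ^ k * b) + (hh ^ k * b) * (rf ^ m * q - hh ^ l * c)"
      by (simp add: algebra_simps power_add)
    also have "\<dots> \<in> II" by (rule II_add[OF II_scale[OF p(3)] II_scale[OF q(3)]])
    finally show "rf ^ (n + m) * (p * q) - hh ^ (k + l) * (b * c) \<in> II" .
  qed (use p q in \<open>auto intro!: polys_mult\<close>)
qed

lemma W_scale: "p \<in> W k \<Longrightarrow> a \<in> V \<Longrightarrow> a * p \<in> W k"
  using W_mult[OF W_0, of a p k] by simp

lemma W_hh: "hh \<in> W 1"
  by (rule WI[of hh 1 0]) simp_all

lemma W_cancel:
  assumes "p \<in> V" "rf * p \<in> W k" shows "p \<in> W k"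
proof -
  obtain n b where p: "b \<in> V" "rf ^ n * (rf * p) - hh ^ k * b \<in> II" using assms(2) by (rule WE)
  then have "rf ^ Suc n * p - hh ^ k * b \<in> II" by (simp add: mult_ac)
  then show ?thesis by (rule WI[OF assms(1) p(1)])
qed

lemma W_cong:
  assumes "p - q \<in> II" "q \<in> W k" "p \<in> V" shows "p \<in> W k"
proof -
  have "q \<in> V" using assms(2) by (rule WE)
  then have "p - q \<in> W k" using assms by (intro W_II polys_diff)
  from W_add[OF this assms(2)] show ?thesis by simp
qed

lemma W_uminus: "p \<in> W k \<Longrightarrow> - p \<in> W k"
  using W_scale[of p k "- 1"] polys_uminus[OF polys_1[of all_vars]] by simp

text \<open>\<open>W k\<close> absorbs sums and multiples, so the product rule reduces the claim to
  the variables.\<close>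

lemma D0_W:
  assumes "p \<in> polys U" "U \<subseteq> all_vars" "\<And>v. v \<in> U \<Longrightarrow> D0 (X v) \<in> W k"
  shows "D0 p \<in> W k"
proof -
  from assms(1) have "p \<in> V \<and> D0 p \<in> W k"
  proof (induction rule: polys_induct)
    case (Const c)
    show ?case by (simp add: W_II D0_Const D0_closed)
  next
    case (X v)
    then show ?case using assms polys_X by blast
  next
    case (add p q)
    then show ?case
      using W_cong[OF D0_add W_add] D0_closed polys_add by blast
  next
    case (mult p q)
    then have "p * D0 q + q * D0 p \<in> W k" by (intro W_add W_scale) auto
    then show ?case
      using mult W_cong[OF D0_mult] D0_closed polys_mult by blast
  qed
  then show ?thesis ..
qed

lemma R_polys_ParX: "c \<in> nodes \<gamma> \<Longrightarrow> R_poly \<gamma> c \<in> polys (ParX \<gamma> ` Anc \<gamma> c)"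
  unfolding R_prod S_poly_lin lin_def by (intro polys_prod polys_diff polys_X imageI polys_Const)

text \<open>Write v as X_{Par(a)} with \<open>a\<close> on the path, and let c be the child of
  \<open>a\<close> towards the leaf. The derivation is applied to h X_a = l R_c with l = X_{Par(a)}
  - lb(c). The left side goes to \<open>W (Suc k)\<close>, since X_a is one level higher and its
  derivative is in \<open>W k\<close>; l D(R_c) is there too, as l is in \<open>W 1\<close> and
  D(R_c) in \<open>W k\<close>. What remains is R_c D(l), and R_c divides R_f.\<close>

lemma D0_X_W:
  "v \<in> lower_vars df \<Longrightarrow> level v + k \<le> depth df \<Longrightarrow> D0 (X v) \<in> W k"
proof (induction k arbitrary: v)
  case 0
  then show ?case using lower_vars_subset[OF df_node] by (intro W_0 D0_closed polys_X) auto
next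
  case (Suc k)
  \<comment> \<open>The only path variable without such an \<open>a\<close> is that of the parent of
    the leaf, whose level equals the depth of the leaf and is excluded by
    \<open>Suc k\<close>.\<close>
  have "\<exists>a \<in> Anc \<gamma> df. v = ParX \<gamma> a"
  proof (cases v)
    case None
    have "df \<noteq> rt" using Suc.prems(2) by auto
    then have "rt \<in> Anc \<gamma> df"
      using root_down[OF df_node] by (simp add: Anc_def)
    then show ?thesis using None by (auto simp: ParX_def)
  next
    case (Some b)
    then have b: "b \<in> Anc \<gamma> df" using Suc.prems(1) by (auto simp: lower_vars_def)
    let ?c = "next_node \<gamma> b df"
    note c = next_node_in[OF df_node b] and cD = ChildD[OF next_node_in(1)[OF df_node b] Anc_nodes[OF b]]
    have "?c \<noteq> df" using cD(5) Suc.prems(2) Some by auto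
    then have "?c \<in> Anc \<gamma> df" using c(2) by (simp add: Anc_def)
    moreover have "v = ParX \<gamma> ?c" using cD Some by (simp add: ParX_def)
    ultimately show ?thesis by blast
  qed
  then obtain a where a: "a \<in> Anc \<gamma> df" "v = ParX \<gamma> a" by blast
  have an: "a \<in> nodes \<gamma>" "a \<in> inner_nodes \<gamma>"
    using Anc_nodes[OF a(1)] Anc_inner[OF a(1) df_node] by auto
  have lv: "level v = depth a" using level_ParX[OF an(1)] a(2) by simp
  let ?c = "next_node \<gamma> a df"
  have c: "?c \<in> Child \<gamma> a" "?c \<in> down \<gamma> df" by (rule next_node_in[OF df_node a(1)])+
  note cD = ChildD[OF c(1) an(1)]
  let ?l = "lin a ?c" and ?R = "R_poly \<gamma> ?c"
  have lV: "?l \<in> V" and RV: "?R \<in> V" and QV: "Q_poly \<gamma> a \<in> V" and XV: "X v \<in> V"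
    using lower_V[OF an(1) lin_polys[OF an(1)]] lower_V[OF cD(1) R_polys[OF cD(1)]]
      lower_V[OF an(1) Q_polys[OF an(1)]] lower_V[OF an(1) polys_X[OF ParX_lower[OF an(1)]]] a(2) by auto
  have UV: "U_poly ?c df \<in> V"
    unfolding U_poly_def
    by (rule lower_V[OF df_node], intro polys_prod S_polys_down) (auto simp: Anc_def)
  have r: "rf = U_poly ?c df * ?R" by (rule R_split[OF df_node c(2)])
  have Q: "Q_poly \<gamma> a = ?l * ?R" by (rule Q_lin[OF an(1) c(1)])
  have hXW: "hh * D0 (X (Some a)) \<in> W (Suc k)"
    using W_mult[OF W_hh Suc.IH[of "Some a"]] a(1) Suc.prems(2) lv by (simp add: lower_vars_def)
  have DQ: "D0 (Q_poly \<gamma> a) \<in> W (Suc k)"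
  proof (rule W_cong[OF _ hXW])
    show "D0 (Q_poly \<gamma> a) - hh * D0 (X (Some a)) \<in> II"
      using II_scale[OF D0_hX[OF an(2)], of "- 1"] by simp
  qed (intro D0_closed QV)
  have DR: "D0 ?R \<in> W k"
  proof (rule D0_W[OF R_polys_ParX[OF cD(1)]])
    have sub: "ParX \<gamma> ` Anc \<gamma> ?c \<subseteq> lower_vars df"
      using ParX_lower Anc_nodes lower_vars_mono Anc_mono[OF c(2)] by (fastforce simp: Anc_def)
    then show "ParX \<gamma> ` Anc \<gamma> ?c \<subseteq> all_vars" using lower_vars_subset[OF df_node] by blast
    fix u assume u: "u \<in> ParX \<gamma> ` Anc \<gamma> ?c"
    then obtain b where b: "b \<in> Anc \<gamma> ?c" "u = ParX \<gamma> b" by blast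
    have "level u = depth b" using level_ParX[OF Anc_nodes[OF b(1)]] b(2) by simp
    also have "\<dots> \<le> depth a" using depth_Anc[OF b(1)] cD(5) by simp
    finally show "D0 (X u) \<in> W k"
      using sub u Suc.prems(2) lv by (intro Suc.IH) auto
  qed
  \<comment> \<open>Modulo the ideal R_c l = h X_a, and R_f is a multiple of R_c.\<close>
  have lW: "?l \<in> W 1"
  proof (rule WI[of _ "U_poly ?c df * X (Some a)" 1])
    have "rf ^ 1 * ?l - hh ^ 1 * (U_poly ?c df * X (Some a)) = (- U_poly ?c df) * Delta0 \<gamma> a"
      unfolding Delta0_def Q r by (simp add: algebra_simps)
    also have "\<dots> \<in> II" by (rule II_scale[OF Delta0_II[OF an(2)]])
    finally show "rf ^ 1 * ?l - hh ^ 1 * (U_poly ?c df * X (Some a)) \<in> II" .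
  qed (use lV UV X_V(1)[OF an(2)] in \<open>auto intro: polys_mult\<close>)
  have "?l * D0 ?R \<in> W (Suc k)" using W_mult[OF lW DR] by simp
  then have "D0 (Q_poly \<gamma> a) + - (?l * D0 ?R) \<in> W (Suc k)" by (intro W_add DQ W_uminus)
  then have "?R * D0 ?l \<in> W (Suc k)"
  proof (rule W_cong[rotated])
    have "?R * D0 ?l - (D0 (Q_poly \<gamma> a) + - (?l * D0 ?R)) = (- 1) * (D0 (?l * ?R) - (?l * D0 ?R + ?R * D0 ?l))"
      unfolding Q by simp
    also have "\<dots> \<in> II" by (rule II_scale[OF D0_mult[OF lV RV]])
    finally show "?R * D0 ?l - (D0 (Q_poly \<gamma> a) + - (?l * D0 ?R)) \<in> II" .
  qed (intro polys_mult RV D0_closed lV)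
  then have "U_poly ?c df * (?R * D0 ?l) \<in> W (Suc k)" by (rule W_scale[OF _ UV])
  then have "rf * D0 ?l \<in> W (Suc k)" by (simp only: r mult.assoc)
  then have Dl: "D0 ?l \<in> W (Suc k)" by (rule W_cancel[OF D0_closed[OF lV]])
  have "D0 (?l + Const [:lb \<gamma> ?c:]) - (D0 ?l + D0 (Const [:lb \<gamma> ?c:])) \<in> II"
    by (rule D0_add[OF lV]) simp
  then have "D0 (X v) - (D0 ?l + D0 (Const [:lb \<gamma> ?c:])) \<in> II"
    by (simp add: lin_def a(2))
  then show ?case
    by (rule W_cong) (intro W_add Dl W_II D0_Const D0_closed polys_Const XV)+
qed

text \<open>Since the slope is a constant of K, clearing denominators gives h^N D(X_0) = c in
  \<open>B\<close> with c in \<open>A\<close>; with the divisibility at the leaf, c R_f^n = h^(N+d)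
  b. Were c not divisible by h^(N+d), cancelling the common power of \<open>h\<close> would leave an
  equation that fails at the closed point of the leaf.\<close>

lemma D0_X0_eq: "\<exists>c. D0 (X None) - Const (hA ^ depth df * c) \<in> II"
proof -
  let ?q = "D0 (X None)" and ?d = "depth df"
  have qV: "?q \<in> V" using D0_closed X_V by blast
  have "?q \<in> W ?d" by (rule D0_X_W) (simp_all add: lower_vars_def)
  then obtain n b where b: "b \<in> V" "rf ^ n * ?q - hh ^ ?d * b \<in> II" by (rule WE)
  have "Anc \<gamma> e \<subseteq> inner_nodes \<gamma>" if "e \<in> inner_nodes \<gamma>" for e
    using that Anc_inner inner_nodesD by blast
  moreover have "inner_nodes \<gamma> \<subseteq> nodes \<gamma>" using inner_nodesD by blast
  ultimately obtain N q0 where q0: "q0 \<in> polys {None}" "hh ^ N * ?q - q0 \<in> idl.span (Delta0 \<gamma> ` inner_nodes \<gamma>)"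
    using clear_denominators[of "inner_nodes \<gamma>" ?q] qV unfolding all_vars_def by blast
  from q0(2) have q0I: "hh ^ N * ?q - q0 \<in> II" by (rule span_Delta0_II[OF subset_refl])
  obtain z where z: "slope = [:z:]" using slope_const degree_eq_zeroE by blast
  have "Phi q0 = Phi (hh ^ N * ?q)" using Phi_eq[OF q0I] by simp
  also have "\<dots> = [:to_fract (hA ^ N) * z:]"
    unfolding hh_power Phi.mult Phi_Const using z by (simp add: slope_def)
  finally obtain c where c: "q0 = Const c" using Phi_None_const[OF q0(1)] by blast
  have key: "Const c * rf ^ n - hh ^ (N + ?d) * b \<in> II"
  proof -
    have "Const c * rf ^ n - hh ^ (N + ?d) * b
        = hh ^ N * (rf ^ n * ?q - hh ^ ?d * b) - rf ^ n * (hh ^ N * ?q - q0)"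
      unfolding c by (simp add: algebra_simps power_add)
    also have "\<dots> \<in> II" by (rule II_diff[OF II_scale[OF b(2)] II_scale[OF q0I]])
    finally show ?thesis .
  qed
  have "hA ^ (N + ?d) dvd c"
  proof (rule ccontr)
    assume "\<not> hA ^ (N + ?d) dvd c"
    then obtain j a where j: "j < N + ?d" "c = hA ^ j * a" "poly a 0 \<noteq> 0"
      using hA_power_dvd_or by blast
    \<comment> \<open>The exponent of \<open>h\<close> left in front of b is positive, so that term
      vanishes at the point.\<close>
    obtain k where k: "N + ?d = j + Suc k" using j(1) less_iff_Suc_add by auto
    let ?x = "Const a * rf ^ n - hh ^ Suc k * b"
    have "hh ^ j * ?x = Const c * rf ^ n - hh ^ (N + ?d) * b"
      unfolding k j(2) by (simp add: algebra_simps power_add Const.mult Const.power)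
    then have "hh ^ j * ?x \<in> II" using key by simp
    moreover have "?x \<in> V" using b(1) rf_V by (intro polys_diff polys_mult polys_power polys_Const)
    ultimately have "?x \<in> II" using II_hh_cancel by blast
    then have "eval_point df ?x = 0" by (rule ev_II[OF deep_leaf(1)])
    then show False
      using j(3) ev_R_f[OF deep_leaf(1)] by (simp add: ev.diff ev.mult ev.power ev_Const hA_def)
  qed
  then obtain c' where c': "c = hA ^ (N + ?d) * c'" by (elim dvdE)
  have "hh ^ N * (?q - Const (hA ^ ?d * c')) = hh ^ N * ?q - q0"
    unfolding c c' by (simp add: algebra_simps power_add Const.mult Const.power)
  then have "hh ^ N * (?q - Const (hA ^ ?d * c')) \<in> II" using q0I by simp
  then show ?thesis using II_hh_cancel[OF polys_diff[OF qV polys_Const]] by blast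
qed

text \<open>The values on the variables are found by recursion on the level from h D(X_e) = D(Q_e).
  Agreement with \<open>D0\<close> modulo the ideal follows since both satisfy this equation and
  \<open>B\<close> has no \<open>h\<close>-torsion; nilpotency passes from Q_e to X_e by cancelling
  \<open>h\<close> in the polynomial ring.\<close>

lemma derivation_lift:
  obtains d where "\<And>v. v \<in> all_vars \<Longrightarrow> d v \<in> V"
    and "\<And>p. p \<in> V \<Longrightarrow> der d p - D0 p \<in> II"
    and "\<And>p. p \<in> V \<Longrightarrow> \<exists>n. (der d ^^ n) p = 0"
proof -
  obtain c where c: "D0 (X None) - Const (hA ^ depth df * c) \<in> II" using D0_X0_eq by blast
  \<comment> \<open>The choice stands for the quotient by \<open>h\<close>; its existence is
    established in \<open>main\<close>, along with the divisibility that carries the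
    recursion.\<close>
  define F where "F v y = (case v of None \<Rightarrow> Const (hA ^ depth df * c)
     | Some e \<Rightarrow> if e \<in> inner_nodes \<gamma> then (SOME q. hh * q = der y (Q_poly \<gamma> e)) else 0)"
    for v and y :: "'n option \<Rightarrow> 'n apoly"
  have "\<exists>y. \<forall>v. y v = F v y"
  proof (rule level_recursion[where lv = level])
    fix v and y y' :: "'n option \<Rightarrow> 'n apoly"
    assume eq: "\<And>u. level u < level v \<Longrightarrow> y u = y' u"
    have "der y (Q_poly \<gamma> e) = der y' (Q_poly \<gamma> e)" if "v = Some e" "e \<in> inner_nodes \<gamma>" for e
      using der_cong_polys[OF Q_polys[OF inner_nodesD[OF that(2)]]] eq level_lower_vars that(1) by blast
    then show "F v y = F v y'" by (auto simp: F_def split: option.split)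
  qed
  then obtain d where d: "d v = F v d" for v by blast
  have dN: "d None = Const (hA ^ depth df * c)" by (subst d) (simp add: F_def)
  \<comment> \<open>The exponent starts at the depth of the leaf for X_0 and drops by one per level.
    Inner nodes have smaller depth than the leaf, so the subtraction is never truncated.\<close>
  have main: "d v \<in> V \<and> hh ^ (depth df - level v) dvd d v \<and>
      (\<forall>e. v = Some e \<longrightarrow> hh * d v = der d (Q_poly \<gamma> e))" if "v \<in> all_vars" for v
    using that
  proof (induction "level v" arbitrary: v rule: less_induct)
    case less
    show ?case
    proof (cases v)
      case None
      then have "hh ^ (depth df - level v) dvd d v" "d v \<in> V"
        unfolding None dN by (simp_all only: Const.mult Const.power level_simps diff_zero dvd_triv_left)
          (simp flip: Const.mult Const.power)
      then show ?thesis using None by simp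
    next
      case (Some e)
      then have e: "e \<in> inner_nodes \<gamma>" using less.prems by (auto simp: all_vars_def)
      note en = inner_nodesD[OF e]
      let ?m = "depth df - level v"
      have m: "depth df - depth e = Suc ?m" using deep_leaf(2)[OF e] Some by simp
      have IH: "d u \<in> V" "hh ^ (depth df - level u) dvd d u" if "u \<in> lower_vars e" for u
        using less.hyps[of u] that level_lower_vars[OF that] lower_vars_subset[OF en] Some by auto
      have "hh ^ Suc ?m dvd der d (Q_poly \<gamma> e)"
      proof (rule der_dvd[OF Q_polys[OF en]])
        fix u assume u: "u \<in> lower_vars e"
        then have "Suc ?m \<le> depth df - level u" using level_lower_vars[OF u] m by simp
        then have "hh ^ Suc ?m dvd (hh :: 'n apoly) ^ (depth df - level u)" by (rule le_imp_power_dvd)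
        then show "hh ^ Suc ?m dvd d u" using IH(2)[OF u] dvd_trans by blast
      qed
      then obtain w where w: "der d (Q_poly \<gamma> e) = hh * (hh ^ ?m * w)"
        by (auto simp: mult.assoc elim!: dvdE)
      have "d v = (SOME q. hh * q = der d (Q_poly \<gamma> e))"
        by (subst d) (simp add: F_def Some e)
      then have hd: "hh * d v = der d (Q_poly \<gamma> e)"
        using someI[of "\<lambda>q. hh * q = der d (Q_poly \<gamma> e)" "hh ^ ?m * w"] w by simp
      then have "hh ^ 1 * (d v - hh ^ ?m * w) = 0" using w by (simp add: right_diff_distrib)
      then have "d v = hh ^ ?m * w" using hh_mult_eq_0[of 1] by fastforce
      moreover have "der d (Q_poly \<gamma> e) \<in> V"
        by (rule der_polys[OF Q_polys[OF en] lower_vars_subset[OF en] IH(1)])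
      then have "d v \<in> V" using hd polys_Const_mult_cancel[of hA "d v"] by simp
      ultimately show ?thesis using hd Some by simp
    qed
  qed
  have dV: "der d p \<in> V" if "p \<in> V" for p
    using that main by (intro der_polys[OF that]) auto
  have hdX: "hh * d (Some e) = der d (Q_poly \<gamma> e)" if "e \<in> inner_nodes \<gamma>" for e
    using main[of "Some e"] that by (auto simp: all_vars_def)
  have lift: "der d p - D0 p \<in> II" if "p \<in> V" for p
    using that
  proof (induction rule: poly_level_induct)
    case (Const c)
    then show ?case using II_scale[OF D0_Const, of "- 1"] by simp
  next
    case None
    then show ?case using II_scale[OF c, of "- 1"] by (simp add: dN)
  next
    case (Some e)
    note en = inner_nodesD[OF Some(1)]
    have "der d (Q_poly \<gamma> e) - D0 (Q_poly \<gamma> e) \<in> II"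
      by (rule Some(2)[OF Q_polys[OF en] lower_V[OF en Q_polys[OF en]]])
    from II_diff[OF this D0_hX[OF Some(1)]]
    have "hh ^ 1 * (der d (X (Some e)) - D0 (X (Some e))) \<in> II"
      by (simp add: hdX[OF Some(1)] right_diff_distrib)
    moreover have "der d (X (Some e)) - D0 (X (Some e)) \<in> V"
      using X_V(1)[OF Some(1)] by (intro polys_diff dV D0_closed)
    ultimately show ?case using II_hh_cancel by blast
  next
    case (add p q)
    have "der d (p + q) - D0 (p + q) = (der d p - D0 p) + (der d q - D0 q) - (D0 (p + q) - (D0 p + D0 q))"
      by (simp add: der_add)
    also have "\<dots> \<in> II" by (rule II_diff[OF II_add[OF add(3,4)] D0_add[OF add(1,2)]])
    finally show ?case .
  next
    case (mult p q)
    have "der d (p * q) - D0 (p * q)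
        = p * (der d q - D0 q) + q * (der d p - D0 p) - (D0 (p * q) - (p * D0 q + q * D0 p))"
      by (simp add: der_mult algebra_simps)
    also have "\<dots> \<in> II"
      by (rule II_diff[OF II_add[OF II_scale[OF mult(4)] II_scale[OF mult(3)]] D0_mult[OF mult(1,2)]])
    finally show ?case .
  qed
  have nil: "\<exists>n. (der d ^^ n) p = 0" if "p \<in> V" for p
    using that
  proof (induction rule: poly_level_induct)
    case (Const c)
    have "(der d ^^ 1) (Const c) = 0" by simp
    then show ?case by blast
  next
    case None
    have "(der d ^^ 2) (X None) = 0" by (simp add: numeral_2_eq_2 dN)
    then show ?case by blast
  next
    case (Some e)
    note en = inner_nodesD[OF Some(1)]
    obtain n where "(der d ^^ n) (Q_poly \<gamma> e) = 0"
      using Some(2)[OF Q_polys[OF en] lower_V[OF en Q_polys[OF en]]] by blast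
    then have "(der d ^^ Suc n) (Q_poly \<gamma> e) = 0" by (simp add: der_funpow_0[of 1, simplified])
    then have "(der d ^^ n) (hh * d (Some e)) = 0" by (simp add: hdX[OF Some(1)] funpow_swap1)
    then have "hh ^ 1 * (der d ^^ n) (d (Some e)) = 0" by (simp add: der_funpow_Const_mult)
    then have "(der d ^^ n) (d (Some e)) = 0" by (rule hh_mult_eq_0)
    then have "(der d ^^ Suc n) (X (Some e)) = 0" by (simp add: funpow_swap1)
    then show ?case by blast
  next
    case (add p q)
    then show ?case using nilpotent_add by blast
  next
    case (mult p q)
    then show ?case using nilpotent_mult by blast
  qed
  show thesis
    by (rule that[of d]) (use main lift nil in auto)
qed

end


section \<open>Actions of the additive group\<close>

lemma coeff_X_mult:
  assumes "cring R" and q: "q \<in> carrier (UP R)"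
  shows "up_ring.coeff (UP R) (up_ring.monom (UP R) \<one>\<^bsub>R\<^esub> 1 \<otimes>\<^bsub>UP R\<^esub> q) n
    = (case n of 0 \<Rightarrow> \<zero>\<^bsub>R\<^esub> | Suc m \<Rightarrow> up_ring.coeff (UP R) q m)"
proof -
  interpret R: UP_cring R "UP R" by (rule UP_cring.intro) fact+
  show ?thesis
  proof (cases n)
    case 0
    then show ?thesis using q by (simp add: R.R.l_null)
  next
    case (Suc m)
    then show ?thesis using R.coeff_monom_mult[OF R.R.one_closed q, of 1 m] q by simp
  qed
qed

lemma coeff_const_mult:
  assumes "cring R" and q: "q \<in> carrier (UP R)" and a: "a \<in> carrier R"
  shows "up_ring.coeff (UP R) (up_ring.monom (UP R) a 0 \<otimes>\<^bsub>UP R\<^esub> q) n = a \<otimes>\<^bsub>R\<^esub> up_ring.coeff (UP R) q n"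
proof -
  interpret R: UP_cring R "UP R" by (rule UP_cring.intro) fact+
  show ?thesis using R.coeff_monom_mult[OF a q, of 0 n] by simp
qed

lemma UP_cring_cring: "cring R \<Longrightarrow> cring (UP R)"
  using UP_cring.UP_cring UP_cring.intro by blast

lemma UP_apply: "p \<in> carrier (UP R) \<Longrightarrow> up_ring.coeff (UP R) p n = p n"
  by (simp add: UP_def)

text \<open>The index \<open>n\<close> counts powers of the outer variable s, and \<open>k\<close>
  powers of t. The coefficient of s^n t^k in (s+t)^i is i choose n if i = n+k, and zero
  otherwise.\<close>

lemma Ga_comult_coeff:
  assumes R: "cring R" and p: "p \<in> carrier (UP R)"
  shows "Ga_comult R p n k = [((n + k) choose n)] \<cdot>\<^bsub>R\<^esub> p (n + k)"
proof -
  define P where "P = UP R"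
  define PP where "PP = UP P"
  have Pc: "cring P" and PPc: "cring PP" unfolding PP_def P_def by (intro UP_cring_cring R)+
  interpret P: UP_cring R P unfolding P_def by (rule UP_cring.intro) (rule R)
  interpret PP: UP_cring P PP unfolding PP_def by (rule UP_cring.intro) (rule Pc)
  define S where "S = up_ring.monom PP \<one>\<^bsub>P\<^esub> 1"
  define T where "T = up_ring.monom PP (up_ring.monom P \<one>\<^bsub>R\<^esub> 1) 0"
  define \<sigma> where "\<sigma> = S \<oplus>\<^bsub>PP\<^esub> T"
  have ST: "S \<in> carrier PP" "T \<in> carrier PP" "\<sigma> \<in> carrier PP"
    unfolding \<sigma>_def S_def T_def by simp_all
  have pow: "\<sigma> [^]\<^bsub>PP\<^esub> i \<in> carrier PP" for i :: nat
    using ST(3) by simp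
  \<comment> \<open>Pascal's rule: multiplication by s + t raises one of the two indices.\<close>
  have coef: "up_ring.coeff P (up_ring.coeff PP (\<sigma> [^]\<^bsub>PP\<^esub> i) n) k
      = (if n + k = i then [(i choose n)] \<cdot>\<^bsub>R\<^esub> \<one>\<^bsub>R\<^esub> else \<zero>\<^bsub>R\<^esub>)" for i n k :: nat
  proof (induction i arbitrary: n k)
    case 0
    show ?case by simp
  next
    case (Suc i)
    let ?q = "\<sigma> [^]\<^bsub>PP\<^esub> i"
    have "\<sigma> [^]\<^bsub>PP\<^esub> Suc i = S \<otimes>\<^bsub>PP\<^esub> ?q \<oplus>\<^bsub>PP\<^esub> T \<otimes>\<^bsub>PP\<^esub> ?q"
      using ST pow unfolding \<sigma>_def by (simp add: PP.P.m_comm PP.P.l_distr)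
    then have "up_ring.coeff P (up_ring.coeff PP (\<sigma> [^]\<^bsub>PP\<^esub> Suc i) n) k
        = up_ring.coeff P (up_ring.coeff PP (S \<otimes>\<^bsub>PP\<^esub> ?q) n) k
          \<oplus>\<^bsub>R\<^esub> up_ring.coeff P (up_ring.coeff PP (T \<otimes>\<^bsub>PP\<^esub> ?q) n) k"
      using ST pow by simp
    also have "up_ring.coeff P (up_ring.coeff PP (S \<otimes>\<^bsub>PP\<^esub> ?q) n) k
        = (case n of 0 \<Rightarrow> \<zero>\<^bsub>R\<^esub> | Suc m \<Rightarrow> up_ring.coeff P (up_ring.coeff PP ?q m) k)"
      unfolding S_def PP_def using coeff_X_mult[OF Pc, of ?q n] pow
      by (simp add: PP_def split: nat.split)
    also have "up_ring.coeff P (up_ring.coeff PP (T \<otimes>\<^bsub>PP\<^esub> ?q) n) k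
        = (case k of 0 \<Rightarrow> \<zero>\<^bsub>R\<^esub> | Suc l \<Rightarrow> up_ring.coeff P (up_ring.coeff PP ?q n) l)"
      using coeff_const_mult[OF Pc, folded PP_def, of ?q "up_ring.monom P \<one>\<^bsub>R\<^esub> 1" n] pow
        coeff_X_mult[OF R, folded P_def, of "up_ring.coeff PP ?q n" k]
      by (simp add: T_def)
    finally show ?case
      by (cases n; cases k) (auto simp: Suc.IH P.R.add.nat_pow_mult)
  qed
  let ?\<phi> = "\<lambda>a. up_ring.monom PP (up_ring.monom P a 0) 0"
  have pP: "p \<in> carrier P" using p by (simp add: P_def)
  have G: "Ga_comult R p = (\<Oplus>\<^bsub>PP\<^esub>i\<in>{..deg R p}. ?\<phi> (up_ring.coeff P p i) \<otimes>\<^bsub>PP\<^esub> \<sigma> [^]\<^bsub>PP\<^esub> i)"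
    unfolding Ga_comult_def P_def[symmetric] PP_def[symmetric] \<sigma>_def S_def T_def
    by (rule P.eval_on_carrier[OF pP])
  have tc: "?\<phi> (up_ring.coeff P p i) \<otimes>\<^bsub>PP\<^esub> \<sigma> [^]\<^bsub>PP\<^esub> i \<in> carrier PP" for i
    using pP pow by simp
  have summand: "up_ring.coeff P (up_ring.coeff PP (?\<phi> (up_ring.coeff P p i) \<otimes>\<^bsub>PP\<^esub> \<sigma> [^]\<^bsub>PP\<^esub> i) n) k
      = (if n + k = i then [((n + k) choose n)] \<cdot>\<^bsub>R\<^esub> up_ring.coeff P p i else \<zero>\<^bsub>R\<^esub>)" for i
  proof -
    have "up_ring.coeff P (up_ring.coeff PP (?\<phi> (up_ring.coeff P p i) \<otimes>\<^bsub>PP\<^esub> \<sigma> [^]\<^bsub>PP\<^esub> i) n) k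
        = up_ring.coeff P p i \<otimes>\<^bsub>R\<^esub> up_ring.coeff P (up_ring.coeff PP (\<sigma> [^]\<^bsub>PP\<^esub> i) n) k"
      using coeff_const_mult[OF Pc, of "\<sigma> [^]\<^bsub>PP\<^esub> i" "up_ring.monom P (up_ring.coeff P p i) 0" n]
        coeff_const_mult[OF R, of "up_ring.coeff PP (\<sigma> [^]\<^bsub>PP\<^esub> i) n" "up_ring.coeff P p i" k] pow pP
      by (simp add: PP_def[symmetric] P_def[symmetric])
    then show ?thesis
      using pP by (simp add: coef P.R.add_pow_rdistr)
  qed
  have GP: "Ga_comult R p \<in> carrier PP"
    unfolding G by (rule PP.P.finsum_closed) (use tc in auto)
  then have "Ga_comult R p n k = up_ring.coeff P (up_ring.coeff PP (Ga_comult R p) n) k"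
    using UP_apply[of "Ga_comult R p" P n] UP_apply[of "up_ring.coeff PP (Ga_comult R p) n" R k]
      PP.coeff_closed[OF GP, of n] by (simp add: PP_def[symmetric] P_def[symmetric])
  also have "\<dots> = (\<Oplus>\<^bsub>R\<^esub>i\<in>{..deg R p}. if n + k = i then [((n + k) choose n)] \<cdot>\<^bsub>R\<^esub> up_ring.coeff P p i else \<zero>\<^bsub>R\<^esub>)"
    unfolding G using tc by (simp add: PP.coeff_finsum P.coeff_finsum Pi_def summand)
  also have "\<dots> = [((n + k) choose n)] \<cdot>\<^bsub>R\<^esub> up_ring.coeff P p (n + k)"
  proof (cases "n + k \<le> deg R p")
    case True
    then show ?thesis
      using P.R.finsum_singleton[of "n + k" "{..deg R p}" "\<lambda>i. [((n + k) choose n)] \<cdot>\<^bsub>R\<^esub> up_ring.coeff P p i"] pP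
      by simp
  next
    case False
    then have "up_ring.coeff P p (n + k) = \<zero>\<^bsub>R\<^esub>" using P.deg_aboveD[of p "n + k"] pP by simp
    moreover have "(\<Oplus>\<^bsub>R\<^esub>i\<in>{..deg R p}. if n + k = i then [((n + k) choose n)] \<cdot>\<^bsub>R\<^esub> up_ring.coeff P p i else \<zero>\<^bsub>R\<^esub>) = \<zero>\<^bsub>R\<^esub>"
      by (rule P.R.add.finprod_one_eqI) (use False in auto)
    ultimately show ?thesis by simp
  qed
  finally show ?thesis using UP_apply[of p R] p by (simp add: P_def)
qed

lemma eval_at_zero:
  assumes R: "cring R" and p: "p \<in> carrier (UP R)"
  shows "eval R R (\<lambda>c. c) \<zero>\<^bsub>R\<^esub> p = p 0"
proof -
  interpret P: UP_cring R "UP R" by (rule UP_cring.intro) (rule R)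
  have "eval R R (\<lambda>c. c) \<zero>\<^bsub>R\<^esub> p = (\<Oplus>\<^bsub>R\<^esub>i\<in>{..deg R p}. up_ring.coeff (UP R) p i \<otimes>\<^bsub>R\<^esub> \<zero>\<^bsub>R\<^esub> [^]\<^bsub>R\<^esub> i)"
    by (rule P.eval_on_carrier[OF p])
  moreover have "\<zero>\<^bsub>R\<^esub> [^]\<^bsub>R\<^esub> i = (if i = 0 then \<one>\<^bsub>R\<^esub> else \<zero>\<^bsub>R\<^esub>)" for i :: nat
    by (cases i) simp_all
  ultimately have "eval R R (\<lambda>c. c) \<zero>\<^bsub>R\<^esub> p
      = (\<Oplus>\<^bsub>R\<^esub>i\<in>{..deg R p}. up_ring.coeff (UP R) p i \<otimes>\<^bsub>R\<^esub> (if i = 0 then \<one>\<^bsub>R\<^esub> else \<zero>\<^bsub>R\<^esub>))"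
    by simp
  also have "(\<Oplus>\<^bsub>R\<^esub>i\<in>{..deg R p}. up_ring.coeff (UP R) p i \<otimes>\<^bsub>R\<^esub> (if i = 0 then \<one>\<^bsub>R\<^esub> else \<zero>\<^bsub>R\<^esub>))
      = (\<Oplus>\<^bsub>R\<^esub>i\<in>{..deg R p}. if 0 = i then up_ring.coeff (UP R) p i else \<zero>\<^bsub>R\<^esub>)"
    by (rule P.R.finsum_cong') (use p in auto)
  also have "\<dots> = up_ring.coeff (UP R) p 0"
    using P.R.finsum_singleton[of 0 "{..deg R p}" "up_ring.coeff (UP R) p"] p by simp
  finally show ?thesis using UP_apply[OF p] by simp
qed

context fl_rooted_tree
begin

section \<open>The coordinate ring as a quotient ring\<close>

abbreviation "AR \<equiv> A_ring \<gamma>"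
abbreviation "BR \<equiv> B_ring \<gamma>"

lemma A_ring_simps [simp]:
  "mult AR = (*)" "one AR = 1" "zero AR = 0" "add AR = (+)" "carrier AR = polys all_vars"
  by (simp_all add: A_ring_def flip: carrier_A_ring)

lemma A_cring: "cring AR"
proof (rule cringI)
  show "abelian_group AR"
  proof (rule abelian_groupI)
    fix x assume "x \<in> carrier AR"
    then show "\<exists>y\<in>carrier AR. y \<oplus>\<^bsub>AR\<^esub> x = \<zero>\<^bsub>AR\<^esub>"
      by (intro bexI[of _ "- x"]) (auto intro: polys_uminus)
  qed (auto intro: polys_add simp: add_ac)
  show "Group.comm_monoid AR"
    by (rule comm_monoidI) (auto intro: polys_mult simp: mult_ac)
qed (auto simp: distrib_right)

lemma A_minus: "x \<in> carrier AR \<Longrightarrow> \<ominus>\<^bsub>AR\<^esub> x = - x"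
proof -
  interpret A: cring AR by (rule A_cring)
  assume x: "x \<in> carrier AR"
  show ?thesis by (rule A.minus_equality) (use x in \<open>auto intro: polys_uminus\<close>)
qed

lemma A_finsum: "(\<And>x. x \<in> S \<Longrightarrow> f x \<in> carrier AR) \<Longrightarrow> finite S \<Longrightarrow> finsum AR f S = sum f S"
proof -
  interpret A: cring AR by (rule A_cring)
  assume *: "\<And>x. x \<in> S \<Longrightarrow> f x \<in> carrier AR" and "finite S"
  from \<open>finite S\<close> * show ?thesis
    by (induction S) (auto simp: A.finsum_insert Pi_def)
qed

lemma A_add_pow: "x \<in> carrier AR \<Longrightarrow> [(n::nat)] \<cdot>\<^bsub>AR\<^esub> x = of_nat n * x"
proof -
  interpret A: cring AR by (rule A_cring)
  show "x \<in> carrier AR \<Longrightarrow> [(n::nat)] \<cdot>\<^bsub>AR\<^esub> x = of_nat n * x"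
    by (induction n) (auto simp: algebra_simps)
qed

abbreviation "gens \<equiv> {Delta0 \<gamma> e | e. e \<in> inner_nodes \<gamma>} \<union>
      {Delta \<gamma> e' e | e e'. e \<in> inner_nodes \<gamma> \<and> e' \<in> Anc \<gamma> e}"

lemma gens_carrier: "gens \<subseteq> polys all_vars"
proof -
  have low: "p \<in> polys (lower_vars e) \<Longrightarrow> p \<in> polys all_vars" if "e \<in> inner_nodes \<gamma>" for p e
    using polys_mono[OF lower_vars_subset[OF inner_nodesD[OF that]]] by blast
  have X: "X (Some e) \<in> polys all_vars" if "e \<in> inner_nodes \<gamma>" for e
    using that by (intro polys_X) (simp add: all_vars_def)
  have "Delta0 \<gamma> e \<in> polys all_vars" if e: "e \<in> inner_nodes \<gamma>" for e
    unfolding Delta0_def by (intro polys_diff polys_mult polys_Const X e low[OF e] Q_polys inner_nodesD)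
  moreover have "Delta \<gamma> a e \<in> polys all_vars" if e: "e \<in> inner_nodes \<gamma>" and a: "a \<in> Anc \<gamma> e" for a e
  proof -
    note en = inner_nodesD[OF e]
    have ai: "a \<in> inner_nodes \<gamma>" by (rule Anc_inner[OF a en])
    show ?thesis
      unfolding Delta_eq[OF en a]
      by (intro polys_diff polys_mult X e ai low[OF ai lin_polys] low[OF e T_polys] inner_nodesD)
  qed
  ultimately show ?thesis by blast
qed

text \<open>For the harder inclusion, the variables absent from the ring are set to 0. This
  retraction fixes the generators and moves their coefficients into the carrier.\<close>

lemma I_ideal_eq: "I_ideal \<gamma> = II \<inter> polys all_vars"
proof -
  interpret A: cring AR by (rule A_cring)
  have "ideal (II \<inter> polys all_vars) AR"
  proof (rule idealI[OF A.ring_axioms])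
    show "subgroup (II \<inter> polys all_vars) (add_monoid AR)"
    proof (rule A.add.subgroupI)
      show "II \<inter> polys all_vars \<noteq> {}" using II_0 polys_0 by blast
    next
      fix a assume "a \<in> II \<inter> polys all_vars"
      then show "\<ominus>\<^bsub>AR\<^esub> a \<in> II \<inter> polys all_vars"
        using II_scale[of a "- 1"] by (simp add: A_minus polys_uminus)
    qed (auto intro: II_add polys_add)
  qed (auto intro: II_scale II_mult_right polys_mult)
  moreover have "gens \<subseteq> II \<inter> polys all_vars"
    using gens_carrier Delta0_II Delta_II by blast
  ultimately have "I_ideal \<gamma> \<subseteq> II \<inter> polys all_vars"
    unfolding I_ideal_def by (rule A.genideal_minimal)
  moreover have "II \<inter> polys all_vars \<subseteq> I_ideal \<gamma>"
  proof
    fix p assume p: "p \<in> II \<inter> polys all_vars"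
    define ret where "ret = (subst Const (\<lambda>v. if v \<in> all_vars then X v else 0) :: 'n apoly \<Rightarrow> 'n apoly)"
    interpret ret: comm_hom ret
      unfolding ret_def by (rule comm_hom.subst_comm_hom[OF Const.comm_hom_axioms])
    have ret_X: "ret (X v) = (if v \<in> all_vars then X v else 0)" for v
      unfolding ret_def by (rule comm_hom_subst_simps(2)[OF Const.comm_hom_axioms])
    have ret_C: "ret (Const c) = Const c" for c
      unfolding ret_def by (rule comm_hom_subst_simps(1)[OF Const.comm_hom_axioms])
    have id: "ret q = q" if "q \<in> polys all_vars" for q
      using that by (induction rule: polys_induct) (simp_all add: ret_X ret_C ret.add ret.mult)
    have cl: "ret q \<in> polys all_vars" for q
    proof -
      have "q \<in> polys UNIV" by simp
      then show ?thesis
        by (induction rule: polys_induct)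
          (auto simp: ret_X ret_C ret.add ret.mult intro: polys_X polys_add polys_mult)
    qed
    interpret I: ideal "I_ideal \<gamma>" AR
      unfolding I_ideal_def by (rule A.genideal_ideal) (use gens_carrier in simp)
    have gI: "g \<in> I_ideal \<gamma>" if "g \<in> gens" for g
      unfolding I_ideal_def using A.genideal_self[of gens] gens_carrier that by auto
    have "ret q \<in> I_ideal \<gamma>" if "q \<in> II" for q
      using that unfolding II_def
    proof (induction rule: idl.span_induct_alt)
      case base
      then show ?case using I.zero_closed by (simp add: ret.zero)
    next
      case (step c g y)
      have "ret c * g \<in> I_ideal \<gamma>"
        using I.I_l_closed[OF gI[OF step(1)], of "ret c"] cl by simp
      then have "ret c * g + ret y \<in> I_ideal \<gamma>"
        using I.a_closed[of "ret c * g" "ret y"] step(2) by simp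
      moreover have "ret g = g" using step(1) gens_carrier by (intro id) blast
      ultimately show ?case by (simp add: ret.add ret.mult)
    qed
    from this[of p] id[of p] p show "p \<in> I_ideal \<gamma>" by simp
  qed
  ultimately show ?thesis by blast
qed

lemma I_ideal: "ideal (I_ideal \<gamma>) AR"
proof -
  interpret A: cring AR by (rule A_cring)
  show ?thesis unfolding I_ideal_def by (rule A.genideal_ideal) (use gens_carrier in simp)
qed

lemma B_cring: "cring BR"
  unfolding B_ring_def by (rule ideal.quotient_is_cring[OF I_ideal A_cring])

lemma B_proj_hom: "B_proj \<gamma> \<in> ring_hom AR BR"
  using ideal.rcos_ring_hom[OF I_ideal] unfolding B_ring_def B_proj_def by simp

lemma B_proj_eq:
  assumes "p \<in> polys all_vars" "q \<in> polys all_vars"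
  shows "B_proj \<gamma> p = B_proj \<gamma> q \<longleftrightarrow> p - q \<in> II"
proof -
  interpret A: cring AR by (rule A_cring)
  have "p \<ominus>\<^bsub>AR\<^esub> q = p - q" using assms by (simp add: a_minus_def A_minus)
  then show ?thesis
    using A.quotient_eq_iff_same_a_r_cos[OF I_ideal, of p q] assms polys_diff[OF assms]
    by (auto simp: B_proj_def I_ideal_eq)
qed

lemma B_proj_surj: "b \<in> carrier BR \<Longrightarrow> \<exists>p \<in> polys all_vars. b = B_proj \<gamma> p"
  unfolding B_ring_def FactRing_def B_proj_def using A_RCOSETS_def'[of AR "I_ideal \<gamma>"] by auto

lemma B_proj_closed: "p \<in> polys all_vars \<Longrightarrow> B_proj \<gamma> p \<in> carrier BR"
  using ring_hom_closed[OF B_proj_hom] by simp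

lemma B_proj_add:
  "p \<in> polys all_vars \<Longrightarrow> q \<in> polys all_vars \<Longrightarrow> B_proj \<gamma> (p + q) = B_proj \<gamma> p \<oplus>\<^bsub>BR\<^esub> B_proj \<gamma> q"
  using ring_hom_add[OF B_proj_hom] by simp

lemma B_proj_mult:
  "p \<in> polys all_vars \<Longrightarrow> q \<in> polys all_vars \<Longrightarrow> B_proj \<gamma> (p * q) = B_proj \<gamma> p \<otimes>\<^bsub>BR\<^esub> B_proj \<gamma> q"
  using ring_hom_mult[OF B_proj_hom] by simp

lemma B_proj_0: "B_proj \<gamma> 0 = \<zero>\<^bsub>BR\<^esub>"
proof -
  interpret A: cring AR by (rule A_cring)
  interpret B: cring BR by (rule B_cring)
  have "B_proj \<gamma> 0 \<oplus>\<^bsub>BR\<^esub> B_proj \<gamma> 0 = B_proj \<gamma> 0"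
    using B_proj_add[of 0 0] by simp
  then show ?thesis using B_proj_closed[of 0] by (metis B.add.l_cancel_one polys_0)
qed

lemma B_proj_add_pow:
  assumes "p \<in> polys all_vars"
  shows "[(n::nat)] \<cdot>\<^bsub>BR\<^esub> B_proj \<gamma> p = B_proj \<gamma> (of_nat n * p)"
proof -
  interpret B: cring BR by (rule B_cring)
  have "of_nat n * p \<in> polys all_vars" for n
    unfolding of_nat_Const by (intro polys_mult polys_Const assms)
  then show ?thesis
  proof (induction n)
    case (Suc n)
    then show ?case
      using B.a_comm[OF B_proj_closed[OF assms] B_proj_closed[of "of_nat n * p"]]
      by (simp add: B_proj_add assms distrib_right)
  qed (simp add: B_proj_0)
qed

text \<open>The coefficient of t in the coaction is a derivation \<delta> of \<open>B\<close> over
  \<open>A\<close>, and the coaction law forces n! times the n-th coefficient to be \<delta>^n. So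
  an action is the exponential of its derivation, and lifting the derivation lifts the
  action.\<close>

lemma Ga_action_extends:
  assumes nu: "Ga_action BR (\<lambda>a. B_proj \<gamma> (Const a)) \<nu>"
  shows "\<exists>\<mu>. Ga_action AR Const \<mu> \<and> Ga_restricts AR (B_proj \<gamma>) \<mu> \<nu>"
proof -
  interpret A: cring AR by (rule A_cring)
  interpret B: cring BR by (rule B_cring)
  let ?V = "polys all_vars" and ?\<pi> = "B_proj \<gamma>"
  define \<delta> where "\<delta> b = \<nu> b 1" for b
  have hom: "\<nu> \<in> ring_hom BR (UP BR)"
    and nu_const: "\<nu> (?\<pi> (Const a)) = up_ring.monom (UP BR) (?\<pi> (Const a)) 0"
    and nu_0: "b \<in> carrier BR \<Longrightarrow> eval BR BR (\<lambda>c. c) \<zero>\<^bsub>BR\<^esub> (\<nu> b) = b"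
    and nu_co: "b \<in> carrier BR \<Longrightarrow> UP_map BR \<nu> (\<nu> b) = Ga_comult BR (\<nu> b)" for a b
    using nu unfolding Ga_action_def by blast+
  have nu_car: "\<nu> b \<in> carrier (UP BR)" if "b \<in> carrier BR" for b
    using ring_hom_closed[OF hom that] .
  then have nu_up: "\<nu> b \<in> up BR" if "b \<in> carrier BR" for b
    using that by (simp add: UP_def)
  have nu_n: "\<nu> b n \<in> carrier BR" if "b \<in> carrier BR" for b n
    using nu_up[OF that] by (rule mem_upD)
  have nu_at0: "\<nu> b 0 = b" if "b \<in> carrier BR" for b
    using eval_at_zero[OF B_cring nu_car[OF that]] nu_0[OF that] by simp
  have \<delta>_car: "\<delta> b \<in> carrier BR" if "b \<in> carrier BR" for b
    unfolding \<delta>_def using nu_n[OF that] .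
  have \<delta>_add: "\<delta> (b \<oplus>\<^bsub>BR\<^esub> c) = \<delta> b \<oplus>\<^bsub>BR\<^esub> \<delta> c" if "b \<in> carrier BR" "c \<in> carrier BR" for b c
    unfolding \<delta>_def ring_hom_add[OF hom that] using nu_up that by (simp add: UP_def)
  have \<delta>_mult: "\<delta> (b \<otimes>\<^bsub>BR\<^esub> c) = b \<otimes>\<^bsub>BR\<^esub> \<delta> c \<oplus>\<^bsub>BR\<^esub> \<delta> b \<otimes>\<^bsub>BR\<^esub> c"
    if "b \<in> carrier BR" "c \<in> carrier BR" for b c
  proof -
    have "\<nu> (b \<otimes>\<^bsub>BR\<^esub> c) 1 = (\<Oplus>\<^bsub>BR\<^esub>i\<in>{..1}. \<nu> b i \<otimes>\<^bsub>BR\<^esub> \<nu> c (1 - i))"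
      unfolding ring_hom_mult[OF hom that] using nu_up that by (simp add: UP_def)
    also have "{..1::nat} = {0, 1}" by auto
    finally show ?thesis
      using nu_n that nu_at0 by (simp add: \<delta>_def B.a_comm)
  qed
  have \<delta>_Const: "\<delta> (?\<pi> (Const a)) = \<zero>\<^bsub>BR\<^esub>" for a
    unfolding \<delta>_def nu_const using B_proj_closed[of "Const a"] by (simp add: UP_def)
  have \<delta>_0: "\<delta> \<zero>\<^bsub>BR\<^esub> = \<zero>\<^bsub>BR\<^esub>"
    using \<delta>_Const[of 0] by (simp add: Const.zero B_proj_0)
  have \<delta>_add_pow: "\<delta> ([(k::nat)] \<cdot>\<^bsub>BR\<^esub> b) = [k] \<cdot>\<^bsub>BR\<^esub> \<delta> b" if "b \<in> carrier BR" for b k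
    by (induction k) (simp_all add: \<delta>_0 \<delta>_add that)
  \<comment> \<open>The coefficient of s^n t in the law for s + t, where the binomial coefficient is
    n+1.\<close>
  have \<delta>_nu: "\<delta> (\<nu> b n) = [Suc n] \<cdot>\<^bsub>BR\<^esub> \<nu> b (Suc n)" if "b \<in> carrier BR" for b n
  proof -
    have "\<nu> (\<nu> b n) 1 = UP_map BR \<nu> (\<nu> b) n 1"
      unfolding UP_map_def UP_apply[OF nu_car[OF that]] ..
    also have "\<dots> = [((n + 1) choose n)] \<cdot>\<^bsub>BR\<^esub> \<nu> b (n + 1)"
      unfolding nu_co[OF that] by (rule Ga_comult_coeff[OF B_cring nu_car[OF that]])
    also have "(n + 1) choose n = Suc n" by simp
    finally show ?thesis by (simp add: \<delta>_def)
  qed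
  \<comment> \<open>Any representative \<open>E\<close> of \<delta> is allowed, since both the
    chosen \<open>D0\<close> and the lifted derivation are iterated.\<close>
  have iterate: "?\<pi> ((E ^^ n) p) = [(fact n :: nat)] \<cdot>\<^bsub>BR\<^esub> \<nu> (?\<pi> p) n \<and> (E ^^ n) p \<in> ?V"
    if E: "\<And>x. x \<in> ?V \<Longrightarrow> E x \<in> ?V \<and> ?\<pi> (E x) = \<delta> (?\<pi> x)" and p: "p \<in> ?V" for E p n
  proof (induction n)
    case 0
    show ?case using p nu_at0 nu_n B_proj_closed by simp
  next
    case (Suc n)
    have b: "?\<pi> p \<in> carrier BR" using B_proj_closed p by blast
    have "?\<pi> (E ((E ^^ n) p)) = [(fact n :: nat)] \<cdot>\<^bsub>BR\<^esub> ([Suc n] \<cdot>\<^bsub>BR\<^esub> \<nu> (?\<pi> p) (Suc n))"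
      using E Suc \<delta>_add_pow[OF nu_n[OF b]] \<delta>_nu[OF b] by simp
    also have "\<dots> = [(fact (Suc n) :: nat)] \<cdot>\<^bsub>BR\<^esub> \<nu> (?\<pi> p) (Suc n)"
      using B.add.nat_pow_pow[OF nu_n[OF b]] by (simp only: fact_Suc of_nat_id mult.commute)
    finally show ?case using E Suc by simp
  qed
  define D0 where "D0 p = (if p \<in> ?V then (SOME q. q \<in> ?V \<and> ?\<pi> q = \<delta> (?\<pi> p)) else 0)" for p
  have D0: "D0 p \<in> ?V \<and> ?\<pi> (D0 p) = \<delta> (?\<pi> p)" if p: "p \<in> ?V" for p
  proof -
    have "\<exists>q. q \<in> ?V \<and> ?\<pi> q = \<delta> (?\<pi> p)"
      using B_proj_surj[OF \<delta>_car[OF B_proj_closed[OF p]]] by auto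
    from someI_ex[OF this] show ?thesis using p by (simp add: D0_def)
  qed
  interpret derivation_mod \<gamma> D0
  proof
    fix p q assume p: "p \<in> ?V" and q: "q \<in> ?V"
    note c = B_proj_closed[OF p] B_proj_closed[OF q]
    have "?\<pi> (D0 (p + q)) = ?\<pi> (D0 p + D0 q)"
      using D0 p q c polys_add[OF p q] by (simp add: B_proj_closed B_proj_add B_proj_mult \<delta>_add)
    then show "D0 (p + q) - (D0 p + D0 q) \<in> II"
      using D0 p q polys_add by (subst (asm) B_proj_eq) auto
    have "?\<pi> (D0 (p * q)) = ?\<pi> (p * D0 q + q * D0 p)"
      using D0 p q c polys_mult \<delta>_car by (simp add: B_proj_closed B_proj_add B_proj_mult \<delta>_mult B.m_comm polys_mult)
    moreover have "D0 (p * q) \<in> ?V" "p * D0 q + q * D0 p \<in> ?V"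
      using D0[OF p] D0[OF q] D0[OF polys_mult[OF p q]] p q by (auto intro: polys_add polys_mult)
    ultimately show "D0 (p * q) - (p * D0 q + q * D0 p) \<in> II"
      by (simp only: B_proj_eq)
  next
    fix a :: "complex poly"
    have "?\<pi> (D0 (Const a)) = ?\<pi> 0" using D0[of "Const a"] \<delta>_Const by (simp add: B_proj_0)
    then show "D0 (Const a) \<in> II" using D0[of "Const a"] B_proj_eq[of "D0 (Const a)" 0] by simp
  next
    fix p assume p: "p \<in> ?V" "p \<in> II"
    then have "?\<pi> p = ?\<pi> 0" using B_proj_eq[of p 0] by simp
    then have "?\<pi> (D0 p) = ?\<pi> 0" using D0[OF p(1)] \<delta>_0 by (simp add: B_proj_0)
    then show "D0 p \<in> II" using D0[OF p(1)] B_proj_eq[of "D0 p" 0] by simp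
  next
    have X: "X None \<in> ?V" by (rule polys_X) (simp add: all_vars_def)
    have "\<nu> (?\<pi> (X None)) \<in> up BR" by (rule nu_up[OF B_proj_closed[OF X]])
    \<comment> \<open>Nilpotency comes from the fact that the coaction takes polynomial values: the
      coefficients of the image of X_0 vanish beyond m.\<close>
    then obtain m where "bound \<zero>\<^bsub>BR\<^esub> m (\<nu> (?\<pi> (X None)))" by (auto simp: up_def)
    then have "\<nu> (?\<pi> (X None)) (Suc m) = \<zero>\<^bsub>BR\<^esub>" by (auto dest: bound.bound)
    then have "?\<pi> ((D0 ^^ Suc m) (X None)) = ?\<pi> 0"
      using iterate[OF D0 X, of "Suc m"] by (simp add: B_proj_0 del: funpow.simps)
    then have "(D0 ^^ Suc m) (X None) \<in> II"
      using B_proj_eq[OF conjunct2[OF iterate[OF D0 X]] polys_0] unfolding diff_zero by blast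
    then show "\<exists>n. (D0 ^^ n) (X None) \<in> II" by blast
  qed (use D0 in blast)
  obtain d where dV: "\<And>v. v \<in> all_vars \<Longrightarrow> d v \<in> ?V"
    and dD: "\<And>p. p \<in> ?V \<Longrightarrow> der d p - D0 p \<in> II"
    and dn: "\<And>p. p \<in> ?V \<Longrightarrow> \<exists>n. (der d ^^ n) p = 0"
    using derivation_lift by blast
  have der_V: "der d p \<in> ?V" if "p \<in> ?V" for p
    by (rule der_polys[OF that subset_refl dV])
  have der_\<pi>: "der d p \<in> ?V \<and> ?\<pi> (der d p) = \<delta> (?\<pi> p)" if "p \<in> ?V" for p
    using B_proj_eq[OF der_V[OF that], of "D0 p"] dD[OF that] D0[OF that] der_V[OF that] by simp
  have it: "?\<pi> ((der d ^^ n) p) = [(fact n :: nat)] \<cdot>\<^bsub>BR\<^esub> \<nu> (?\<pi> p) n \<and> (der d ^^ n) p \<in> ?V"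
    if "p \<in> ?V" for p n
    by (rule iterate[OF _ that]) (rule der_\<pi>)
  have dpV: "divpow d n p \<in> ?V" if "p \<in> ?V" for n p
    unfolding divpow_def using it[OF that] by (intro polys_mult polys_Const) blast
  \<comment> \<open>The exponential of the lifted derivation: the coefficient of t^n is D^n /
    n!.\<close>
  define \<mu> where "\<mu> p = (\<lambda>n. divpow d n p)" for p
  have mu_up: "\<mu> p \<in> up AR" if p: "p \<in> ?V" for p
  proof -
    obtain n where n: "(der d ^^ n) p = 0" using dn[OF p] by blast
    have "divpow d m p = 0" if "n < m" for m
      unfolding divpow_eq_0_iff by (rule nilpotent_mono[OF n]) (use that in simp)
    then have "bound \<zero>\<^bsub>AR\<^esub> n (\<mu> p)" by (auto simp: \<mu>_def)
    then show ?thesis using dpV[OF p] by (auto simp: \<mu>_def up_def)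
  qed
  then have mu_car: "\<mu> p \<in> carrier (UP AR)" if "p \<in> ?V" for p
    using that by (simp add: UP_def)
  have mu_Const: "\<mu> (Const a) = (\<lambda>n. if n = 0 then Const a else 0)" for a
  proof
    fix n show "\<mu> (Const a) n = (if n = 0 then Const a else 0)"
    proof (cases n)
      case (Suc m)
      have "(der d ^^ n) (Const a) = 0"
        unfolding Suc funpow_Suc_right by (simp add: der_funpow_0)
      then show ?thesis using Suc by (simp add: \<mu>_def divpow_eq_0_iff)
    qed (simp add: \<mu>_def)
  qed
  have "\<mu> \<in> ring_hom AR (UP AR)"
  proof (rule ring_hom_memI)
    fix p q assume p: "p \<in> carrier AR" and q: "q \<in> carrier AR"
    show "\<mu> p \<in> carrier (UP AR)" using mu_car p by simp
    show "\<mu> (p \<oplus>\<^bsub>AR\<^esub> q) = \<mu> p \<oplus>\<^bsub>UP AR\<^esub> \<mu> q"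
      using p q mu_up by (simp add: UP_def \<mu>_def divpow_add)
    have "finsum AR (\<lambda>i. \<mu> p i \<otimes>\<^bsub>AR\<^esub> \<mu> q (n - i)) {..n} = \<mu> (p * q) n" for n
      using p q dpV by (subst A_finsum) (auto simp: \<mu>_def divpow_mult intro: polys_mult)
    then show "\<mu> (p \<otimes>\<^bsub>AR\<^esub> q) = \<mu> p \<otimes>\<^bsub>UP AR\<^esub> \<mu> q"
      using p q mu_up by (auto simp: UP_def)
  next
    show "\<mu> \<one>\<^bsub>AR\<^esub> = \<one>\<^bsub>UP AR\<^esub>"
      using mu_Const[of 1] by (auto simp: UP_def Const.one)
  qed
  moreover have "\<mu> (Const a) = up_ring.monom (UP AR) (Const a) 0" for a
    by (rule ext) (simp add: mu_Const UP_def)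
  moreover have "eval AR AR (\<lambda>c. c) \<zero>\<^bsub>AR\<^esub> (\<mu> p) = p" if "p \<in> carrier AR" for p
    using eval_at_zero[OF A_cring mu_car] that by (simp add: \<mu>_def)
  moreover have "UP_map AR \<mu> (\<mu> p) = Ga_comult AR (\<mu> p)" if p: "p \<in> carrier AR" for p
  proof (intro ext)
    fix n k
    have pV: "p \<in> ?V" using p by simp
    have "UP_map AR \<mu> (\<mu> p) n k = divpow d k (divpow d n p)"
      unfolding UP_map_def UP_apply[OF mu_car[OF pV]] by (simp add: \<mu>_def)
    also have "\<dots> = of_nat ((n + k) choose n) * divpow d (n + k) p"
      by (rule divpow_divpow)
    also have "\<dots> = [((n + k) choose n)] \<cdot>\<^bsub>AR\<^esub> \<mu> p (n + k)"
      using dpV[OF pV] by (simp add: A_add_pow \<mu>_def)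
    also have "\<dots> = Ga_comult AR (\<mu> p) n k"
      using Ga_comult_coeff[OF A_cring mu_car[OF pV]] by simp
    finally show "UP_map AR \<mu> (\<mu> p) n k = Ga_comult AR (\<mu> p) n k" .
  qed
  ultimately have "Ga_action AR Const \<mu>" unfolding Ga_action_def by blast
  moreover have "Ga_restricts AR (B_proj \<gamma>) \<mu> \<nu>"
    unfolding Ga_restricts_def
  proof (intro ballI ext)
    fix p n assume "p \<in> carrier AR"
    then have p: "p \<in> ?V" by simp
    have b: "?\<pi> p \<in> carrier BR" by (rule B_proj_closed[OF p])
    \<comment> \<open>Scalars act on \<open>B\<close> through polynomials, so division by n! is
      carried out on a representative of the n-th coefficient.\<close>
    obtain y where y: "y \<in> ?V" "\<nu> (?\<pi> p) n = ?\<pi> y" using B_proj_surj[OF nu_n[OF b]] by blast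
    let ?c = "Const [:1 / fact n:] :: 'n apoly"
    have fy: "of_nat (fact n) * y \<in> ?V" unfolding of_nat_Const by (intro polys_mult polys_Const y)
    have "?\<pi> ((der d ^^ n) p) = ?\<pi> (of_nat (fact n) * y)"
      using it[OF p, of n] B_proj_add_pow[OF y(1), of "fact n"] y(2) by simp
    then have "?\<pi> (divpow d n p) = ?\<pi> (?c * (of_nat (fact n) * y))"
      unfolding divpow_def using it[OF p, of n] fy by (simp add: B_proj_closed B_proj_add B_proj_mult)
    also have "?c * (of_nat (fact n) * y) = y"
    proof -
      have "?c * Const [:of_nat (fact n):] = 1"
        by (simp add: Const.one flip: Const.mult one_pCons)
      then show ?thesis unfolding of_nat_Const by (simp flip: mult.assoc)
    qed
    finally show "UP_map AR (B_proj \<gamma>) (\<mu> p) n = \<nu> (B_proj \<gamma> p) n"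
      unfolding UP_map_def UP_apply[OF mu_car[OF p]] using y(2) by (simp add: \<mu>_def)
  qed
  ultimately show ?thesis by blast
qed

end

theorem theorem0p3:
  fixes \<gamma> :: "'n fl_tree"
    and \<nu> :: "'n apoly set \<Rightarrow> nat \<Rightarrow> 'n apoly set"
  assumes "fine_labelled_rooted_tree \<gamma>"
    and "Ga_action (B_ring \<gamma>) (\<lambda>a. B_proj \<gamma> (Const a)) \<nu>"
  shows "\<exists>\<mu> :: 'n apoly \<Rightarrow> nat \<Rightarrow> 'n apoly.
           Ga_action (A_ring \<gamma>) Const \<mu> \<and> Ga_restricts (A_ring \<gamma>) (B_proj \<gamma>) \<mu> \<nu>"
proof -
  interpret fl_rooted_tree \<gamma> by unfold_locales (rule assms(1))
  show ?thesis by (rule Ga_action_extends[OF assms(2)])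
qed

end
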